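(* Let $\lambda\in\mathcal M$ and $\mu$ be nonzero finite even Borel measures on $S^{n-1}$ not concentrated on any great subsphere, and let $\Psi\in\mathcal C$ with $\Psi(\xi,t)=\Psi(-\xi,t)$ for all $(\xi,t)$. (i) If $\Psi\in\mathscr G_I$, then there exists $K\in\mathscr K^n_e$ with $\frac{\mu}{|\mu|}=\frac{\widetilde J_{\Psi,\lambda}(K,\cdot)}{\widetilde J_{\Psi,\lambda}(K,S^{n-1})}$. If in addition $\lambda$ is strictly positive on nonempty open subsets of $S^{n-1}$, then for a nonzero finite even Borel measure $\mu$, being not concentrated on any great subsphere is also necessary for this identity to hold for some $K\in\mathscr K^n_e$. (ii) If in addition $\mu$ vanishes on great subspheres, there is a constant $C\in(-\infty,\infty)$ with $\inf_{v\in S^{n-1}}\int_{S^{n-1}}\log|v\cdot\xi|\,d\lambda(\xi)>C$, and $\Psi\in\mathcal C_d$, then there exists $K\in\mathscr K^n_e$ with $\frac{\mu}{|\mu|}=\frac{\widetilde J_{\Psi,\lambda}(K,\cdot)}{\widetilde J_{\Psi,\lambda}(K,S^{n-1})}$.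
   Context: $S^{n-1}$ unit sphere of $\mathbb R^n$, $n\ge2$, $d\xi$ spherical Lebesgue measure, $|\mu|=\mu(S^{n-1})$. Even measure: $\mu(-\omega)=\mu(\omega)$. Not concentrated on any great subsphere: $\mu(S^{n-1}\setminus v^\perp)>0$ for all $v$; vanishes on great subspheres: $\mu(S^{n-1}\cap v^\perp)=0$ for all $v$. $\mathscr K^n_{(o)}$: compact convex sets with the origin in their interior; $\mathscr K^n_e$: origin-symmetric members. For $K$: $h_K(x)=\max\{x\cdot y:y\in K\}$, $\rho_K(x)=\max\{t\ge0:tx\in K\}$; $\pmb\alpha_K(\xi)$ set of outer unit normals at $\rho_K(\xi)\xi$, singleton $\{\alpha_K(\xi)\}$ a.e.; $\pmb\alpha^*_K(\omega)=\{\xi:\pmb\alpha_K(\xi)\cap\omega\ne\emptyset\}$. $\mathcal C$: $\Psi:S^{n-1}\times(0,\infty)\to\mathbb R$ with $\Psi,\Psi_t$ continuous; $\mathcal C_d=\{\Psi_t<0\}$. $\mathscr G_I$: positive $\Psi\in\mathcal C$ with, for each $u$, $\Psi_t(u,\cdot)>0$, $\lim_{t\to0^+}\Psi(u,t)=0$, $\lim_{t\to\infty}\Psi(u,t)=\infty$. $\mathcal M$: nonzero finite Borel measures absolutely continuous w.r.t. $d\xi$. $\widetilde J_{\Psi,\lambda}(K,\omega)=\int_{\pmb\alpha^*_K(\omega)}\frac{d\lambda(\xi)}{h_K(\alpha_K(\xi))\Psi_t(\alpha_K(\xi),h_K(\alpha_K(\xi)))}$. *)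

theory Defs
  imports "HOL-Analysis.Analysis"
begin

definition sphere_borel :: "'a::euclidean_space measure" where
  "sphere_borel = restrict_space borel (sphere 0 1)"

text \<open>Spherical Lebesgue measure: n times the push-forward of Lebesgue measure on the
  punctured unit ball under radial projection (i.e. sigma(A) = n * vol(cone over A)).\<close>
definition spherical_lebesgue :: "'a::euclidean_space measure" where
  "spherical_lebesgue =
     scale_measure (of_nat DIM('a))
       (distr (restrict_space lborel (cball 0 1 - {0})) sphere_borel (\<lambda>x. x /\<^sub>R norm x))"

definition borel_on_sphere :: "'a::euclidean_space measure \<Rightarrow> bool" where
  "borel_on_sphere \<mu> \<longleftrightarrow> sets \<mu> = sets (sphere_borel :: 'a measure)"

definition nonzero_finite_borel :: "'a::euclidean_space measure \<Rightarrow> bool" where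
  "nonzero_finite_borel \<mu> \<longleftrightarrow> borel_on_sphere \<mu> \<and> finite_measure \<mu>
     \<and> emeasure \<mu> (sphere 0 1) \<noteq> 0"

definition even_measure :: "'a::euclidean_space measure \<Rightarrow> bool" where
  "even_measure \<mu> \<longleftrightarrow> (\<forall>A\<in>sets \<mu>. emeasure \<mu> (uminus ` A) = emeasure \<mu> A)"

definition not_concentrated :: "'a::euclidean_space measure \<Rightarrow> bool" where
  "not_concentrated \<mu> \<longleftrightarrow>
     (\<forall>v\<in>sphere 0 1. emeasure \<mu> (sphere 0 1 - {x. v \<bullet> x = 0}) > 0)"

definition vanishes_on_great_subspheres :: "'a::euclidean_space measure \<Rightarrow> bool" where
  "vanishes_on_great_subspheres \<mu> \<longleftrightarrow>
     (\<forall>v\<in>sphere 0 1. emeasure \<mu> (sphere 0 1 \<inter> {x. v \<bullet> x = 0}) = 0)"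

definition class_M :: "'a::euclidean_space measure \<Rightarrow> bool" where
  "class_M lam \<longleftrightarrow> nonzero_finite_borel lam \<and> absolutely_continuous spherical_lebesgue lam"

definition strictly_positive_on_open :: "'a::euclidean_space measure \<Rightarrow> bool" where
  "strictly_positive_on_open lam \<longleftrightarrow>
     (\<forall>U. openin (top_of_set (sphere 0 1)) U \<and> U \<noteq> {} \<longrightarrow> emeasure lam U > 0)"

definition Kn_o :: "'a::euclidean_space set \<Rightarrow> bool" where
  "Kn_o K \<longleftrightarrow> compact K \<and> convex K \<and> 0 \<in> interior K"

definition Kn_e :: "'a::euclidean_space set \<Rightarrow> bool" where
  "Kn_e K \<longleftrightarrow> Kn_o K \<and> (\<forall>x\<in>K. - x \<in> K)"

definition support_fun :: "'a::euclidean_space set \<Rightarrow> 'a \<Rightarrow> real" where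
  "support_fun K x = Sup ((\<lambda>y. x \<bullet> y) ` K)"

definition radial_fun :: "'a::euclidean_space set \<Rightarrow> 'a \<Rightarrow> real" where
  "radial_fun K x = Sup {t. t \<ge> 0 \<and> t *\<^sub>R x \<in> K}"

definition outer_normals :: "'a::euclidean_space set \<Rightarrow> 'a \<Rightarrow> 'a set" where
  "outer_normals K \<xi> = {u \<in> sphere 0 1. \<forall>y\<in>K. u \<bullet> y \<le> u \<bullet> (radial_fun K \<xi> *\<^sub>R \<xi>)}"

definition regular_dir :: "'a::euclidean_space set \<Rightarrow> 'a \<Rightarrow> bool" where
  "regular_dir K \<xi> \<longleftrightarrow> (\<exists>u. outer_normals K \<xi> = {u})"

definition radial_gauss :: "'a::euclidean_space set \<Rightarrow> 'a \<Rightarrow> 'a" where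
  "radial_gauss K \<xi> = (THE u. outer_normals K \<xi> = {u})"

definition rev_radial_gauss :: "'a::euclidean_space set \<Rightarrow> 'a set \<Rightarrow> 'a set" where
  "rev_radial_gauss K \<omega> = {\<xi> \<in> sphere 0 1. outer_normals K \<xi> \<inter> \<omega> \<noteq> {}}"

definition psi_t :: "('a \<Rightarrow> real \<Rightarrow> real) \<Rightarrow> 'a \<Rightarrow> real \<Rightarrow> real" where
  "psi_t \<Psi> u t = deriv (\<Psi> u) t"

definition class_C :: "('a::euclidean_space \<Rightarrow> real \<Rightarrow> real) \<Rightarrow> bool" where
  "class_C \<Psi> \<longleftrightarrow>
     (\<forall>u\<in>sphere 0 1. \<forall>t>0. \<Psi> u differentiable (at t)) \<and>
     continuous_on (sphere 0 1 \<times> {0<..}) (\<lambda>(u, t). \<Psi> u t) \<and>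
     continuous_on (sphere 0 1 \<times> {0<..}) (\<lambda>(u, t). psi_t \<Psi> u t)"

definition class_Cd :: "('a::euclidean_space \<Rightarrow> real \<Rightarrow> real) \<Rightarrow> bool" where
  "class_Cd \<Psi> \<longleftrightarrow> class_C \<Psi> \<and> (\<forall>u\<in>sphere 0 1. \<forall>t>0. psi_t \<Psi> u t < 0)"

definition class_GI :: "('a::euclidean_space \<Rightarrow> real \<Rightarrow> real) \<Rightarrow> bool" where
  "class_GI \<Psi> \<longleftrightarrow> class_C \<Psi> \<and>
     (\<forall>u\<in>sphere 0 1. \<forall>t>0. \<Psi> u t > 0) \<and>
     (\<forall>u\<in>sphere 0 1. \<forall>t>0. psi_t \<Psi> u t > 0) \<and>
     (\<forall>u\<in>sphere 0 1. (\<Psi> u \<longlongrightarrow> 0) (at_right 0) \<and> filterlim (\<Psi> u) at_top at_top)"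

text \<open>J~_{Psi,lambda}(K, omega). The integrand uses alpha_K at the (full-measure) set of
  regular directions and is set to 0 on the null set of non-regular directions.\<close>
definition J_tilde :: "('a::euclidean_space \<Rightarrow> real \<Rightarrow> real) \<Rightarrow> 'a measure \<Rightarrow> 'a set \<Rightarrow> 'a set \<Rightarrow> real" where
  "J_tilde \<Psi> lam K \<omega> =
     set_lebesgue_integral lam (rev_radial_gauss K \<omega>)
       (\<lambda>\<xi>. if regular_dir K \<xi> then
               1 / (support_fun K (radial_gauss K \<xi>) *
                    psi_t \<Psi> (radial_gauss K \<xi>) (support_fun K (radial_gauss K \<xi>)))
             else 0)"

definition solves_eq :: "('a::euclidean_space \<Rightarrow> real \<Rightarrow> real) \<Rightarrow> 'a measure \<Rightarrow> 'a measure \<Rightarrow> 'a set \<Rightarrow> bool" where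
  "solves_eq \<Psi> lam \<mu> K \<longleftrightarrow>
     (\<forall>\<omega>\<in>sets \<mu>. measure \<mu> \<omega> / measure \<mu> (sphere 0 1)
                 = J_tilde \<Psi> lam K \<omega> / J_tilde \<Psi> lam K (sphere 0 1))"

text \<open>int_{S^{n-1}} log|v.xi| d lambda(xi), as an extended real (values in [-inf,0]).\<close>
definition log_integral :: "'a::euclidean_space measure \<Rightarrow> 'a \<Rightarrow> ereal" where
  "log_integral lam v =
     - enn2ereal (\<integral>\<^sup>+ \<xi>. (if v \<bullet> \<xi> = 0 then \<infinity> else ennreal (- ln \<bar>v \<bullet> \<xi>\<bar>)) \<partial>lam)"

end

theory Submission
  imports Defs "HOL-Complex_Analysis.Great_Picard"
begin

text \<open>
  Put \<open>G = \<Psi>\<close> in (i) and \<open>G = - \<Psi>\<close> in (ii), so that \<open>G\<close> is strictly increasing in \<open>t\<close>. The body is the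
  Wulff shape of a positive even continuous function \<open>h\<close> that maximises \<open>\<integral> log \<rho> d\<lambda>\<close> subject to
  \<open>\<integral> G(u, h(u)) d\<mu> \<le> \<integral> G(u, 1) d\<mu>\<close>; we work with the gauge \<open>1 / \<rho>\<close>, the maximum of \<open>(u \<bullet> x) / h u\<close>
  over the sphere. Replacing \<open>h\<close> by the support function of its Wulff shape keeps \<open>\<rho>\<close> and relaxes the
  constraint, so maximisers are sought among support functions. The trial value at the unit ball is \<open>0\<close>,
  and competitors that are at least as good lie between two fixed balls: in (i) the constraint bounds the
  outer radius, because \<open>\<mu>\<close> is not concentrated and \<open>G\<close> grows to infinity, and then \<open>\<lambda>\<close> bounds the inner
  one; in (ii) the logarithmic integral bounds the inner radius, and then the constraint bounds the outer
  one, because the support functions of ever longer bodies tend to infinity \<open>\<mu>\<close>-almost everywhere.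

  Arzela--Ascoli gives a maximiser. Perturbing it to \<open>h exp(t f)\<close> changes \<open>log \<rho>(\<xi>)\<close> to first order by
  \<open>t f(\<alpha>(\<xi>))\<close> wherever the normal \<open>\<alpha>(\<xi>)\<close> is unique, so \<open>\<integral> f(\<alpha>) d\<lambda>\<close> is proportional to
  \<open>\<integral> f h G_t(u, h) d\<mu>\<close>, which is the asserted identity of measures. Almost every direction has a unique
  normal: subgradients of the gauge are monotone along lines, hence have a unique component along the line
  off a countable set, and Fubini applies.
\<close>

section \<open>Wulff shapes and their gauges\<close>

text \<open>The obstacle is that a small perturbation of a support function is in general not a
  support function. Varying over all positive even continuous \<open>h\<close> removes it, because
  \<open>wulff\<close> turns any competitor into a body. Monotonicity of \<open>G\<close> makes the
  return to support functions harmless, since the support function of the Wulff shape lies below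
  \<open>h\<close>. The constraint is an inequality, so perturbations that decrease it to first
  order stay admissible, without any exact correction. The weight \<open>h * G_t\<close> produced by
  \<open>h exp(t f)\<close> is the reciprocal of the integrand of \<open>J_tilde\<close>; testing
  with \<open>f\<close> divided by this weight cancels it, and the proportionality constant drops
  out of the normalised quotient. Symmetry is what allows coercivity to rest on great subspheres
  alone: a far point of a body comes with its antipode, and such a pair makes the support function
  large away from a single hyperplane.\<close>

definition pos_even :: "('a::euclidean_space \<Rightarrow> real) \<Rightarrow> bool" where
  "pos_even h \<longleftrightarrow> continuous_on (sphere 0 1) h \<and> (\<forall>u\<in>sphere 0 1. h u > 0 \<and> h (- u) = h u)"

definition wulff :: "('a::euclidean_space \<Rightarrow> real) \<Rightarrow> 'a set" where
  "wulff h = {x. \<forall>u\<in>sphere 0 1. u \<bullet> x \<le> h u}"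

text \<open>For \<open>pos_even h\<close> this is the Minkowski functional of
  \<open>wulff h\<close>. Unlike the radial function it is finite and convex on the whole space, the
  origin included, as the arguments along lines require.\<close>

definition wulff_gauge :: "('a::euclidean_space \<Rightarrow> real) \<Rightarrow> 'a \<Rightarrow> real" where
  "wulff_gauge h x = (SUP u\<in>sphere 0 1. (u \<bullet> x) / h u)"

text \<open>Every half-space defining \<open>wulff h\<close> touches the body. Otherwise an outer
  normal \<open>u\<close> may fail to be a maximiser in the gauge, because \<open>h u\<close>
  exceeds the support value.\<close>

definition is_support :: "('a::euclidean_space \<Rightarrow> real) \<Rightarrow> bool" where
  "is_support h \<longleftrightarrow> pos_even h \<and> (\<forall>u\<in>sphere 0 1. support_fun (wulff h) u = h u)"

lemma sphere_nonempty: "sphere (0::'a::euclidean_space) 1 \<noteq> {}"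
  by simp

lemma pos_even_continuous: "pos_even h \<Longrightarrow> continuous_on (sphere 0 1) h"
  and pos_even_pos: "pos_even h \<Longrightarrow> u \<in> sphere 0 1 \<Longrightarrow> h u > 0"
  and pos_even_even: "pos_even h \<Longrightarrow> u \<in> sphere 0 1 \<Longrightarrow> h (- u) = h u"
  by (auto simp: pos_even_def)

lemma pos_even_bounds:
  assumes "pos_even (h :: 'a::euclidean_space \<Rightarrow> real)"
  obtains m M where "0 < m" "\<And>u. u \<in> sphere 0 1 \<Longrightarrow> m \<le> h u" "\<And>u. u \<in> sphere 0 1 \<Longrightarrow> h u \<le> M"
proof -
  have c: "continuous_on (sphere 0 1) h" using assms by (rule pos_even_continuous)
  obtain a where "a \<in> sphere 0 1" "\<forall>u\<in>sphere 0 1. h a \<le> h u"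
    using continuous_attains_inf[OF compact_sphere sphere_nonempty c] by auto
  moreover obtain b where "b \<in> sphere 0 1" "\<forall>u\<in>sphere 0 1. h u \<le> h b"
    using continuous_attains_sup[OF compact_sphere sphere_nonempty c] by auto
  ultimately show thesis using that[of "h a" "h b"] pos_even_pos[OF assms] by auto
qed

lemma wulff_gauge_attained:
  assumes "pos_even (h :: 'a::euclidean_space \<Rightarrow> real)"
  obtains u where "u \<in> sphere 0 1" "wulff_gauge h x = (u \<bullet> x) / h u"
    "\<And>w. w \<in> sphere 0 1 \<Longrightarrow> (w \<bullet> x) / h w \<le> wulff_gauge h x"
proof -
  have c: "continuous_on (sphere 0 1) (\<lambda>u. (u \<bullet> x) / h u)"
    using pos_even_continuous[OF assms] pos_even_pos[OF assms]
    by (intro continuous_intros) (auto simp: less_imp_neq[symmetric])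
  obtain u where u: "u \<in> sphere 0 1" "\<forall>w\<in>sphere 0 1. (w \<bullet> x) / h w \<le> (u \<bullet> x) / h u"
    using continuous_attains_sup[OF compact_sphere sphere_nonempty c] by auto
  have "wulff_gauge h x = (u \<bullet> x) / h u"
    unfolding wulff_gauge_def using u by (intro cSup_eq_maximum) auto
  then show thesis using that u by auto
qed

lemma wulff_gauge_upper:
  assumes "pos_even h" "u \<in> sphere 0 1"
  shows "u \<bullet> x \<le> wulff_gauge h x * h u"
proof -
  have "(u \<bullet> x) / h u \<le> wulff_gauge h x"
    using wulff_gauge_attained[OF assms(1)] assms(2) by metis
  then show ?thesis using pos_even_pos[OF assms] by (simp add: pos_divide_le_eq)
qed

lemma wulff_gauge_max:
  assumes "pos_even (h :: 'a::euclidean_space \<Rightarrow> real)"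
  obtains u where "u \<in> sphere 0 1" "u \<bullet> x = wulff_gauge h x * h u"
proof -
  obtain u where "u \<in> sphere 0 1" "wulff_gauge h x = (u \<bullet> x) / h u"
    using wulff_gauge_attained[OF assms] by metis
  then show thesis using that pos_even_pos[OF assms] by force
qed

lemma wulff_gauge_least:
  assumes "pos_even h" "\<And>u. u \<in> sphere 0 1 \<Longrightarrow> u \<bullet> x \<le> c * h u"
  shows "wulff_gauge h x \<le> c"
proof -
  obtain u where u: "u \<in> sphere 0 1" "u \<bullet> x = wulff_gauge h x * h u"
    using wulff_gauge_max[OF assms(1)] by metis
  then show ?thesis using assms(2)[of u] pos_even_pos[OF assms(1) u(1)] by simp
qed

lemma mem_wulff_iff:
  assumes "pos_even h"
  shows "x \<in> wulff h \<longleftrightarrow> wulff_gauge h x \<le> 1"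
proof
  assume "x \<in> wulff h"
  then show "wulff_gauge h x \<le> 1"
    by (intro wulff_gauge_least[OF assms]) (auto simp: wulff_def)
next
  assume g: "wulff_gauge h x \<le> 1"
  show "x \<in> wulff h" unfolding wulff_def
  proof safe
    fix u :: 'a assume u: "u \<in> sphere 0 1"
    have "u \<bullet> x \<le> wulff_gauge h x * h u" by (rule wulff_gauge_upper[OF assms u])
    also have "\<dots> \<le> 1 * h u" using g pos_even_pos[OF assms u] by (intro mult_right_mono) auto
    finally show "u \<bullet> x \<le> h u" by simp
  qed
qed

text \<open>The maximum is tested at \<open>u = sgn x\<close>, which is a unit vector only away from
  the origin; hence the disjunct \<open>x = 0\<close>.\<close>

lemma wulff_gauge_nonneg:
  assumes "pos_even h"
  shows "wulff_gauge h x \<ge> norm x * inverse (h (sgn x)) \<or> x = 0" and "wulff_gauge h x \<ge> 0"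
proof -
  show A: "wulff_gauge h x \<ge> norm x * inverse (h (sgn x)) \<or> x = 0"
  proof (cases "x = 0")
    case False
    then have s: "sgn x \<in> sphere 0 1" by (simp add: norm_sgn)
    have "sgn x \<bullet> x = norm x" using False by (simp add: sgn_div_norm dot_square_norm power2_eq_square)
    then show ?thesis using wulff_gauge_upper[OF assms s, of x] pos_even_pos[OF assms s]
      by (simp add: field_simps)
  qed simp
  show "wulff_gauge h x \<ge> 0"
  proof (cases "x = 0")
    case True
    then show ?thesis using wulff_gauge_attained[OF assms, of x] by (metis div_0 inner_zero_right order_refl)
  next
    case False
    then have s: "sgn x \<in> sphere 0 1" by (simp add: norm_sgn)
    have "0 \<le> norm x * inverse (h (sgn x))" using pos_even_pos[OF assms s] by simp
    then show ?thesis using A False by linarith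
  qed
qed

lemma wulff_gauge_zero [simp]:
  assumes "pos_even h"
  shows "wulff_gauge h 0 = 0"
  using wulff_gauge_attained[OF assms, of 0] by (metis div_0 inner_zero_right)

lemma wulff_gauge_pos:
  assumes "pos_even h" "x \<noteq> 0"
  shows "wulff_gauge h x > 0"
proof -
  have s: "sgn x \<in> sphere 0 1" using assms by (simp add: norm_sgn)
  have "0 < norm x * inverse (h (sgn x))" using pos_even_pos[OF assms(1) s] assms by simp
  then show ?thesis using wulff_gauge_nonneg(1)[OF assms(1), of x] assms(2) by linarith
qed

lemma wulff_gauge_scale:
  assumes "pos_even h" "c \<ge> 0"
  shows "wulff_gauge h (c *\<^sub>R x) = c * wulff_gauge h x"
proof -
  obtain u where u: "u \<in> sphere 0 1" "u \<bullet> x = wulff_gauge h x * h u"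
    using wulff_gauge_max[OF assms(1)] by metis
  have "c * wulff_gauge h x * h u \<le> wulff_gauge h (c *\<^sub>R x) * h u"
    using wulff_gauge_upper[OF assms(1) u(1), of "c *\<^sub>R x"] u by (simp add: mult.assoc)
  then have 1: "c * wulff_gauge h x \<le> wulff_gauge h (c *\<^sub>R x)"
    using pos_even_pos[OF assms(1) u(1)] by simp
  have "wulff_gauge h (c *\<^sub>R x) \<le> c * wulff_gauge h x"
  proof (rule wulff_gauge_least[OF assms(1)])
    fix w :: 'a assume "w \<in> sphere 0 1"
    then have "c * (w \<bullet> x) \<le> c * (wulff_gauge h x * h w)"
      using wulff_gauge_upper[OF assms(1)] assms(2) by (intro mult_left_mono) auto
    then show "w \<bullet> c *\<^sub>R x \<le> c * wulff_gauge h x * h w" by (simp add: mult.assoc)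
  qed
  then show ?thesis using 1 by simp
qed

lemma wulff_gauge_minus:
  assumes "pos_even h"
  shows "wulff_gauge h (- x) = wulff_gauge h x"
proof -
  have "wulff_gauge h (- x) \<le> wulff_gauge h x" for x
  proof (rule wulff_gauge_least[OF assms])
    fix w :: 'a assume w: "w \<in> sphere 0 1"
    then have "(- w) \<bullet> x \<le> wulff_gauge h x * h (- w)"
      by (intro wulff_gauge_upper[OF assms]) auto
    then show "w \<bullet> (- x) \<le> wulff_gauge h x * h w"
      using pos_even_even[OF assms w] by simp
  qed
  from this[of x] this[of "-x"] show ?thesis by simp
qed

text \<open>Each quotient \<open>(u \<bullet> x) / h u\<close> is Lipschitz in \<open>x\<close> with
  constant \<open>1 / h u \<le> 1 / m\<close>, and a supremum inherits the common constant.\<close>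

lemma wulff_gauge_lipschitz:
  assumes "pos_even h" "0 < m" "\<And>u. u \<in> sphere 0 1 \<Longrightarrow> m \<le> h u"
  shows "\<bar>wulff_gauge h x - wulff_gauge h y\<bar> \<le> norm (x - y) / m"
proof -
  have "wulff_gauge h x \<le> wulff_gauge h y + norm (x - y) / m" for x y
  proof (rule wulff_gauge_least[OF assms(1)])
    fix w :: 'a assume w: "w \<in> sphere 0 1"
    have "w \<bullet> x = w \<bullet> y + w \<bullet> (x - y)" by (simp add: inner_diff_right)
    also have "w \<bullet> (x - y) \<le> norm (x - y)"
      using norm_cauchy_schwarz[of w "x - y"] w by simp
    also have "norm (x - y) \<le> norm (x - y) / m * h w"
      using assms(2) assms(3)[OF w] by (simp add: pos_le_divide_eq mult_left_mono)
    finally show "w \<bullet> x \<le> (wulff_gauge h y + norm (x - y) / m) * h w"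
      using wulff_gauge_upper[OF assms(1) w, of y] by (simp add: distrib_right)
  qed
  from this[of x y] this[of y x] show ?thesis by (simp add: norm_minus_commute abs_le_iff)
qed

lemma wulff_gauge_continuous:
  assumes "pos_even h"
  shows "continuous_on UNIV (wulff_gauge h)"
proof -
  obtain m M where m: "0 < m" "\<And>u. u \<in> sphere 0 1 \<Longrightarrow> m \<le> h u"
    using pos_even_bounds[OF assms] by metis
  have "(1/m)-lipschitz_on UNIV (wulff_gauge h)"
    using wulff_gauge_lipschitz[OF assms m] m(1)
    by (intro lipschitz_onI) (auto simp: dist_real_def dist_norm)
  then show ?thesis by (rule lipschitz_on_continuous_on)
qed

text \<open>Comparison with balls: the upper bound is the Lipschitz estimate from the origin, the
  lower one tests the maximum at \<open>u = x\<close>.\<close>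

lemma wulff_gauge_bounds:
  assumes "pos_even h" "x \<in> sphere 0 1"
  shows "0 < m \<Longrightarrow> (\<And>u. u \<in> sphere 0 1 \<Longrightarrow> m \<le> h u) \<Longrightarrow> wulff_gauge h x \<le> 1 / m"
    and "(\<And>u. u \<in> sphere 0 1 \<Longrightarrow> h u \<le> M) \<Longrightarrow> 1 / M \<le> wulff_gauge h x"
proof -
  assume "0 < m" "\<And>u. u \<in> sphere 0 1 \<Longrightarrow> m \<le> h u"
  from wulff_gauge_lipschitz[OF assms(1) this, of x 0] show "wulff_gauge h x \<le> 1 / m"
    using assms by (auto simp: abs_le_iff)
next
  assume M: "\<And>u. u \<in> sphere 0 1 \<Longrightarrow> h u \<le> M"
  have s: "x \<bullet> x = 1" using assms(2) by (simp add: dot_square_norm)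
  have "1 \<le> wulff_gauge h x * h x" using wulff_gauge_upper[OF assms(1,2), of x] s by simp
  also have "\<dots> \<le> wulff_gauge h x * M"
    using M[OF assms(2)] wulff_gauge_nonneg(2)[OF assms(1)] by (intro mult_left_mono)
  finally have "1 \<le> wulff_gauge h x * M" .
  moreover have "M > 0" using M[OF assms(2)] pos_even_pos[OF assms] by linarith
  ultimately show "1 / M \<le> wulff_gauge h x" by (simp add: pos_divide_le_eq)
qed

lemma wulff_norm_le:
  assumes "pos_even h" "\<And>u. u \<in> sphere 0 1 \<Longrightarrow> h u \<le> M" "x \<in> wulff h"
  shows "norm x \<le> M"
proof (cases "x = 0")
  case True
  obtain u :: 'a where "u \<in> sphere 0 1" using sphere_nonempty by blast
  then show ?thesis using assms(2) pos_even_pos[OF assms(1)] True by fastforce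
next
  case False
  then have s: "sgn x \<in> sphere 0 1" by (simp add: norm_sgn)
  have "sgn x \<bullet> x = norm x" using False by (simp add: sgn_div_norm dot_square_norm power2_eq_square)
  then show ?thesis using assms(2)[OF s] assms(3) s by (force simp: wulff_def)
qed

lemma wulff_Kn_e:
  assumes "pos_even h"
  shows "Kn_e (wulff h)"
proof -
  obtain m M where m: "0 < m" "\<And>u. u \<in> sphere 0 1 \<Longrightarrow> m \<le> h u" "\<And>u. u \<in> sphere 0 1 \<Longrightarrow> h u \<le> M"
    using pos_even_bounds[OF assms] by metis
  have W: "wulff h = (\<Inter>u\<in>sphere 0 1. {x. u \<bullet> x \<le> h u})" by (auto simp: wulff_def)
  have cl: "closed (wulff h)" unfolding W by (intro closed_INT ballI closed_halfspace_le)
  have cv: "convex (wulff h)" unfolding W by (intro convex_INT convex_halfspace_le)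
  have "norm x \<le> M" if "x \<in> wulff h" for x
    by (rule wulff_norm_le[OF assms m(3) that])
  then have "bounded (wulff h)" by (auto simp: bounded_iff)
  then have cp: "compact (wulff h)" using cl by (simp add: compact_eq_bounded_closed)
  have "ball 0 m \<subseteq> wulff h"
  proof
    fix x :: 'a assume "x \<in> ball 0 m"
    then have x: "norm x < m" by simp
    show "x \<in> wulff h" unfolding wulff_def
    proof safe
      fix u :: 'a assume u: "u \<in> sphere 0 1"
      have "u \<bullet> x \<le> norm x" using norm_cauchy_schwarz[of u x] u by simp
      then show "u \<bullet> x \<le> h u" using x m(2)[OF u] by linarith
    qed
  qed
  then have i: "0 \<in> interior (wulff h)" using m(1) by (meson centre_in_ball interior_maximal open_ball subsetD)
  have "- x \<in> wulff h" if "x \<in> wulff h" for x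
    using that assms by (simp add: mem_wulff_iff wulff_gauge_minus)
  then show ?thesis using cp cv i by (auto simp: Kn_e_def Kn_o_def)
qed

lemma radial_fun_wulff:
  assumes "pos_even h" "x \<noteq> 0"
  shows "radial_fun (wulff h) x = 1 / wulff_gauge h x"
proof -
  have p: "wulff_gauge h x > 0" by (rule wulff_gauge_pos[OF assms])
  have "{t. t \<ge> 0 \<and> t *\<^sub>R x \<in> wulff h} = {0..1 / wulff_gauge h x}"
    using p assms(1) by (auto simp: mem_wulff_iff wulff_gauge_scale field_simps)
  then show ?thesis using p by (simp add: radial_fun_def)
qed

section \<open>Support functions of symmetric convex bodies\<close>

lemma Kn_e_bdd_above:
  assumes "Kn_e K"
  shows "bdd_above ((\<lambda>y. x \<bullet> y) ` K)"
proof -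
  have "compact ((\<lambda>y. x \<bullet> y) ` K)"
    using assms by (intro compact_continuous_image continuous_intros) (auto simp: Kn_e_def Kn_o_def)
  then show ?thesis by (simp add: bounded_imp_bdd_above compact_imp_bounded)
qed

lemma support_fun_upper:
  assumes "Kn_e K" "y \<in> K"
  shows "x \<bullet> y \<le> support_fun K x"
  unfolding support_fun_def using assms Kn_e_bdd_above by (intro cSup_upper) auto

lemma Kn_e_zero: "Kn_e K \<Longrightarrow> 0 \<in> K"
  using interior_subset by (auto simp: Kn_e_def Kn_o_def)

lemma support_fun_least:
  assumes "Kn_e K" "\<And>y. y \<in> K \<Longrightarrow> x \<bullet> y \<le> c"
  shows "support_fun K x \<le> c"
  unfolding support_fun_def using assms Kn_e_zero[OF assms(1)] by (intro cSup_least) auto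

text \<open>The constant is an outer radius of \<open>K\<close>; a common radius for a sequence of
  bodies thus makes their support functions equicontinuous.\<close>

lemma support_fun_lipschitz:
  assumes K: "Kn_e K" and R: "\<And>x. x \<in> K \<Longrightarrow> norm x \<le> R"
  shows "support_fun K x \<le> support_fun K y + R * norm (x - y)"
proof (rule support_fun_least[OF K])
  fix z assume z: "z \<in> K"
  have "x \<bullet> z = y \<bullet> z + (x - y) \<bullet> z" by (simp add: inner_diff_left)
  also have "(x - y) \<bullet> z \<le> norm (x - y) * norm z" by (rule norm_cauchy_schwarz)
  also have "\<dots> \<le> norm (x - y) * R" using R[OF z] by (intro mult_left_mono) auto
  finally show "x \<bullet> z \<le> support_fun K y + R * norm (x - y)"
    using support_fun_upper[OF K z, of y] by (simp add: mult.commute)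
qed

lemma pos_even_support_fun:
  assumes K: "Kn_e K"
  shows "pos_even (support_fun K)"
proof -
  have bd: "bounded K" using K by (auto simp: Kn_e_def Kn_o_def compact_imp_bounded)
  then obtain R where R: "R > 0" "\<And>x. x \<in> K \<Longrightarrow> norm x \<le> R" by (auto simp: bounded_pos)
  have le: "support_fun K x \<le> support_fun K y + R * norm (x - y)" for x y
    using support_fun_lipschitz[OF K R(2)] R(1) by simp
  have "R-lipschitz_on (sphere 0 1) (support_fun K)"
  proof (rule lipschitz_onI)
    fix x y :: 'a
    show "dist (support_fun K x) (support_fun K y) \<le> R * dist x y"
      using le[of x y] le[of y x] by (auto simp: dist_real_def dist_norm abs_le_iff norm_minus_commute)
  qed (use R in auto)
  then have c: "continuous_on (sphere 0 1) (support_fun K)" by (rule lipschitz_on_continuous_on)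
  obtain r where r: "r > 0" "cball 0 r \<subseteq> K"
    using K by (auto simp: Kn_e_def Kn_o_def mem_interior_cball)
  have "support_fun K u > 0" if u: "u \<in> sphere 0 1" for u
  proof -
    have "r *\<^sub>R u \<in> K" using r u by auto
    from support_fun_upper[OF K this, of u] have "r \<le> support_fun K u"
      using u by (simp add: dot_square_norm)
    then show ?thesis using r by simp
  qed
  moreover have "support_fun K (- u) \<le> support_fun K u" for u
  proof (rule support_fun_least[OF K])
    fix y assume "y \<in> K"
    then have "- y \<in> K" using K by (auto simp: Kn_e_def)
    from support_fun_upper[OF K this, of u] show "- u \<bullet> y \<le> support_fun K u" by simp
  qed
  then have "support_fun K (- u) = support_fun K u" for u
    by (metis antisym minus_minus)
  ultimately show ?thesis using c by (auto simp: pos_even_def)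
qed

text \<open>A closed convex set is the intersection of its supporting half-spaces: a point outside
  is cut off by a separating hyperplane.\<close>

lemma wulff_support_fun:
  assumes K: "Kn_e K"
  shows "wulff (support_fun K) = K"
proof
  show "K \<subseteq> wulff (support_fun K)" using support_fun_upper[OF K] by (auto simp: wulff_def)
  show "wulff (support_fun K) \<subseteq> K"
  proof (rule subsetI, rule ccontr)
    fix x assume x: "x \<in> wulff (support_fun K)" "x \<notin> K"
    have "convex K" "closed K" using K by (auto simp: Kn_e_def Kn_o_def compact_imp_closed)
    then obtain a b where ab: "a \<bullet> x < b" "\<forall>y\<in>K. b < a \<bullet> y"
      using separating_hyperplane_closed_point[of K x] x by auto
    have "a \<noteq> 0" using ab Kn_e_zero[OF K] by force
    \<comment> \<open>The separation puts \<open>x\<close> on the side where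
      \<open>a \<bullet> y\<close> is small, so the outward direction is \<open>- a\<close>.\<close>
    define u where "u = - sgn a"
    have u: "u \<in> sphere 0 1" using \<open>a \<noteq> 0\<close> by (simp add: u_def norm_sgn)
    have "support_fun K u \<le> - b / norm a"
    proof (rule support_fun_least[OF K])
      fix y assume "y \<in> K"
      then show "u \<bullet> y \<le> - b / norm a" using ab(2) \<open>a \<noteq> 0\<close>
        by (auto simp: u_def sgn_div_norm divide_inverse mult.commute less_imp_le)
    qed
    moreover have "- b / norm a < u \<bullet> x" using ab(1) \<open>a \<noteq> 0\<close>
      by (auto simp: u_def sgn_div_norm divide_inverse mult.commute)
    ultimately show False using x u by (force simp: wulff_def)
  qed
qed

lemma is_support_support_fun:
  assumes K: "Kn_e K"
  shows "is_support (support_fun K)"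
  using pos_even_support_fun[OF K] wulff_support_fun[OF K] by (simp add: is_support_def)

lemma support_fun_wulff_le:
  assumes "pos_even h" "u \<in> sphere 0 1"
  shows "support_fun (wulff h) u \<le> h u"
  using assms by (intro support_fun_least wulff_Kn_e) (auto simp: wulff_def)

text \<open>Both functions have the same Wulff shape, and away from the origin each gauge is the
  reciprocal of its radial function.\<close>

lemma wulff_gauge_support_fun:
  assumes "pos_even h"
  shows "wulff_gauge (support_fun (wulff h)) x = wulff_gauge h x"
proof (cases "x = 0")
  case False
  let ?k = "support_fun (wulff h)"
  have k: "pos_even ?k" "wulff ?k = wulff h"
    using wulff_Kn_e[OF assms] pos_even_support_fun wulff_support_fun by auto
  have "wulff_gauge ?k x > 0" "wulff_gauge h x > 0"
    using wulff_gauge_pos False k assms by auto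
  then show ?thesis
    using radial_fun_wulff[OF assms False] radial_fun_wulff[OF k(1) False] k(2) by simp
next
  case True
  then show ?thesis using assms pos_even_support_fun[OF wulff_Kn_e[OF assms]] by simp
qed

lemma is_support_pos_even: "is_support h \<Longrightarrow> pos_even h"
  by (simp add: is_support_def)

text \<open>The boundary point in direction \<open>x\<close> is \<open>x / wulff_gauge h x\<close>,
  and \<open>u\<close> is normal there iff the support value in direction \<open>u\<close> is
  attained there. Identifying that value with \<open>h u\<close> is where \<open>is_support\<close>
  enters.\<close>

lemma outer_normals_wulff:
  assumes "is_support h" "x \<noteq> 0"
  shows "outer_normals (wulff h) x = {u \<in> sphere 0 1. u \<bullet> x = wulff_gauge h x * h u}"
proof -
  have h: "pos_even h" using assms by (simp add: is_support_def)
  have p: "wulff_gauge h x > 0" by (rule wulff_gauge_pos[OF h assms(2)])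
  have K: "Kn_e (wulff h)" by (rule wulff_Kn_e[OF h])
  have mem: "(1 / wulff_gauge h x) *\<^sub>R x \<in> wulff h"
    using p by (simp add: mem_wulff_iff[OF h] wulff_gauge_scale[OF h] del: scaleR_scaleR)
  have "(\<forall>y\<in>wulff h. u \<bullet> y \<le> u \<bullet> ((1 / wulff_gauge h x) *\<^sub>R x)) \<longleftrightarrow> u \<bullet> x = wulff_gauge h x * h u"
    if u: "u \<in> sphere 0 1" for u
  proof -
    have su: "support_fun (wulff h) u = h u" using assms u by (simp add: is_support_def)
    have "(\<forall>y\<in>wulff h. u \<bullet> y \<le> u \<bullet> ((1 / wulff_gauge h x) *\<^sub>R x)) \<longleftrightarrow> h u \<le> u \<bullet> ((1 / wulff_gauge h x) *\<^sub>R x)"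
      using support_fun_upper[OF K, of _ u] support_fun_least[OF K, of u] su order_trans by metis
    also have "\<dots> \<longleftrightarrow> wulff_gauge h x * h u \<le> u \<bullet> x"
      using p by (simp add: field_simps)
    also have "\<dots> \<longleftrightarrow> u \<bullet> x = wulff_gauge h x * h u"
      using wulff_gauge_upper[OF h u, of x] by auto
    finally show ?thesis .
  qed
  then show ?thesis unfolding outer_normals_def radial_fun_wulff[OF h assms(2)] by blast
qed

section \<open>Almost every direction is regular\<close>

text \<open>The maximising directions of the gauge. Unlike \<open>outer_normals\<close>, this is the
  right notion also for perturbed \<open>h\<close>, which need not be support functions, and it is a
  closed condition on the pair \<open>(u, x)\<close>.\<close>

definition normals :: "('a::euclidean_space \<Rightarrow> real) \<Rightarrow> 'a \<Rightarrow> 'a set" where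
  "normals h x = {u \<in> sphere 0 1. u \<bullet> x = wulff_gauge h x * h u}"

lemma normals_nonempty: "pos_even h \<Longrightarrow> normals h x \<noteq> {}"
  using wulff_gauge_max[of h x] by (fastforce simp: normals_def)

lemma normals_scale:
  assumes "pos_even h" "c > 0"
  shows "normals h (c *\<^sub>R x) = normals h x"
  using assms by (auto simp: normals_def wulff_gauge_scale)

text \<open>A closed relation between \<open>y\<close> and two unit vectors stays closed when
  projected along the compact product of spheres. Suitable \<open>\<phi>\<close> express distinct
  normals, distinct components of subgradients, and normals inside a closed set; this is the source
  of measurability.\<close>

lemma closed_normal_pairs:
  assumes h: "pos_even (h :: 'a::euclidean_space \<Rightarrow> real)"
    and phi: "continuous_on (sphere 0 1 \<times> sphere 0 1) \<phi>"
  shows "closed {y. \<exists>u\<in>normals h y. \<exists>w\<in>normals h y. (c::real) \<le> \<phi> (u, w)}"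
proof -
  let ?D = "(sphere (0::'a) 1 \<times> sphere (0::'a) 1) \<times> (UNIV :: 'a set)"
  let ?F = "\<lambda>p. (fst (fst p) \<bullet> snd p - wulff_gauge h (snd p) * h (fst (fst p)),
                 snd (fst p) \<bullet> snd p - wulff_gauge h (snd p) * h (snd (fst p)), \<phi> (fst p))"
  have [continuous_intros]: "continuous_on A (\<lambda>x. wulff_gauge h (f x))" if "continuous_on A f" for f and A :: "(('a \<times> 'a) \<times> 'a) set"
    using continuous_on_compose2[OF wulff_gauge_continuous[OF h] that] by auto
  have 1: "continuous_on ?D (\<lambda>p. h (fst (fst p)))" "continuous_on ?D (\<lambda>p. h (snd (fst p)))"
    by (rule continuous_on_compose2[OF pos_even_continuous[OF h]]; force intro!: continuous_intros)+
  have 2: "continuous_on ?D (\<lambda>p. \<phi> (fst p))"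
    by (rule continuous_on_compose2[OF phi]; force intro!: continuous_intros)
  have "continuous_on ?D ?F"
    using 1 2 by (intro continuous_intros) 
  then have cl: "closedin (top_of_set ?D) (?D \<inter> ?F -` ({0} \<times> {0} \<times> {c..}))"
    by (rule continuous_closedin_preimage) (intro closed_Times closed_singleton closed_atLeast)
  have "closedin (top_of_set UNIV) {y. \<exists>x. x \<in> sphere (0::'a) 1 \<times> sphere (0::'a) 1 \<and> (x, y) \<in> ?D \<inter> ?F -` ({0} \<times> {0} \<times> {c..})}"
    by (rule closedin_compact_projection[OF _ cl]) (intro compact_Times compact_sphere)
  also have "{y. \<exists>x. x \<in> sphere (0::'a) 1 \<times> sphere (0::'a) 1 \<and> (x, y) \<in> ?D \<inter> ?F -` ({0} \<times> {0} \<times> {c..})}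
    = {y. \<exists>u\<in>normals h y. \<exists>w\<in>normals h y. c \<le> \<phi> (u, w)}"
    by (auto simp: normals_def; force)
  finally show ?thesis by simp
qed

text \<open>For a normal \<open>u\<close> at \<open>y\<close>, the vector \<open>u / h u\<close> is a subgradient of the gauge at \<open>y\<close>; this is
  the monotonicity of subgradients along a line.\<close>

lemma normals_monotone:
  assumes h: "pos_even h" and "s < t"
    and u: "u \<in> normals h (x + s *\<^sub>R e)" and w: "w \<in> normals h (x + t *\<^sub>R e)"
  shows "(u \<bullet> e) / h u \<le> (w \<bullet> e) / h w"
proof -
  have S: "u \<in> sphere 0 1" "w \<in> sphere 0 1" using u w by (auto simp: normals_def)
  have pos: "h u > 0" "h w > 0" using pos_even_pos[OF h] S by auto
  let ?g = "wulff_gauge h"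
  have "u \<bullet> (x + s *\<^sub>R e) / h u = ?g (x + s *\<^sub>R e)" "w \<bullet> (x + t *\<^sub>R e) / h w = ?g (x + t *\<^sub>R e)"
    using u w pos by (auto simp: normals_def)
  moreover have "u \<bullet> (x + t *\<^sub>R e) / h u \<le> ?g (x + t *\<^sub>R e)" "w \<bullet> (x + s *\<^sub>R e) / h w \<le> ?g (x + s *\<^sub>R e)"
    using wulff_gauge_upper[OF h S(1), of "x + t *\<^sub>R e"] wulff_gauge_upper[OF h S(2), of "x + s *\<^sub>R e"] pos
    by (auto simp: pos_divide_le_eq)
  moreover have "v \<bullet> (x + r *\<^sub>R e) / h v = (v \<bullet> x) / h v + r * ((v \<bullet> e) / h v)" for v r
    by (simp add: inner_add_right add_divide_distrib)
  note this[of u s] this[of u t] this[of w s] this[of w t]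
  \<comment> \<open>Adding the two subgradient inequalities cancels the gauge values.\<close>
  ultimately have "t * ((u \<bullet> e) / h u) + s * ((w \<bullet> e) / h w) \<le> s * ((u \<bullet> e) / h u) + t * ((w \<bullet> e) / h w)"
    by linarith
  then have "(t - s) * ((u \<bullet> e) / h u - (w \<bullet> e) / h w) \<le> 0"
    unfolding left_diff_distrib right_diff_distrib by linarith
  then show ?thesis using \<open>s < t\<close> by (simp add: mult_le_0_iff)
qed

text \<open>A selection of subgradients is monotone along the line, and the component along the line is
  unique wherever that selection is continuous.\<close>

lemma countable_bad_on_line:
  assumes h: "pos_even h"
  shows "countable {t. \<exists>u\<in>normals h (x + t *\<^sub>R e). \<exists>w\<in>normals h (x + t *\<^sub>R e). (u \<bullet> e) / h u \<noteq> (w \<bullet> e) / h w}"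
proof -
  define P where "P t = (SOME u. u \<in> normals h (x + t *\<^sub>R e))" for t
  define q where "q t = (P t \<bullet> e) / h (P t)" for t
  have P: "P t \<in> normals h (x + t *\<^sub>R e)" for t
    unfolding P_def using normals_nonempty[OF h] by (simp add: some_in_eq)
  have "mono q"
  proof (rule monoI)
    fix s t :: real assume "s \<le> t"
    then show "q s \<le> q t"
      using normals_monotone[OF h _ P P, of s t] by (cases "s = t") (auto simp: q_def)
  qed
  then have "countable {t. \<not> isCont q t}" by (rule mono_ctble_discont)
  moreover have "{t. \<exists>u\<in>normals h (x + t *\<^sub>R e). \<exists>w\<in>normals h (x + t *\<^sub>R e). (u \<bullet> e) / h u \<noteq> (w \<bullet> e) / h w}
     \<subseteq> {t. \<not> isCont q t}"
  proof -
    \<comment> \<open>By monotonicity the component of \<open>u\<close> is at most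
      \<open>q s\<close> for \<open>s > t\<close> and at least \<open>q s\<close> for
      \<open>s < t\<close>; continuity of \<open>q\<close> at \<open>t\<close> squeezes it.\<close>
    have "(u \<bullet> e) / h u = q t" if c: "isCont q t" and u: "u \<in> normals h (x + t *\<^sub>R e)" for t u
    proof (rule antisym)
      have "(q \<longlongrightarrow> q t) (at_right t)" using c by (simp add: isCont_def filterlim_at_split)
      moreover have "\<forall>\<^sub>F s in at_right t. (u \<bullet> e) / h u \<le> q s"
        using normals_monotone[OF h _ u P] by (auto simp: eventually_at_right_field q_def intro: exI[of _ "t+1"])
      ultimately show "(u \<bullet> e) / h u \<le> q t" by (rule tendsto_lowerbound) simp
      have "(q \<longlongrightarrow> q t) (at_left t)" using c by (simp add: isCont_def filterlim_at_split)
      moreover have "\<forall>\<^sub>F s in at_left t. q s \<le> (u \<bullet> e) / h u"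
        using normals_monotone[OF h _ P u] by (auto simp: eventually_at_left_field q_def intro: exI[of _ "t-1"])
      ultimately show "q t \<le> (u \<bullet> e) / h u" by (rule tendsto_upperbound) simp
    qed
    then show ?thesis by (auto; metis)
  qed
  ultimately show ?thesis by (rule countable_subset[rotated])
qed

text \<open>Fubini for \<open>(x, t) \<mapsto> x + t *\<^sub>R e\<close>: by translation invariance the integral is \<open>\<infinity>\<close> times the
  measure of \<open>N\<close>.\<close>

lemma null_if_countable_on_lines:
  fixes N :: "'a::euclidean_space set"
  assumes N: "N \<in> sets borel" and c: "\<And>x. countable {t. x + t *\<^sub>R e \<in> N}"
  shows "emeasure lborel N = 0"
proof -
  have meas: "(\<lambda>(x, t). indicator N (x + t *\<^sub>R e) :: ennreal) \<in> borel_measurable (lborel \<Otimes>\<^sub>M lborel)"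
    using N by measurable
  have "(\<integral>\<^sup>+ t. indicator N (x + t *\<^sub>R e) \<partial>lborel) = 0" for x
  proof -
    have "(\<integral>\<^sup>+ t. indicator N (x + t *\<^sub>R e) \<partial>lborel) = (\<integral>\<^sup>+ t. indicator {t. x + t *\<^sub>R e \<in> N} t \<partial>(lborel :: real measure))"
      by (intro nn_integral_cong) (auto simp: indicator_def)
    also have "\<dots> = emeasure lborel {t. x + t *\<^sub>R e \<in> N}"
    proof (rule nn_integral_indicator)
      show "{t. x + t *\<^sub>R e \<in> N} \<in> sets lborel"
        by (rule sets.countable[OF _ c]) simp
    qed
    also have "\<dots> = 0" by (rule emeasure_lborel_countable[OF c])
    finally show ?thesis .
  qed
  then have "0 = (\<integral>\<^sup>+ x. \<integral>\<^sup>+ t. indicator N (x + t *\<^sub>R e) \<partial>(lborel :: real measure) \<partial>lborel)" by simp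
  also have "\<dots> = (\<integral>\<^sup>+ t. \<integral>\<^sup>+ x. indicator N (x + t *\<^sub>R e) \<partial>lborel \<partial>(lborel :: real measure))"
    using lborel_pair.Fubini[OF meas] by simp
  also have "\<dots> = (\<integral>\<^sup>+ t. emeasure lborel N \<partial>(lborel :: real measure))"
  proof (intro nn_integral_cong)
    fix t :: real
    have "(\<integral>\<^sup>+ x. indicator N (x + t *\<^sub>R e) \<partial>lborel) = (\<integral>\<^sup>+ x. indicator N x \<partial>distr lborel borel ((+) (t *\<^sub>R e)))"
      using N by (subst nn_integral_distr) (auto simp: add.commute)
    also have "\<dots> = emeasure lborel N"
      unfolding lborel_distr_plus using N by simp
    finally show "(\<integral>\<^sup>+ x. indicator N (x + t *\<^sub>R e) \<partial>lborel) = emeasure lborel N" .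
  qed
  also have "\<dots> = emeasure lborel N * \<infinity>" by simp
  finally show ?thesis by (simp add: ennreal_mult_eq_top_iff split: if_splits)
qed

definition nonregular :: "('a::euclidean_space \<Rightarrow> real) \<Rightarrow> 'a set" where
  "nonregular h = {x. \<exists>u\<in>normals h x. \<exists>w\<in>normals h x. u \<noteq> w}"

text \<open>Distinctness of two normals is a countable union of the closed conditions
  \<open>inverse (real (Suc n)) \<le> dist u w\<close>.\<close>

lemma nonregular_borel:
  assumes h: "pos_even h"
  shows "nonregular h \<in> sets borel"
proof -
  have "nonregular h = (\<Union>n. {y. \<exists>u\<in>normals h y. \<exists>w\<in>normals h y. inverse (real (Suc n)) \<le> (\<lambda>(u, w). dist u w) (u, w)})"
  proof -
    have "u \<noteq> w \<longleftrightarrow> (\<exists>n. inverse (real (Suc n)) \<le> dist u w)" for u w :: 'a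
      by (metis dist_eq_0_iff dist_nz inverse_positive_iff_positive leD less_imp_le of_nat_0_less_iff reals_Archimedean zero_less_Suc)
    then show ?thesis by (auto simp: nonregular_def)
  qed
  also have "\<dots> \<in> sets borel"
    by (intro sets.countable_UN image_subsetI borel_closed closed_normal_pairs[OF h])
      (auto simp: case_prod_beta intro!: continuous_intros)
  finally show ?thesis .
qed

text \<open>Distinct normals yield distinct subgradients \<open>u / h u\<close>, so some coordinate
  direction \<open>e\<close> separates them; the set \<open>B e\<close> of points where this happens
  meets every line parallel to \<open>e\<close> in a countable set and is therefore null.\<close>

lemma nonregular_null:
  assumes h: "pos_even (h :: 'a::euclidean_space \<Rightarrow> real)"
  shows "emeasure lborel (nonregular h - {0}) = 0"
proof -
  define B where "B e = {y. \<exists>u\<in>normals h y. \<exists>w\<in>normals h y. (u \<bullet> e) / h u \<noteq> (w \<bullet> e) / h w}" for e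
  have meas: "B e \<in> sets borel" for e
  proof -
    let ?\<phi> = "\<lambda>(u, w). \<bar>(u \<bullet> e) / h u - (w \<bullet> e) / h w\<bar>"
    have eq: "B e = (\<Union>n. {y. \<exists>u\<in>normals h y. \<exists>w\<in>normals h y. inverse (real (Suc n)) \<le> ?\<phi> (u, w)})"
    proof -
      have "a \<noteq> b \<longleftrightarrow> (\<exists>n. inverse (real (Suc n)) \<le> \<bar>a - b\<bar>)" for a b :: real
        by (metis dist_eq_0_iff dist_nz dist_real_def inverse_positive_iff_positive leD less_imp_le of_nat_0_less_iff reals_Archimedean zero_less_Suc)
      then show ?thesis by (auto simp: B_def)
    qed
    have cont: "continuous_on (sphere 0 1 \<times> sphere 0 1) ?\<phi>"
    proof -
      have "continuous_on (sphere 0 1 \<times> sphere 0 1) (\<lambda>p. h (fst p))" "continuous_on (sphere 0 1 \<times> sphere 0 1) (\<lambda>p. h (snd p))"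
        by (rule continuous_on_compose2[OF pos_even_continuous[OF h]]; force intro!: continuous_intros)+
      then show ?thesis unfolding case_prod_beta using pos_even_pos[OF h]
        by (intro continuous_intros) (force simp: less_imp_neq[symmetric])+
    qed
    show ?thesis unfolding eq
      by (intro sets.countable_UN image_subsetI borel_closed closed_normal_pairs[OF h] cont)
  qed
  have null: "emeasure lborel (B e) = 0" for e
    by (rule null_if_countable_on_lines[OF meas, of _ e])
      (use countable_bad_on_line[OF h, of _ e] in \<open>simp add: B_def\<close>)
  have "nonregular h - {0} \<subseteq> (\<Union>e\<in>Basis. B e)"
  proof
    fix x assume "x \<in> nonregular h - {0}"
    then obtain u w where x: "x \<noteq> 0" and uw: "u \<in> normals h x" "w \<in> normals h x" "u \<noteq> w"
      by (auto simp: nonregular_def)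
    have S: "u \<in> sphere 0 1" "w \<in> sphere 0 1" using uw by (auto simp: normals_def)
    have pos: "h u > 0" "h w > 0" using pos_even_pos[OF h] S by auto
    \<comment> \<open>The norm of \<open>u / h u\<close> is \<open>1 / h u\<close>, so this vector
      determines first \<open>h u\<close> and then \<open>u\<close>.\<close>
    have "u /\<^sub>R h u \<noteq> w /\<^sub>R h w"
    proof
      assume eq: "u /\<^sub>R h u = w /\<^sub>R h w"
      then have "norm (u /\<^sub>R h u) = norm (w /\<^sub>R h w)" by simp
      then have "h u = h w" using pos S by simp
      then show False using eq uw pos by simp
    qed
    then obtain e where "e \<in> Basis" "(u /\<^sub>R h u) \<bullet> e \<noteq> (w /\<^sub>R h w) \<bullet> e"
      by (metis euclidean_eqI)
    then show "x \<in> (\<Union>e\<in>Basis. B e)" using uw by (auto simp: B_def divide_inverse mult.commute)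
  qed
  moreover have "(\<Union>e\<in>Basis. B e) \<in> null_sets lborel"
    using null meas by (intro null_sets_UN' countable_finite finite_Basis) (auto simp: null_sets_def)
  ultimately show ?thesis
    using emeasure_eq_0 null_setsD1 null_setsD2 by blast
qed

section \<open>Transfer of the null set to the sphere\<close>

lemma space_borel_on_sphere:
  assumes "nonzero_finite_borel M"
  shows "space M = sphere 0 1"
proof -
  have "sets M = sets sphere_borel"
    using assms by (simp add: nonzero_finite_borel_def borel_on_sphere_def)
  then have "space M = space sphere_borel" by (rule sets_eq_imp_space_eq)
  then show ?thesis by (simp add: sphere_borel_def space_restrict_space)
qed

text \<open>Normals are constant along rays, so the cone over the nonregular directions is Lebesgue
  null; spherical Lebesgue measure is defined through such cones, and absolute continuity passes the
  null set on to \<open>lam\<close>.\<close>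

lemma AE_regular:
  assumes lam: "class_M lam" and h: "pos_even (h :: 'a::euclidean_space \<Rightarrow> real)"
  shows "AE x in lam. x \<notin> nonregular h"
proof -
  let ?N = "nonregular h \<inter> sphere 0 1"
  have sb: "?N \<in> sets sphere_borel"
    using nonregular_borel[OF h] by (auto simp: sphere_borel_def sets_restrict_space)
  have m: "(\<lambda>x::'a. x /\<^sub>R norm x) \<in> measurable (restrict_space lborel (cball 0 1 - {0})) sphere_borel"
    unfolding sphere_borel_def
    by (rule measurable_restrict_space2) (auto simp: space_restrict_space intro!: measurable_restrict_space1)
  have "(\<lambda>x. x /\<^sub>R norm x) -` ?N \<inter> (cball 0 1 - {0}) \<subseteq> nonregular h - {0}"
  proof safe
    fix x :: 'a assume "x /\<^sub>R norm x \<in> nonregular h" "x \<noteq> 0"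
    then show "x \<in> nonregular h"
      using normals_scale[OF h, of "inverse (norm x)" x] by (simp add: nonregular_def)
  qed
  then have "emeasure lborel ((\<lambda>x. x /\<^sub>R norm x) -` ?N \<inter> (cball 0 1 - {0})) = 0"
    by (rule emeasure_eq_0[rotated 2]) (use nonregular_null[OF h] nonregular_borel[OF h] in auto)
  then have "emeasure (distr (restrict_space lborel (cball 0 1 - {0})) sphere_borel (\<lambda>x::'a. x /\<^sub>R norm x)) ?N = 0"
    by (subst emeasure_distr[OF m sb]) (auto simp: space_restrict_space emeasure_restrict_space)
  then have "?N \<in> null_sets spherical_lebesgue"
    using sb by (auto simp: spherical_lebesgue_def null_sets_def)
  then have "?N \<in> null_sets lam"
    using lam by (auto simp: class_M_def absolutely_continuous_def)
  moreover have "space lam = sphere 0 1"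
    using lam by (simp add: class_M_def space_borel_on_sphere)
  ultimately show ?thesis by (auto intro: AE_I')
qed

section \<open>The radial Gauss map\<close>

text \<open>The value on nonregular directions is an arbitrary unit vector, so that the map stays in the
  sphere.\<close>

definition gauss :: "('a::euclidean_space \<Rightarrow> real) \<Rightarrow> 'a \<Rightarrow> 'a" where
  "gauss h x = (if x \<in> nonregular h then SOME u. u \<in> sphere 0 1 else SOME u. u \<in> normals h x)"

lemma gauss_in_normals: "pos_even h \<Longrightarrow> x \<notin> nonregular h \<Longrightarrow> gauss h x \<in> normals h x"
  using normals_nonempty[of h x] by (simp add: gauss_def some_in_eq)

lemma gauss_sphere: "pos_even h \<Longrightarrow> gauss h x \<in> sphere 0 1"
proof (cases "x \<in> nonregular h")
  case True
  then show ?thesis using some_in_eq[of "sphere (0::'a) 1"] by (simp only: gauss_def) (simp del: mem_sphere)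
next
  case False
  assume "pos_even h"
  then show ?thesis using gauss_in_normals[of h x] False by (auto simp: normals_def)
qed

lemma normals_eq_gauss: "pos_even h \<Longrightarrow> x \<notin> nonregular h \<Longrightarrow> normals h x = {gauss h x}"
  using gauss_in_normals[of h x] by (auto simp: nonregular_def)

text \<open>Membership of a normal in \<open>C\<close> is written as
  \<open>0 \<le> - infdist u C\<close> to fit the closedness statement for pairs. The empty set is
  treated apart because \<open>infdist u {}\<close> is 0.\<close>

lemma closed_normals_meet:
  assumes h: "pos_even (h :: 'a::euclidean_space \<Rightarrow> real)" and C: "closed C"
  shows "closed {y. normals h y \<inter> C \<noteq> {}}"
proof (cases "C = {}")
  case False
  have "closed {y. \<exists>u\<in>normals h y. \<exists>w\<in>normals h y. 0 \<le> (\<lambda>(u, w). - infdist u C) (u, w)}"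
    by (rule closed_normal_pairs[OF h]) (auto simp: case_prod_beta intro!: continuous_intros)
  also have "{y. \<exists>u\<in>normals h y. \<exists>w\<in>normals h y. 0 \<le> (\<lambda>(u, w). - infdist u C) (u, w)} = {y. normals h y \<inter> C \<noteq> {}}"
  proof -
    have "0 \<le> - infdist u C \<longleftrightarrow> u \<in> C" for u
      using in_closed_iff_infdist_zero[OF C False, of u] infdist_nonneg[of u C] by linarith
    then show ?thesis by auto
  qed
  finally show ?thesis .
qed simp

text \<open>Off the nonregular set, the preimage of an open \<open>U\<close> is the complement of
  the closed set of points having a normal outside \<open>U\<close>.\<close>

lemma gauss_borel:
  assumes h: "pos_even (h :: 'a::euclidean_space \<Rightarrow> real)"
  shows "gauss h \<in> borel_measurable borel"
proof (rule borel_measurableI)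
  fix U :: "'a set" assume "open U"
  then have C: "closed {y. normals h y \<inter> (- U) \<noteq> {}}"
    by (intro closed_normals_meet[OF h]) auto
  let ?N = "nonregular h"
  have "gauss h -` U \<inter> space borel =
    (if (SOME u::'a. u \<in> sphere 0 1) \<in> U then ?N else {}) \<union> ((- ?N) - {y. normals h y \<inter> (- U) \<noteq> {}})"
    (is "?L = ?R")
  proof (rule set_eqI)
    fix x
    show "x \<in> ?L \<longleftrightarrow> x \<in> ?R"
    proof (cases "x \<in> ?N")
      case True
      then show ?thesis by (simp add: gauss_def)
    next
      case False
      then show ?thesis using normals_eq_gauss[OF h False] by auto
    qed
  qed
  also have "\<dots> \<in> sets borel"
    using nonregular_borel[OF h] borel_closed[OF C] by auto
  finally show "gauss h -` U \<inter> space borel \<in> sets borel" .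
qed

section \<open>Measurability and integrability on the sphere\<close>

lemma sets_nonzero_finite_borel: "nonzero_finite_borel M \<Longrightarrow> sets M = sets (restrict_space borel (sphere 0 1))"
  by (simp add: nonzero_finite_borel_def borel_on_sphere_def sphere_borel_def)

lemma measurable_continuous_sphere:
  assumes "nonzero_finite_borel M" "continuous_on (sphere 0 1) f"
  shows "f \<in> borel_measurable M"
  using borel_measurable_continuous_on_restrict[OF assms(2)]
    measurable_cong_sets[OF sets_nonzero_finite_borel[OF assms(1)] refl] by blast

lemma measurable_borel_sphere:
  assumes "nonzero_finite_borel M" "f \<in> borel_measurable borel"
  shows "f \<in> borel_measurable M"
  using measurable_restrict_space1[OF assms(2)]
    measurable_cong_sets[OF sets_nonzero_finite_borel[OF assms(1)] refl] by blast

lemma integrable_bounded_sphere: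
  assumes "nonzero_finite_borel M" "(f :: _ \<Rightarrow> real) \<in> borel_measurable M" "\<And>x. x \<in> sphere 0 1 \<Longrightarrow> \<bar>f x\<bar> \<le> B"
  shows "integrable M f"
proof -
  interpret finite_measure M using assms(1) by (simp add: nonzero_finite_borel_def)
  show ?thesis
    using assms(2,3) space_borel_on_sphere[OF assms(1)] by (intro integrable_const_bound[of _ B]) auto
qed

lemma continuous_sphere_bounded:
  assumes "continuous_on (sphere (0::'a::euclidean_space) 1) (f :: 'a \<Rightarrow> real)"
  obtains B where "\<And>x. x \<in> sphere 0 1 \<Longrightarrow> \<bar>f x\<bar> \<le> B"
proof -
  have "bounded (f ` sphere 0 1)"
    by (rule compact_imp_bounded[OF compact_continuous_image[OF assms compact_sphere]])
  then obtain B where "\<forall>y\<in>f ` sphere 0 1. norm y \<le> B" unfolding bounded_iff by blast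
  then show thesis using that[of B] by (metis imageI real_norm_def)
qed

lemma integrable_continuous_sphere:
  assumes "nonzero_finite_borel M" "continuous_on (sphere 0 1) (f :: _ \<Rightarrow> real)"
  shows "integrable M f"
proof -
  obtain B where "\<And>x. x \<in> sphere 0 1 \<Longrightarrow> \<bar>f x\<bar> \<le> B"
    using continuous_sphere_bounded[OF assms(2)] by blast
  then show ?thesis
    by (intro integrable_bounded_sphere[OF assms(1) measurable_continuous_sphere[OF assms]])
qed

lemma measurable_gauss:
  assumes "nonzero_finite_borel lam" "pos_even h"
  shows "gauss h \<in> measurable lam sphere_borel"
  unfolding sphere_borel_def
  by (rule measurable_restrict_space2) (use gauss_sphere[OF assms(2)] measurable_borel_sphere[OF assms(1) gauss_borel[OF assms(2)]] in auto)

lemma measurable_comp_gauss: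
  assumes "nonzero_finite_borel lam" "pos_even h" "continuous_on (sphere 0 1) f"
  shows "(\<lambda>x. f (gauss h x)) \<in> borel_measurable lam"
  using measurable_compose[OF measurable_gauss[OF assms(1,2)]
      borel_measurable_continuous_on_restrict[OF assms(3), folded sphere_borel_def]] .

lemma integrable_comp_gauss:
  assumes "nonzero_finite_borel lam" "pos_even h" "continuous_on (sphere 0 1) (f :: _ \<Rightarrow> real)"
  shows "integrable lam (\<lambda>x. f (gauss h x))"
proof -
  obtain B where "\<And>x. x \<in> sphere 0 1 \<Longrightarrow> \<bar>f x\<bar> \<le> B"
    using continuous_sphere_bounded[OF assms(3)] by blast
  then show ?thesis
    using gauss_sphere[OF assms(2)]
    by (intro integrable_bounded_sphere[OF assms(1) measurable_comp_gauss[OF assms]]) blast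
qed

lemma class_C_continuous:
  assumes "class_C \<Psi>" "continuous_on A u" "continuous_on A r" "\<And>x. x \<in> A \<Longrightarrow> u x \<in> sphere 0 1 \<and> r x > 0"
  shows "continuous_on A (\<lambda>x. \<Psi> (u x) (r x))" "continuous_on A (\<lambda>x. psi_t \<Psi> (u x) (r x))"
proof -
  have *: "continuous_on A (\<lambda>x. (u x, r x))" "(\<lambda>x. (u x, r x)) ` A \<subseteq> sphere 0 1 \<times> {0<..}"
    using assms(2-4) by (auto intro!: continuous_intros)
  show "continuous_on A (\<lambda>x. \<Psi> (u x) (r x))" "continuous_on A (\<lambda>x. psi_t \<Psi> (u x) (r x))"
    using continuous_on_compose2[of "sphere 0 1 \<times> {0<..}" "\<lambda>(u, t). \<Psi> u t", OF _ *]
      continuous_on_compose2[of "sphere 0 1 \<times> {0<..}" "\<lambda>(u, t). psi_t \<Psi> u t", OF _ *]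
      assms(1) by (simp_all add: class_C_def)
qed

text \<open>Off the nonregular set, \<open>x\<close> lies in
  \<open>rev_radial_gauss (wulff h) \<omega>\<close> iff its only normal lies in
  \<open>\<omega>\<close>, so \<open>J_tilde\<close> becomes an integral over the image of
  \<open>lam\<close> under \<open>gauss h\<close>.\<close>

lemma J_tilde_wulff:
  assumes lam: "class_M lam" and h: "is_support h" and Psi: "class_C \<Psi>"
    and om: "\<omega> \<in> sets (sphere_borel :: 'a::euclidean_space measure)"
  shows "J_tilde \<Psi> lam (wulff h) \<omega> =
    (\<integral>x. indicator \<omega> (gauss h x) * (1 / (h (gauss h x) * psi_t \<Psi> (gauss h x) (h (gauss h x)))) \<partial>lam)"
proof -
  let ?F = "\<lambda>x. indicator \<omega> (gauss h x) * (1 / (h (gauss h x) * psi_t \<Psi> (gauss h x) (h (gauss h x))))"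
  have pe: "pos_even h" using h by (rule is_support_pos_even)
  have nf: "nonzero_finite_borel lam" using lam by (simp add: class_M_def)
  have sp: "space lam = sphere 0 1" by (rule space_borel_on_sphere[OF nf])
  have c: "continuous_on (sphere 0 1) (\<lambda>u. h u * psi_t \<Psi> u (h u))"
    using pos_even_continuous[OF pe] pos_even_pos[OF pe]
    by (intro continuous_intros class_C_continuous[OF Psi]) auto
  have F: "?F \<in> borel_measurable lam"
  proof -
    have "(\<lambda>x. indicator \<omega> (gauss h x) :: real) \<in> borel_measurable lam"
      using om by (intro measurable_compose[OF measurable_gauss[OF nf pe]] borel_measurable_indicator)
    then show ?thesis using measurable_comp_gauss[OF nf pe c] by measurable
  qed
  have N: "nonregular h \<inter> space lam \<in> sets lam"
    using nonregular_borel[OF pe] sp sets_nonzero_finite_borel[OF nf] by (auto simp: sets_restrict_space)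
  \<comment> \<open>This equality is pointwise on the whole sphere, as \<open>J_tilde\<close> sets
    its integrand to 0 at nonregular directions; only the next one is almost everywhere.\<close>
  have "J_tilde \<Psi> lam (wulff h) \<omega> = (\<integral>x. (if x \<in> nonregular h then 0 else ?F x) \<partial>lam)"
    unfolding J_tilde_def set_lebesgue_integral_def
  proof (rule Bochner_Integration.integral_cong[OF refl])
    fix x assume "x \<in> space lam"
    then have x: "x \<in> sphere 0 1" "x \<noteq> 0" using sp by auto
    have on: "outer_normals (wulff h) x = normals h x"
      using outer_normals_wulff[OF h x(2)] by (simp add: normals_def)
    show "indicator (rev_radial_gauss (wulff h) \<omega>) x *\<^sub>R
         (if regular_dir (wulff h) x
          then 1 / (support_fun (wulff h) (radial_gauss (wulff h) x) *
             psi_t \<Psi> (radial_gauss (wulff h) x) (support_fun (wulff h) (radial_gauss (wulff h) x)))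
          else 0) = (if x \<in> nonregular h then 0 else ?F x)"
    proof (cases "x \<in> nonregular h")
      case True
      then have "\<not> regular_dir (wulff h) x"
        unfolding regular_dir_def on by (auto simp: nonregular_def)
      then show ?thesis using True by simp
    next
      case False
      then have g: "outer_normals (wulff h) x = {gauss h x}"
        using normals_eq_gauss[OF pe] on by simp
      then have "regular_dir (wulff h) x" "radial_gauss (wulff h) x = gauss h x"
        by (auto simp: regular_dir_def radial_gauss_def)
      moreover have "support_fun (wulff h) (gauss h x) = h (gauss h x)"
        using h gauss_sphere[OF pe] by (auto simp: is_support_def)
      moreover have "indicator (rev_radial_gauss (wulff h) \<omega>) x = (indicator \<omega> (gauss h x) :: real)"
        using x(1) g by (auto simp: rev_radial_gauss_def indicator_def)
      ultimately show ?thesis using False by simp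
    qed
  qed
  also have "\<dots> = (\<integral>x. ?F x \<partial>lam)"
  proof (rule integral_cong_AE)
    show "(\<lambda>x. if x \<in> nonregular h then 0 else ?F x) \<in> borel_measurable lam"
      using F N by (intro measurable_If) (auto simp: Int_def conj_commute)
    show "AE x in lam. (if x \<in> nonregular h then 0 else ?F x) = ?F x"
      using AE_regular[OF lam pe] by eventually_elim simp
  qed (rule F)
  finally show ?thesis .
qed

text \<open>Indicators of closed sets are limits of the cut-offs
  \<open>max 0 (1 - real k * infdist x C)\<close>, and the traces of closed sets on the sphere form
  a generator stable under intersection.\<close>

lemma measure_eq_of_integral_continuous:
  fixes M N :: "'a::euclidean_space measure"
  assumes M: "sets M = sets sphere_borel" "finite_measure M"
    and N: "sets N = sets sphere_borel" "finite_measure N"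
    and eq: "\<And>f::'a \<Rightarrow> real. continuous_on UNIV f \<Longrightarrow> (\<integral>x. f x \<partial>M) = (\<integral>x. f x \<partial>N)"
  shows "M = N"
proof -
  interpret M: finite_measure M by fact
  interpret N: finite_measure N by fact
  let ?S = "sphere (0::'a) 1"
  let ?E = "{?S \<inter> C |C. closed C}"
  have "sets (sphere_borel :: 'a measure) = (\<inter>) ?S ` sigma_sets UNIV (Collect closed)"
    unfolding sphere_borel_def sets_restrict_space by (subst borel_eq_closed) simp
  also have "\<dots> = sigma_sets ?S ((\<inter>) ?S ` Collect closed)"
    by (rule sigma_sets_Int) auto
  also have "(\<inter>) ?S ` Collect closed = ?E" by auto
  finally have gen: "sets (sphere_borel :: 'a measure) = sigma_sets ?S ?E" .
  have spM: "space M = ?S" using sets_eq_imp_space_eq[OF M(1)] by (simp add: sphere_borel_def space_restrict_space)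
  have spN: "space N = ?S" using sets_eq_imp_space_eq[OF N(1)] by (simp add: sphere_borel_def space_restrict_space)
  \<comment> \<open>\<open>C\<close> has to be nonempty: \<open>infdist x {} = 0\<close> would make
    the cut-offs constantly 1.\<close>
  have lim: "(\<lambda>k. \<integral>x. max 0 (1 - real k * infdist x C) \<partial>L) \<longlonglongrightarrow> measure L (?S \<inter> C)"
    if L: "sets L = sets sphere_borel" "finite_measure L" and C: "closed C" "C \<noteq> {}" for L C
  proof -
    interpret L: finite_measure L by fact
    have sp: "space L = ?S" using sets_eq_imp_space_eq[OF L(1)] by (simp add: sphere_borel_def space_restrict_space)
    have SC: "?S \<inter> C \<in> sets L"
      unfolding L(1) gen using C by (intro sigma_sets.Basic) auto
    have m: "f \<in> borel_measurable L" if "continuous_on UNIV (f :: 'a \<Rightarrow> real)" for f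
      using continuous_on_subset[OF that, of ?S] measurable_cong_sets[OF L(1) refl] unfolding sphere_borel_def
      by (metis borel_measurable_continuous_on_restrict subset_UNIV)
    have "(\<lambda>k. \<integral>x. max 0 (1 - real k * infdist x C) \<partial>L) \<longlonglongrightarrow> (\<integral>x. indicator (?S \<inter> C) x \<partial>L)"
    proof (rule integral_dominated_convergence[where w="\<lambda>_. 1"])
      show "indicat_real (?S \<inter> C) \<in> borel_measurable L" using SC by simp
      show "(\<lambda>x. max 0 (1 - real k * infdist x C)) \<in> borel_measurable L" for k
        by (intro m continuous_intros)
      show "integrable L (\<lambda>_. 1 :: real)" by simp
      show "AE x in L. norm (max 0 (1 - real k * infdist x C)) \<le> 1" for k
        by (auto simp: infdist_nonneg)
      show "AE x in L. (\<lambda>k. max 0 (1 - real k * infdist x C)) \<longlonglongrightarrow> indicat_real (?S \<inter> C) x"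
      proof (rule AE_I2)
        fix x assume x: "x \<in> space L"
        show "(\<lambda>k. max 0 (1 - real k * infdist x C)) \<longlonglongrightarrow> indicat_real (?S \<inter> C) x"
        proof (cases "x \<in> C")
          case True
          then show ?thesis using x sp by (simp add: infdist_zero)
        next
          case False
          then have p: "infdist x C > 0"
            using in_closed_iff_infdist_zero[OF C] infdist_nonneg[of x C] by fastforce
          then obtain n where n: "real n * infdist x C > 1"
            using reals_Archimedean3 by blast
          have "\<forall>\<^sub>F k in sequentially. max 0 (1 - real k * infdist x C) = 0"
          proof (rule eventually_sequentiallyI[of n])
            fix k assume "n \<le> k"
            then have "real n * infdist x C \<le> real k * infdist x C" using p by (intro mult_right_mono) auto
            then show "max 0 (1 - real k * infdist x C) = 0" using n by simp
          qed
          then have "(\<lambda>k. max 0 (1 - real k * infdist x C)) \<longlonglongrightarrow> 0" by (rule tendsto_eventually)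
          then show ?thesis using False by simp
        qed
      qed
    qed
    then show ?thesis using SC by simp
  qed
  show ?thesis
  proof (rule measure_eqI_generator_eq[of ?E ?S M N "\<lambda>_. ?S"])
    show "Int_stable ?E"
    proof (rule Int_stableI)
      fix a b assume "a \<in> ?E" "b \<in> ?E"
      then obtain C D where "a = ?S \<inter> C" "b = ?S \<inter> D" "closed C" "closed D" by blast
      then have "a \<inter> b = ?S \<inter> (C \<inter> D)" "closed (C \<inter> D)" by auto
      then show "a \<inter> b \<in> ?E" by blast
    qed
    show "?E \<subseteq> Pow ?S" by auto
    show "emeasure M X = emeasure N X" if "X \<in> ?E" for X
    proof -
      obtain C where C: "X = ?S \<inter> C" "closed C" using \<open>X \<in> ?E\<close> by blast
      show ?thesis
      proof (cases "C = {}")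
        case False
        have "(\<integral>x. max 0 (1 - real k * infdist x C) \<partial>M) = (\<integral>x. max 0 (1 - real k * infdist x C) \<partial>N)" for k
          by (intro eq continuous_intros)
        then have "measure M X = measure N X"
          using LIMSEQ_unique[OF lim[OF M C(2) False]] lim[OF N C(2) False] C by simp
        then show ?thesis by (simp add: M.emeasure_eq_measure N.emeasure_eq_measure)
      qed (use C in simp)
    qed
    show "sets M = sigma_sets ?S ?E" "sets N = sigma_sets ?S ?E" using M(1) N(1) gen by auto
    show "range (\<lambda>_::nat. ?S) \<subseteq> ?E" by auto
  qed auto
qed

section \<open>First variations\<close>

text \<open>The exponential form keeps the perturbation positive for every \<open>t\<close> and
  makes \<open>f\<close> the derivative of its logarithm.\<close>

lemma pos_even_perturb:
  assumes "pos_even h" "continuous_on (sphere 0 1) f" "\<And>u. u \<in> sphere 0 1 \<Longrightarrow> f (- u) = f u"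
  shows "pos_even (\<lambda>u. h u * exp (t * f u))"
  using assms unfolding pos_even_def by (auto intro!: continuous_intros)

text \<open>A maximiser for one of the two functions is a competitor for the other. The first bound
  uses a fixed normal of \<open>h\<close>; the second involves a normal of the perturbed function,
  which moves with \<open>t\<close>.\<close>

lemma ln_gauge_perturb:
  fixes h :: "'a::euclidean_space \<Rightarrow> real"
  assumes h: "pos_even h" and f: "continuous_on (sphere 0 1) f" "\<And>u. u \<in> sphere 0 1 \<Longrightarrow> f (- u) = f u"
    and x: "x \<noteq> 0"
  defines "H \<equiv> \<lambda>t u. h u * exp (t * f u)"
  shows "w \<in> normals h x \<Longrightarrow> - (t * f w) \<le> ln (wulff_gauge (H t) x) - ln (wulff_gauge h x)"
    and "w \<in> normals (H t) x \<Longrightarrow> ln (wulff_gauge (H t) x) - ln (wulff_gauge h x) \<le> - (t * f w)"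
proof -
  have H: "pos_even (H t)" unfolding H_def by (rule pos_even_perturb[OF h f])
  have p: "wulff_gauge h x > 0" "wulff_gauge (H t) x > 0" using wulff_gauge_pos h H x by auto
  { assume w: "w \<in> normals h x"
    then have S: "w \<in> sphere 0 1" by (simp add: normals_def)
    have "wulff_gauge h x * h w \<le> wulff_gauge (H t) x * H t w"
      using wulff_gauge_upper[OF H S, of x] w by (simp add: normals_def)
    then have "wulff_gauge h x \<le> wulff_gauge (H t) x * exp (t * f w)"
      using pos_even_pos[OF h S] by (simp add: H_def)
    then have "ln (wulff_gauge h x) \<le> ln (wulff_gauge (H t) x * exp (t * f w))"
      using p by simp
    then show "- (t * f w) \<le> ln (wulff_gauge (H t) x) - ln (wulff_gauge h x)"
      using p by (simp add: ln_mult) }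
  { assume w: "w \<in> normals (H t) x"
    then have S: "w \<in> sphere 0 1" by (simp add: normals_def)
    have "wulff_gauge (H t) x * H t w \<le> wulff_gauge h x * h w"
      using wulff_gauge_upper[OF h S, of x] w by (simp add: normals_def)
    then have "wulff_gauge (H t) x * exp (t * f w) \<le> wulff_gauge h x"
      using pos_even_pos[OF h S] by (simp add: H_def)
    then have "ln (wulff_gauge (H t) x * exp (t * f w)) \<le> ln (wulff_gauge h x)"
      using p by simp
    then show "ln (wulff_gauge (H t) x) - ln (wulff_gauge h x) \<le> - (t * f w)"
      using p by (simp add: ln_mult) }
qed

text \<open>Supplies the constant that dominates the difference quotients under the
  integral.\<close>

lemma ln_gauge_perturb_bound:
  fixes h :: "'a::euclidean_space \<Rightarrow> real"
  assumes h: "pos_even h" and f: "continuous_on (sphere 0 1) f" "\<And>u. u \<in> sphere 0 1 \<Longrightarrow> f (- u) = f u"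
    and x: "x \<noteq> 0" and B: "\<And>u. u \<in> sphere 0 1 \<Longrightarrow> \<bar>f u\<bar> \<le> B" and "t > 0"
  shows "\<bar>ln (wulff_gauge (\<lambda>u. h u * exp (t * f u)) x) - ln (wulff_gauge h x)\<bar> \<le> t * B"
proof -
  obtain w where w: "w \<in> normals h x" using normals_nonempty[OF h] by blast
  obtain v where v: "v \<in> normals (\<lambda>u. h u * exp (t * f u)) x"
    using normals_nonempty[OF pos_even_perturb[OF h f]] by blast
  have "\<bar>t * f w\<bar> \<le> t * B" "\<bar>t * f v\<bar> \<le> t * B"
    using B w v \<open>t > 0\<close> by (auto simp: abs_mult normals_def)
  then show ?thesis
    using ln_gauge_perturb[OF h f x, of w t] ln_gauge_perturb[OF h f x, of v t] w v by linarith
qed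

text \<open>The lower bound on the quotient is exact for every \<open>k\<close>. For the upper
  bound, normals of the perturbed functions must come close to \<open>gauss h x\<close> as far as
  the value of \<open>f\<close> is concerned; uniqueness of the normal and compactness ensure
  this.\<close>

lemma ln_gauge_perturb_limit:
  fixes h :: "'a::euclidean_space \<Rightarrow> real"
  assumes h: "pos_even h" and f: "continuous_on (sphere 0 1) f" "\<And>u. u \<in> sphere 0 1 \<Longrightarrow> f (- u) = f u"
    and x: "x \<noteq> 0" "x \<notin> nonregular h" and t: "\<And>k. t k > 0" "t \<longlonglongrightarrow> 0"
  shows "(\<lambda>k. (ln (wulff_gauge (\<lambda>u. h u * exp (t k * f u)) x) - ln (wulff_gauge h x)) / t k) \<longlonglongrightarrow> - f (gauss h x)"
proof -
  define H where "H s u = h u * exp (s * f u)" for s u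
  let ?g = "wulff_gauge h x"
  let ?q = "\<lambda>k. (ln (wulff_gauge (H (t k)) x) - ln ?g) / t k"
  have g: "?g > 0" by (rule wulff_gauge_pos[OF h x(1)])
  have H: "pos_even (H s)" for s unfolding H_def by (rule pos_even_perturb[OF h f])
  obtain B where B: "\<And>u. u \<in> sphere 0 1 \<Longrightarrow> \<bar>f u\<bar> \<le> B" using continuous_sphere_bounded[OF f(1)] by blast
  have N: "normals h x = {gauss h x}" by (rule normals_eq_gauss[OF h x(2)])
  have lower: "- f (gauss h x) \<le> ?q k" for k
    using ln_gauge_perturb(1)[OF h f x(1), of "gauss h x" "t k"] N t(1)[of k]
    by (simp add: pos_le_divide_eq H_def[abs_def] mult.commute)
  have upper: "\<forall>\<^sub>F k in sequentially. ?q k < - f (gauss h x) + e" if e: "e > 0" for e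
  proof -
    \<comment> \<open>The unit vectors where \<open>f\<close> is too small by \<open>e\<close>. None
      of them is a normal of \<open>h\<close> at \<open>x\<close>, so on this compact set the
      quotient stays strictly below the gauge.\<close>
    define Z where "Z = sphere 0 1 \<inter> {u. f u \<le> f (gauss h x) - e}"
    have "\<forall>\<^sub>F k in sequentially. normals (H (t k)) x \<inter> Z = {}"
    proof (cases "Z = {}")
      case False
      have "closedin (top_of_set (sphere 0 1)) Z"
        unfolding Z_def using continuous_closedin_preimage[OF f(1), of "{..f (gauss h x) - e}"]
        by (simp add: vimage_def)
      then have cZ: "compact Z" using closedin_compact compact_sphere by blast
      have ZS: "Z \<subseteq> sphere 0 1" by (auto simp: Z_def)
      have "continuous_on Z (\<lambda>u. (u \<bullet> x) / h u)"
        using continuous_on_subset[OF pos_even_continuous[OF h] ZS] pos_even_pos[OF h] ZS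
        by (intro continuous_intros) (auto simp: less_imp_neq[symmetric])
      then obtain z where z: "z \<in> Z" "\<And>u. u \<in> Z \<Longrightarrow> (u \<bullet> x) / h u \<le> (z \<bullet> x) / h z"
        using continuous_attains_sup[OF cZ False] by blast
      have zS: "z \<in> sphere 0 1" using z(1) ZS by auto
      have "z \<notin> normals h x" using z(1) e unfolding N by (auto simp: Z_def)
      then have "z \<bullet> x < ?g * h z" using wulff_gauge_upper[OF h zS, of x] zS by (force simp: normals_def)
      then have zg: "(z \<bullet> x) / h z < ?g" using pos_even_pos[OF h zS] by (simp add: pos_divide_less_eq)
      \<comment> \<open>Truncation at 0 makes \<open>M\<close> nonnegative, so that multiplying it
        by an upper bound for the exponential factor preserves the inequality.\<close>
      define M where "M = max 0 ((z \<bullet> x) / h z)"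
      have "M < ?g" using zg g by (simp add: M_def)
      have "(\<lambda>k. M * exp (t k * B) - ?g * exp (- (t k * B))) \<longlonglongrightarrow> M * exp (0 * B) - ?g * exp (- (0 * B))"
        by (intro tendsto_intros t(2))
      then have "\<forall>\<^sub>F k in sequentially. M * exp (t k * B) - ?g * exp (- (t k * B)) < 0"
        by (rule order_tendstoD(2)) (use \<open>M < ?g\<close> in simp)
      then show ?thesis
      proof eventually_elim
        case (elim k)
        show ?case
        proof (rule ccontr)
          assume "normals (H (t k)) x \<inter> Z \<noteq> {}"
          then obtain u where u: "u \<in> normals (H (t k)) x" "u \<in> Z" by blast
          have uS: "u \<in> sphere 0 1" using u(2) ZS by auto
          have "t k * \<bar>f v\<bar> \<le> t k * B" if "v \<in> sphere 0 1" for v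
            using B[OF that] t(1)[of k] by simp
          then have ab: "\<bar>t k * f u\<bar> \<le> t k * B" "\<bar>t k * f (gauss h x)\<bar> \<le> t k * B"
            using uS gauss_sphere[OF h, of x] t(1)[of k] by (auto simp: abs_mult)
          have fb: "- (t k * B) \<le> - (t k * f u)" "- (t k * f u) \<le> t k * B"
            "- (t k * B) \<le> - (t k * f (gauss h x))"
            using abs_le_D1[OF ab(1)] abs_le_D2[OF ab(1)] abs_le_D1[OF ab(2)] by (simp_all only: neg_le_iff_le)
          have "wulff_gauge (H (t k)) x = (u \<bullet> x) / H (t k) u"
            using u(1) pos_even_pos[OF H uS, of "t k", THEN less_imp_neq] by (simp add: normals_def)
          also have "\<dots> = (u \<bullet> x) / h u * exp (- (t k * f u))"
            by (simp add: H_def exp_minus inverse_eq_divide)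
          also have "\<dots> \<le> M * exp (- (t k * f u))"
            using z(2)[OF u(2)] by (intro mult_right_mono) (auto simp: M_def)
          also have "\<dots> \<le> M * exp (t k * B)"
            using fb by (intro mult_left_mono) (auto simp: M_def)
          also have "\<dots> < ?g * exp (- (t k * B))" using elim by simp
          also have "\<dots> \<le> ?g * exp (- (t k * f (gauss h x)))"
            using fb g by (intro mult_left_mono) auto
          also have "\<dots> \<le> wulff_gauge (H (t k)) x"
          proof -
            have p: "wulff_gauge (H (t k)) x > 0" by (rule wulff_gauge_pos[OF H x(1)])
            have "- (t k * f (gauss h x)) \<le> ln (wulff_gauge (H (t k)) x) - ln ?g"
              using ln_gauge_perturb(1)[OF h f x(1), of "gauss h x" "t k"] N by (simp add: H_def[abs_def])
            then have "- (t k * f (gauss h x)) \<le> ln (wulff_gauge (H (t k)) x / ?g)"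
              using p g by (simp add: ln_div)
            then have "exp (- (t k * f (gauss h x))) \<le> wulff_gauge (H (t k)) x / ?g"
              using p g by (subst (asm) ln_ge_iff) auto
            then show ?thesis using g by (simp add: pos_le_divide_eq mult.commute)
          qed
          finally show False by simp
        qed
      qed
    qed simp
    then show ?thesis
    proof eventually_elim
      case (elim k)
      obtain u where u: "u \<in> normals (H (t k)) x" using normals_nonempty[OF H] by blast
      then have "u \<notin> Z" "u \<in> sphere 0 1" using elim by (auto simp: normals_def)
      then have fu: "f u > f (gauss h x) - e" by (simp add: Z_def)
      have "ln (wulff_gauge (H (t k)) x) - ln ?g \<le> - (t k * f u)"
        using ln_gauge_perturb(2)[OF h f x(1), of u "t k"] u by (simp add: H_def[abs_def])
      then have "?q k \<le> - f u" using t(1)[of k] by (simp add: pos_divide_le_eq mult.commute)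
      then show ?case using fu by linarith
    qed
  qed
  have "?q \<longlonglongrightarrow> - f (gauss h x)"
  proof (rule order_tendstoI)
    fix a assume "a < - f (gauss h x)"
    then have "\<forall>k. a < ?q k" using lower less_le_trans by blast
    then show "\<forall>\<^sub>F k in sequentially. a < ?q k" by (rule always_eventually)
  next
    fix a assume "- f (gauss h x) < a"
    then show "\<forall>\<^sub>F k in sequentially. ?q k < a" using upper[of "a + f (gauss h x)"] by simp
  qed
  then show ?thesis by (simp only: H_def[abs_def])
qed

lemma continuous_ln_gauge:
  assumes "pos_even h"
  shows "continuous_on (sphere 0 1) (\<lambda>x. ln (wulff_gauge h x))"
proof (rule continuous_on_ln)
  show "continuous_on (sphere 0 1) (wulff_gauge h)"
    by (rule continuous_on_subset[OF wulff_gauge_continuous[OF assms]]) simp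
  show "\<forall>x\<in>sphere 0 1. wulff_gauge h x \<noteq> 0"
    using wulff_gauge_pos[OF assms] by (metis less_irrefl norm_zero zero_neq_one mem_sphere_0)
qed

text \<open>Minus the integral of the logarithm of the radial function, so the problem becomes a
  minimisation.\<close>

definition log_gauge :: "'a::euclidean_space measure \<Rightarrow> ('a \<Rightarrow> real) \<Rightarrow> real" where
  "log_gauge lam h = (\<integral>x. ln (wulff_gauge h x) \<partial>lam)"

lemma log_gauge_variation:
  fixes h :: "'a::euclidean_space \<Rightarrow> real"
  assumes lam: "class_M lam"
    and h: "pos_even h" and f: "continuous_on (sphere 0 1) f" "\<And>u. u \<in> sphere 0 1 \<Longrightarrow> f (- u) = f u"
    and t: "\<And>k. t k > 0" "t \<longlonglongrightarrow> 0"
  shows "(\<lambda>k. (log_gauge lam (\<lambda>u. h u * exp (t k * f u)) - log_gauge lam h) / t k)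
    \<longlonglongrightarrow> - (\<integral>x. f (gauss h x) \<partial>lam)"
proof -
  define H where "H s u = h u * exp (s * f u)" for s u
  have H: "pos_even (H s)" for s unfolding H_def by (rule pos_even_perturb[OF h f])
  have nf: "nonzero_finite_borel lam" using lam by (simp add: class_M_def)
  have sp: "space lam = sphere 0 1" by (rule space_borel_on_sphere[OF nf])
  interpret finite_measure lam using nf by (simp add: nonzero_finite_borel_def)
  obtain B where B: "\<And>u. u \<in> sphere 0 1 \<Longrightarrow> \<bar>f u\<bar> \<le> B" using continuous_sphere_bounded[OF f(1)] by blast
  have I: "integrable lam (\<lambda>x. ln (wulff_gauge k x))" if "pos_even k" for k
    by (rule integrable_continuous_sphere[OF nf continuous_ln_gauge[OF that]])
  have "(\<lambda>k. \<integral>x. (ln (wulff_gauge (H (t k)) x) - ln (wulff_gauge h x)) / t k \<partial>lam) \<longlonglongrightarrow> (\<integral>x. - f (gauss h x) \<partial>lam)"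
  proof (rule integral_dominated_convergence[where w="\<lambda>_. B"])
    show "(\<lambda>x. - f (gauss h x)) \<in> borel_measurable lam"
      using measurable_comp_gauss[OF nf h f(1)] by simp
    show "(\<lambda>x. (ln (wulff_gauge (H (t k)) x) - ln (wulff_gauge h x)) / t k) \<in> borel_measurable lam" for k
      using I[OF H] I[OF h] by measurable
    show "integrable lam (\<lambda>_. B)" by simp
    show "AE x in lam. (\<lambda>k. (ln (wulff_gauge (H (t k)) x) - ln (wulff_gauge h x)) / t k) \<longlonglongrightarrow> - f (gauss h x)"
      using AE_regular[OF lam h] AE_space
    proof eventually_elim
      case (elim x)
      then have "x \<noteq> 0" using sp by auto
      then show ?case using ln_gauge_perturb_limit[OF h f _ _ t] elim(1) by (simp add: H_def[abs_def])
    qed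
    show "AE x in lam. norm ((ln (wulff_gauge (H (t k)) x) - ln (wulff_gauge h x)) / t k) \<le> B" for k
    proof (rule AE_I2)
      fix x assume "x \<in> space lam"
      then have "x \<noteq> 0" using sp by auto
      then show "norm ((ln (wulff_gauge (H (t k)) x) - ln (wulff_gauge h x)) / t k) \<le> B"
        using ln_gauge_perturb_bound[OF h f _ B t(1)[of k]] t(1)[of k]
        by (simp add: H_def[abs_def] abs_div pos_divide_le_eq mult.commute)
    qed
  qed
  then show ?thesis
    using I[OF H] I[OF h] by (simp add: log_gauge_def H_def[abs_def])
qed

section \<open>First variation of the constraint\<close>

definition orlicz :: "('a::euclidean_space \<Rightarrow> real \<Rightarrow> real) \<Rightarrow> 'a measure \<Rightarrow> ('a \<Rightarrow> real) \<Rightarrow> real" where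
  "orlicz G \<mu> h = (\<integral>u. G u (h u) \<partial>\<mu>)"

lemma continuous_orlicz:
  assumes "class_C G" "pos_even h"
  shows "continuous_on (sphere 0 1) (\<lambda>u. G u (h u))"
  using pos_even_continuous[OF assms(2)] pos_even_pos[OF assms(2)]
  by (intro class_C_continuous[OF assms(1)] continuous_intros) auto

lemma class_C_has_derivative:
  assumes "class_C G" "u \<in> sphere 0 1" "s > 0"
  shows "(G u has_real_derivative psi_t G u s) (at s)"
  using assms unfolding class_C_def psi_t_def DERIV_deriv_iff_real_differentiable by blast

text \<open>The mean value theorem dominates the difference quotients; steps of at most 1 keep the
  intermediate points in the compact parameter interval \<open>{0..1}\<close>, over which the
  derivative is bounded.\<close>

lemma orlicz_variation:
  fixes h :: "'a::euclidean_space \<Rightarrow> real"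
  assumes mu: "nonzero_finite_borel \<mu>" and G: "class_C G"
    and h: "pos_even h" and f: "continuous_on (sphere 0 1) f" "\<And>u. u \<in> sphere 0 1 \<Longrightarrow> f (- u) = f u"
    and t: "\<And>k. 0 < t k" "\<And>k. t k \<le> 1" "t \<longlonglongrightarrow> 0"
  shows "(\<lambda>k. (orlicz G \<mu> (\<lambda>u. h u * exp (t k * f u)) - orlicz G \<mu> h) / t k)
    \<longlonglongrightarrow> (\<integral>u. psi_t G u (h u) * h u * f u \<partial>\<mu>)"
proof -
  define H where "H s u = h u * exp (s * f u)" for s u
  have H: "pos_even (H s)" for s unfolding H_def by (rule pos_even_perturb[OF h f])
  have sp: "space \<mu> = sphere 0 1" by (rule space_borel_on_sphere[OF mu])
  interpret finite_measure \<mu> using mu by (simp add: nonzero_finite_borel_def)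
  have der: "((\<lambda>s. G u (H s u)) has_real_derivative psi_t G u (H s u) * (H s u * f u)) (at s)"
    if u: "u \<in> sphere 0 1" for u s
  proof -
    have 1: "((\<lambda>s. H s u) has_real_derivative H s u * f u) (at s)"
      unfolding H_def by (auto intro!: derivative_eq_intros)
    show ?thesis
      by (rule DERIV_chain2[OF class_C_has_derivative[OF G u pos_even_pos[OF H u]] 1])
  qed
  let ?A = "sphere (0::'a) 1 \<times> {0..1::real}"
  have cH: "continuous_on ?A (\<lambda>p. H (snd p) (fst p))"
    unfolding H_def
    by (intro continuous_intros continuous_on_compose2[OF pos_even_continuous[OF h]] continuous_on_compose2[OF f(1)]) auto
  have cD: "continuous_on ?A (\<lambda>p. psi_t G (fst p) (H (snd p) (fst p)) * (H (snd p) (fst p) * f (fst p)))"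
    using pos_even_pos[OF H]
    by (intro continuous_intros class_C_continuous[OF G] cH continuous_on_compose2[OF f(1)]) auto
  have "bounded ((\<lambda>p. psi_t G (fst p) (H (snd p) (fst p)) * (H (snd p) (fst p) * f (fst p))) ` ?A)"
    by (intro compact_imp_bounded compact_continuous_image[OF cD] compact_Times compact_sphere compact_Icc)
  then obtain B where B: "\<And>u s. u \<in> sphere 0 1 \<Longrightarrow> 0 \<le> s \<Longrightarrow> s \<le> 1 \<Longrightarrow> \<bar>psi_t G u (H s u) * (H s u * f u)\<bar> \<le> B"
    unfolding bounded_iff by force
  have I: "integrable \<mu> (\<lambda>u. G u (k u))" if "pos_even k" for k
    by (rule integrable_continuous_sphere[OF mu continuous_orlicz[OF G that]])
  have H0: "H 0 u = h u" for u by (simp add: H_def)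
  have "(\<lambda>k. \<integral>u. (G u (H (t k) u) - G u (h u)) / t k \<partial>\<mu>) \<longlonglongrightarrow> (\<integral>u. psi_t G u (h u) * h u * f u \<partial>\<mu>)"
  proof (rule integral_dominated_convergence[where w="\<lambda>_. B"])
    show "(\<lambda>u. psi_t G u (h u) * h u * f u) \<in> borel_measurable \<mu>"
      using pos_even_continuous[OF h] pos_even_pos[OF h] f(1)
      by (intro measurable_continuous_sphere[OF mu] continuous_intros class_C_continuous[OF G]) auto
    show "(\<lambda>u. (G u (H (t k) u) - G u (h u)) / t k) \<in> borel_measurable \<mu>" for k
      using I[OF H] I[OF h] by measurable
    show "integrable \<mu> (\<lambda>_. B)" by simp
    show "AE u in \<mu>. (\<lambda>k. (G u (H (t k) u) - G u (h u)) / t k) \<longlonglongrightarrow> psi_t G u (h u) * h u * f u"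
    proof (rule AE_I2)
      fix u assume "u \<in> space \<mu>"
      then have u: "u \<in> sphere 0 1" using sp by simp
      have "((\<lambda>s. (G u (H (0 + s) u) - G u (H 0 u)) / s) \<longlongrightarrow> psi_t G u (H 0 u) * (H 0 u * f u)) (at 0)"
        using der[OF u, of 0] unfolding DERIV_def .
      moreover have "filterlim t (at 0) sequentially"
        using t(1,3) by (intro filterlim_atI) (auto simp: less_imp_neq[symmetric])
      ultimately show "(\<lambda>k. (G u (H (t k) u) - G u (h u)) / t k) \<longlonglongrightarrow> psi_t G u (h u) * h u * f u"
        using filterlim_compose[of "\<lambda>s. (G u (H (0 + s) u) - G u (H 0 u)) / s"] by (fastforce simp: H0 mult.assoc)
    qed
    show "AE u in \<mu>. norm ((G u (H (t k) u) - G u (h u)) / t k) \<le> B" for k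
    proof (rule AE_I2)
      fix u assume "u \<in> space \<mu>"
      then have u: "u \<in> sphere 0 1" using sp by simp
      obtain z where z: "0 < z" "z < t k" "G u (H (t k) u) - G u (H 0 u) = (t k - 0) * (psi_t G u (H z u) * (H z u * f u))"
        using MVT2[OF t(1)[of k], of "\<lambda>s. G u (H s u)" "\<lambda>s. psi_t G u (H s u) * (H s u * f u)"] der[OF u] by auto
      then have "(G u (H (t k) u) - G u (h u)) / t k = psi_t G u (H z u) * (H z u * f u)"
        using t(1)[of k] by (simp add: H0)
      then show "norm ((G u (H (t k) u) - G u (h u)) / t k) \<le> B"
        using B[OF u, of z] z(1,2) t(2)[of k] by simp
    qed
  qed
  then show ?thesis
    using I[OF H] I[OF h] by (simp add: orlicz_def H_def[abs_def])
qed

section \<open>Reflection in the origin\<close>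

lemma measurable_uminus_sphere:
  assumes "nonzero_finite_borel (M :: 'a::euclidean_space measure)"
  shows "uminus \<in> measurable M M"
proof -
  have "(uminus :: 'a \<Rightarrow> 'a) \<in> measurable (restrict_space borel (sphere 0 1)) (restrict_space borel (sphere 0 1))"
    by (intro measurable_restrict_space3) auto
  then show ?thesis
    using measurable_cong_sets[OF sets_nonzero_finite_borel[OF assms] sets_nonzero_finite_borel[OF assms]] by blast
qed

lemma distr_uminus_even:
  assumes M: "nonzero_finite_borel M" "even_measure M"
  shows "distr M M uminus = M"
proof (rule measure_eqI)
  have sp: "space M = sphere 0 1" by (rule space_borel_on_sphere[OF M(1)])
  have m: "uminus \<in> measurable M M" by (rule measurable_uminus_sphere[OF M(1)])
  fix A assume "A \<in> sets (distr M M uminus)"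
  then have A: "A \<in> sets M" by simp
  have "uminus -` A \<inter> space M = uminus ` A"
    using sets.sets_into_space[OF A] sp by (force simp: image_iff)
  then show "emeasure (distr M M uminus) A = emeasure M A"
    using M(2) A by (simp add: emeasure_distr[OF m] even_measure_def)
qed simp

lemma integral_even:
  fixes f :: "'a::euclidean_space \<Rightarrow> real"
  assumes M: "nonzero_finite_borel M" "even_measure M" and f: "f \<in> borel_measurable M"
  shows "(\<integral>x. f (- x) \<partial>M) = (\<integral>x. f x \<partial>M)"
proof -
  have m: "uminus \<in> measurable M M" by (rule measurable_uminus_sphere[OF M(1)])
  have "(\<integral>x. f x \<partial>M) = (\<integral>x. f x \<partial>distr M M uminus)" using distr_uminus_even[OF M] by simp
  also have "\<dots> = (\<integral>x. f (- x) \<partial>M)" by (rule integral_distr[OF m f])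
  finally show ?thesis by simp
qed

lemma normals_minus:
  assumes "pos_even h"
  shows "normals h (- x) = uminus ` normals h x"
proof -
  have "u \<in> normals h (- x) \<longleftrightarrow> - u \<in> normals h x" for u
    using pos_even_even[OF assms, of u] by (auto simp: normals_def wulff_gauge_minus[OF assms])
  moreover have "u \<in> uminus ` A \<longleftrightarrow> - u \<in> A" for u :: 'a and A by force
  ultimately show ?thesis by blast
qed

text \<open>Oddness is confined to regular directions: elsewhere \<open>gauss\<close> takes one
  fixed default value.\<close>

lemma gauss_minus:
  assumes "pos_even h" "x \<notin> nonregular h"
  shows "gauss h (- x) = - gauss h x"
proof -
  have N: "normals h (- x) = {- gauss h x}"
    using normals_minus[OF assms(1)] normals_eq_gauss[OF assms] by auto
  then have "- x \<notin> nonregular h" by (auto simp: nonregular_def)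
  then show ?thesis using normals_eq_gauss[OF assms(1), of "- x"] N by auto
qed

section \<open>The Euler--Lagrange equation\<close>

lemma psi_t_even:
  assumes "\<forall>\<xi>\<in>sphere 0 1. \<forall>t>0. G \<xi> t = G (- \<xi>) t" "u \<in> sphere 0 1" "s > 0"
  shows "psi_t G (- u) s = psi_t G u s"
  unfolding psi_t_def
proof (rule deriv_cong_ev[OF _ refl])
  have "\<forall>\<^sub>F t in nhds s. t \<in> {0<..}" using assms(3) by (intro eventually_nhds_in_open) auto
  then show "\<forall>\<^sub>F t in nhds s. G (- u) t = G u t" 
    by eventually_elim (use assms(1,2) in simp)
qed

lemma continuous_psi_t_mult:
  assumes "class_C G" "pos_even h"
  shows "continuous_on (sphere 0 1) (\<lambda>u. psi_t G u (h u) * h u)"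
  using pos_even_continuous[OF assms(2)] pos_even_pos[OF assms(2)]
  by (intro class_C_continuous[OF assms(1)] continuous_intros) auto

text \<open>If \<open>f\<close> lowers the constraint strictly to first order, then
  \<open>h exp(t f)\<close> is admissible for small \<open>t > 0\<close>; minimality fixes the sign
  of the first variation of \<open>log_gauge\<close>, which is minus the integral in the
  conclusion.\<close>

lemma euler_lagrange_even:
  fixes h :: "'a::euclidean_space \<Rightarrow> real"
  assumes lam: "class_M lam" and mu: "nonzero_finite_borel \<mu>" and G: "class_C G"
    and h: "pos_even h"
    and min: "\<And>k. pos_even k \<Longrightarrow> orlicz G \<mu> k \<le> orlicz G \<mu> h \<Longrightarrow> log_gauge lam h \<le> log_gauge lam k"
    and f: "continuous_on (sphere 0 1) f" "\<And>u. u \<in> sphere 0 1 \<Longrightarrow> f (- u) = f u"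
    and neg: "(\<integral>u. psi_t G u (h u) * h u * f u \<partial>\<mu>) < 0"
  shows "(\<integral>x. f (gauss h x) \<partial>lam) \<le> 0"
proof -
  define t where "t k = inverse (real (Suc k))" for k
  have t: "0 < t k" "t k \<le> 1" for k by (auto simp: t_def divide_simps)
  have t0: "t \<longlonglongrightarrow> 0" unfolding t_def by (rule LIMSEQ_inverse_real_of_nat)
  have "\<forall>\<^sub>F k in sequentially. (orlicz G \<mu> (\<lambda>u. h u * exp (t k * f u)) - orlicz G \<mu> h) / t k < 0"
    by (rule order_tendstoD(2)[OF orlicz_variation[OF mu G h f t t0] neg])
  then have "\<forall>\<^sub>F k in sequentially. 0 \<le> (log_gauge lam (\<lambda>u. h u * exp (t k * f u)) - log_gauge lam h) / t k"
  proof eventually_elim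
    case (elim k)
    then have "orlicz G \<mu> (\<lambda>u. h u * exp (t k * f u)) \<le> orlicz G \<mu> h"
      using t(1)[of k] by (simp add: divide_less_0_iff)
    then have "log_gauge lam h \<le> log_gauge lam (\<lambda>u. h u * exp (t k * f u))"
      by (intro min pos_even_perturb[OF h f])
    then show ?case using t(1)[of k] by simp
  qed
  with log_gauge_variation[OF lam h f t(1) t0] have "0 \<le> - (\<integral>x. f (gauss h x) \<partial>lam)"
    by (rule tendsto_lowerbound) auto
  then show ?thesis by simp
qed

lemma integral_pos_sphere:
  fixes f :: "'a::euclidean_space \<Rightarrow> real"
  assumes mu: "nonzero_finite_borel \<mu>" and f: "continuous_on (sphere 0 1) f" "\<And>u. u \<in> sphere 0 1 \<Longrightarrow> 0 < f u"
  shows "0 < (\<integral>u. f u \<partial>\<mu>)"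
proof -
  interpret finite_measure \<mu> using mu by (simp add: nonzero_finite_borel_def)
  have sp: "space \<mu> = sphere 0 1" by (rule space_borel_on_sphere[OF mu])
  obtain a where a: "a \<in> sphere 0 1" "\<And>u. u \<in> sphere 0 1 \<Longrightarrow> f a \<le> f u"
    using continuous_attains_inf[OF compact_sphere sphere_nonempty f(1)] by blast
  have "emeasure \<mu> (space \<mu>) \<noteq> 0" using mu sp by (simp add: nonzero_finite_borel_def)
  then have "0 < measure \<mu> (space \<mu>)" by (simp add: emeasure_eq_measure zero_less_measure_iff)
  then have "0 < f a * measure \<mu> (space \<mu>)" using f(2)[OF a(1)] by simp
  also have "\<dots> = (\<integral>u. f a \<partial>\<mu>)" by simp
  also have "\<dots> \<le> (\<integral>u. f u \<partial>\<mu>)"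
    using a(2) sp by (intro integral_mono integrable_continuous_sphere[OF mu f(1)]) auto
  finally show ?thesis .
qed

lemma continuous_on_sphere_minus:
  assumes "continuous_on (sphere (0::'a::euclidean_space) 1) f"
  shows "continuous_on (sphere 0 1) (\<lambda>u. f (- u))"
  by (rule continuous_on_compose2[OF assms]) (auto intro!: continuous_intros)

text \<open>For even \<open>f\<close>, shifting by the constant that makes the first variation of the constraint slightly
  negative yields one inequality, and \<open>- f\<close> the other; odd functions integrate to zero on both sides.\<close>

lemma euler_lagrange:
  fixes h :: "'a::euclidean_space \<Rightarrow> real"
  assumes lam: "class_M lam" "even_measure lam"
    and mu: "nonzero_finite_borel \<mu>" "even_measure \<mu>"
    and G: "class_C G" "\<forall>u\<in>sphere 0 1. \<forall>t>0. psi_t G u t > 0"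
      "\<forall>\<xi>\<in>sphere 0 1. \<forall>t>0. G \<xi> t = G (- \<xi>) t"
    and h: "pos_even h"
    and min: "\<And>k. pos_even k \<Longrightarrow> orlicz G \<mu> k \<le> orlicz G \<mu> h \<Longrightarrow> log_gauge lam h \<le> log_gauge lam k"
  obtains c where "c > 0"
    "\<And>f. continuous_on (sphere 0 1) f \<Longrightarrow>
      (\<integral>x. f (gauss h x) \<partial>lam) = c * (\<integral>u. psi_t G u (h u) * h u * f u \<partial>\<mu>)"
proof -
  have nf: "nonzero_finite_borel lam" using lam by (simp add: class_M_def)
  define A where "A f = (\<integral>u. psi_t G u (h u) * h u * f u \<partial>\<mu>)" for f :: "'a \<Rightarrow> real"
  define L where "L f = (\<integral>x. f (gauss h x) \<partial>lam)" for f :: "'a \<Rightarrow> real"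
  have cw: "continuous_on (sphere 0 1) (\<lambda>u. psi_t G u (h u) * h u)"
    by (rule continuous_psi_t_mult[OF G(1) h])
  have IA: "integrable \<mu> (\<lambda>u. psi_t G u (h u) * h u * f u)" if "continuous_on (sphere 0 1) f" for f
    by (intro integrable_continuous_sphere[OF mu(1)] continuous_on_mult[OF cw that])
  have IL: "integrable lam (\<lambda>x. f (gauss h x))" if "continuous_on (sphere 0 1) f" for f :: "'a \<Rightarrow> real"
    by (rule integrable_comp_gauss[OF nf h that])
  have A_lin: "A (\<lambda>u. a * f u + b * g u) = a * A f + b * A g"
    if "continuous_on (sphere 0 1) f" "continuous_on (sphere 0 1) g" for a b f g
  proof -
    have "A (\<lambda>u. a * f u + b * g u) = (\<integral>u. a * (psi_t G u (h u) * h u * f u) + b * (psi_t G u (h u) * h u * g u) \<partial>\<mu>)"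
      unfolding A_def by (intro Bochner_Integration.integral_cong refl) (simp add: algebra_simps)
    then show ?thesis using IA[OF that(1)] IA[OF that(2)] by (simp add: A_def)
  qed
  have L_lin: "L (\<lambda>u. a * f u + b * g u) = a * L f + b * L g"
    if "continuous_on (sphere 0 1) f" "continuous_on (sphere 0 1) g" for a b f g
    using IL[OF that(1)] IL[OF that(2)] by (simp add: L_def)
  have c1: "continuous_on (sphere 0 1) (\<lambda>u::'a. 1::real)" by simp
  have A1: "A (\<lambda>_. 1) > 0"
    unfolding A_def using G(2) pos_even_pos[OF h] cw by (intro integral_pos_sphere[OF mu(1)]) auto
  have L1: "L (\<lambda>_. 1) > 0"
    unfolding L_def by (intro integral_pos_sphere[OF nf]) auto
  \<comment> \<open>The multiplier is read off at \<open>f = 1\<close>, that is, from dilations of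
    the body.\<close>
  define c where "c = L (\<lambda>_. 1) / A (\<lambda>_. 1)"
  have c: "c > 0" using A1 L1 by (simp add: c_def)
  have le: "L f \<le> c * A f" if f: "continuous_on (sphere 0 1) f" "\<And>u. u \<in> sphere 0 1 \<Longrightarrow> f (- u) = f u" for f
  proof (rule field_le_epsilon)
    fix e :: real assume e: "e > 0"
    \<comment> \<open>The first summand alone would make the variation of the constraint vanish; the
      second makes it strictly negative and contributes exactly \<open>e\<close> on the side of
      \<open>L\<close>.\<close>
    define b where "b = A f / A (\<lambda>_. 1) + e / L (\<lambda>_. 1)"
    have "A (\<lambda>u. 1 * f u + (- b) * 1) = - (e / L (\<lambda>_. 1)) * A (\<lambda>_. 1)"
      unfolding A_lin[OF f(1) c1] using A1 by (simp add: b_def field_simps)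
    also have "\<dots> < 0" using e A1 L1 by simp
    finally have "L (\<lambda>u. 1 * f u + (- b) * 1) \<le> 0"
      unfolding L_def A_def using f
      by (intro euler_lagrange_even[OF lam(1) mu(1) G(1) h min]) (auto intro!: continuous_intros)
    then have "L f \<le> b * L (\<lambda>_. 1)" unfolding L_lin[OF f(1) c1] by simp
    also have "\<dots> = c * A f + e" using A1 L1 by (simp add: b_def c_def distrib_right)
    finally show "L f \<le> c * A f + e" .
  qed
  have eq: "L f = c * A f" if f: "continuous_on (sphere 0 1) f" "\<And>u. u \<in> sphere 0 1 \<Longrightarrow> f (- u) = f u" for f
  proof (rule antisym[OF le[OF f]])
    \<comment> \<open>The zero summand brings \<open>- f\<close> into the shape of the linearity
      facts.\<close>
    have "L (\<lambda>u. (- 1) * f u + 0 * 1) \<le> c * A (\<lambda>u. (- 1) * f u + 0 * 1)"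
      using f by (intro le) (auto intro!: continuous_intros)
    then show "c * A f \<le> L f" unfolding A_lin[OF f(1) c1] L_lin[OF f(1) c1] by simp
  qed
  show thesis
  proof (rule that[OF c])
    fix f :: "'a \<Rightarrow> real" assume f: "continuous_on (sphere 0 1) f"
    have f': "continuous_on (sphere 0 1) (\<lambda>u. f (- u))" by (rule continuous_on_sphere_minus[OF f])
    have "A (\<lambda>u. f (- u)) = A f"
    proof -
      have "A f = (\<integral>u. psi_t G (- u) (h (- u)) * h (- u) * f (- u) \<partial>\<mu>)"
        unfolding A_def using IA[OF f] by (intro integral_even[OF mu, symmetric]) auto
      also have "\<dots> = A (\<lambda>u. f (- u))"
        unfolding A_def
      proof (intro Bochner_Integration.integral_cong refl)
        fix u assume "u \<in> space \<mu>"
        then have u: "u \<in> sphere 0 1" using space_borel_on_sphere[OF mu(1)] by simp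
        show "psi_t G (- u) (h (- u)) * h (- u) * f (- u) = psi_t G u (h u) * h u * f (- u)"
          using psi_t_even[OF G(3) u pos_even_pos[OF h u]] pos_even_even[OF h u] by simp
      qed
      finally show ?thesis by simp
    qed
    moreover have "L (\<lambda>u. f (- u)) = L f"
    proof -
      have "L f = (\<integral>x. f (gauss h (- x)) \<partial>lam)"
        unfolding L_def using IL[OF f] by (intro integral_even[OF nf lam(2), symmetric]) auto
      also have "\<dots> = L (\<lambda>u. f (- u))"
        unfolding L_def
      proof (rule integral_cong_AE)
        have "(\<lambda>x. f (gauss h x)) \<in> borel_measurable lam" using IL[OF f] by simp
        moreover have "uminus \<in> measurable lam lam"
          by (rule measurable_uminus_sphere[OF nf])
        ultimately show "(\<lambda>x. f (gauss h (- x))) \<in> borel_measurable lam"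
          by (rule measurable_compose[rotated])
        show "(\<lambda>x. f (- gauss h x)) \<in> borel_measurable lam" using IL[OF f'] by simp
        show "AE x in lam. f (gauss h (- x)) = f (- gauss h x)"
          using AE_regular[OF lam(1) h] by eventually_elim (simp add: gauss_minus[OF h])
      qed
      finally show ?thesis by simp
    qed
    \<comment> \<open>This is the even part of \<open>f\<close>; \<open>f\<close> and its reflection
      have the same \<open>L\<close> and the same \<open>A\<close>.\<close>
    moreover have "L (\<lambda>u. (1/2) * f u + (1/2) * f (- u)) = c * A (\<lambda>u. (1/2) * f u + (1/2) * f (- u))"
      using f f' by (intro eq continuous_intros) auto
    ultimately have "L f = c * A f" unfolding A_lin[OF f f'] L_lin[OF f f'] by simp
    then show "(\<integral>x. f (gauss h x) \<partial>lam) = c * (\<integral>u. psi_t G u (h u) * h u * f u \<partial>\<mu>)"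
      by (simp add: L_def A_def)
  qed
qed

text \<open>Testing with \<open>w * f\<close>, where \<open>w = 1 / (h * G_t)\<close>, cancels the
  weight on the side of \<open>\<mu>\<close>. The image under \<open>gauss h\<close> of
  \<open>lam\<close> with density \<open>w (gauss h x)\<close> and the multiple of
  \<open>\<mu>\<close> by \<open>c\<close> then agree on continuous functions, hence as
  measures.\<close>

lemma J_tilde_eq_of_euler_lagrange:
  fixes h :: "'a::euclidean_space \<Rightarrow> real"
  assumes lam: "class_M lam" and mu: "nonzero_finite_borel \<mu>"
    and G: "class_C G" "\<forall>u\<in>sphere 0 1. \<forall>t>0. psi_t G u t > 0"
    and h: "is_support h" and c: "c > 0"
    and el: "\<And>f. continuous_on (sphere 0 1) f \<Longrightarrow>
      (\<integral>x. f (gauss h x) \<partial>lam) = c * (\<integral>u. psi_t G u (h u) * h u * f u \<partial>\<mu>)"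
    and om: "\<omega> \<in> sets (sphere_borel :: 'a measure)"
  shows "J_tilde G lam (wulff h) \<omega> = c * measure \<mu> \<omega>"
proof -
  have pe: "pos_even h" using h by (rule is_support_pos_even)
  have nf: "nonzero_finite_borel lam" using lam by (simp add: class_M_def)
  have sp: "space \<mu> = sphere 0 1" by (rule space_borel_on_sphere[OF mu])
  have smu: "sets \<mu> = sets sphere_borel" using mu by (simp add: nonzero_finite_borel_def borel_on_sphere_def)
  interpret mu: finite_measure \<mu> using mu by (simp add: nonzero_finite_borel_def)
  interpret lam: finite_measure lam using nf by (simp add: nonzero_finite_borel_def)
  define w where "w u = 1 / (h u * psi_t G u (h u))" for u
  have pos: "h u * psi_t G u (h u) > 0" if "u \<in> sphere 0 1" for u
    using that pos_even_pos[OF pe] G(2) by simp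
  have cw: "continuous_on (sphere 0 1) w"
  proof -
    have "continuous_on (sphere 0 1) (\<lambda>u. h u * psi_t G u (h u))"
      using continuous_psi_t_mult[OF G(1) pe] by (simp add: mult.commute)
    moreover have "\<forall>u\<in>sphere 0 1. h u * psi_t G u (h u) \<noteq> 0" using pos by (metis less_irrefl)
    ultimately show ?thesis unfolding w_def by (intro continuous_on_divide continuous_on_const) 
  qed
  have wg0: "w (gauss h x) \<ge> 0" for x
    using pos[OF gauss_sphere[OF pe]] by (simp add: w_def less_imp_le)
  have Iwg: "integrable lam (\<lambda>x. w (gauss h x))" by (rule integrable_comp_gauss[OF nf pe cw])
  have mwg: "(\<lambda>x. w (gauss h x)) \<in> borel_measurable lam" using Iwg by simp
  have mg: "gauss h \<in> measurable (density lam (\<lambda>x. ennreal (w (gauss h x)))) sphere_borel"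
    using measurable_gauss[OF nf pe] by simp
  define M where "M = distr (density lam (\<lambda>x. ennreal (w (gauss h x)))) sphere_borel (gauss h)"
  define N where "N = density \<mu> (\<lambda>_. ennreal c)"
  have M_int: "(\<integral>u. f u \<partial>M) = (\<integral>x. w (gauss h x) * f (gauss h x) \<partial>lam)"
    if f: "f \<in> borel_measurable sphere_borel" for f :: "'a \<Rightarrow> real"
  proof -
    have fg: "(\<lambda>x. f (gauss h x)) \<in> borel_measurable lam"
      by (rule measurable_compose[OF measurable_gauss[OF nf pe] f])
    have "(\<integral>u. f u \<partial>M) = (\<integral>x. f (gauss h x) \<partial>density lam (\<lambda>x. ennreal (w (gauss h x))))"
      unfolding M_def by (rule integral_distr[OF mg f])
    also have "\<dots> = (\<integral>x. w (gauss h x) * f (gauss h x) \<partial>lam)"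
      using integral_density[OF fg mwg] wg0 by simp
    finally show ?thesis .
  qed
  have N_int: "(\<integral>u. f u \<partial>N) = c * (\<integral>u. f u \<partial>\<mu>)"
    if f: "f \<in> borel_measurable \<mu>" for f :: "'a \<Rightarrow> real"
    unfolding N_def using integral_density[OF f, of "\<lambda>_. c"] c by simp
  have "M = N"
  proof (rule measure_eq_of_integral_continuous)
    show "sets M = sets sphere_borel" by (simp add: M_def)
    show "sets N = sets sphere_borel" by (simp add: N_def smu)
    show "finite_measure M"
    proof (rule finite_measureI)
      have "gauss h -` space sphere_borel \<inter> space lam = space lam"
        using measurable_space[OF measurable_gauss[OF nf pe]] by auto
      then have "emeasure M (space M) = (\<integral>\<^sup>+x. ennreal (w (gauss h x)) \<partial>lam)"
        unfolding M_def using mwg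
        by (subst emeasure_distr[OF mg])
          (auto simp: emeasure_density intro!: nn_integral_cong split: split_indicator)
      also have "\<dots> < \<infinity>" using Iwg wg0 by (simp add: nn_integral_eq_integral)
      finally show "emeasure M (space M) \<noteq> \<infinity>" by simp
    qed
    show "finite_measure N"
      unfolding N_def by (intro finite_measureI) (simp add: emeasure_density mult.commute ennreal_mult_eq_top_iff mu.emeasure_finite)
    fix f :: "'a \<Rightarrow> real" assume "continuous_on UNIV f"
    then have f: "continuous_on (sphere 0 1) f" by (rule continuous_on_subset) simp
    then have f': "f \<in> borel_measurable sphere_borel"
      unfolding sphere_borel_def by (rule borel_measurable_continuous_on_restrict)
    have "(\<integral>u. f u \<partial>M) = (\<integral>x. w (gauss h x) * f (gauss h x) \<partial>lam)" by (rule M_int[OF f'])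
    also have "\<dots> = c * (\<integral>u. psi_t G u (h u) * h u * (w u * f u) \<partial>\<mu>)"
      using f cw by (intro el continuous_intros)
    also have "(\<integral>u. psi_t G u (h u) * h u * (w u * f u) \<partial>\<mu>) = (\<integral>u. f u \<partial>\<mu>)"
    proof (intro Bochner_Integration.integral_cong refl)
      fix u assume "u \<in> space \<mu>"
      then have "h u * psi_t G u (h u) > 0" using sp pos by simp
      then show "psi_t G u (h u) * h u * (w u * f u) = f u" by (auto simp: w_def)
    qed
    also have "c * (\<integral>u. f u \<partial>\<mu>) = (\<integral>u. f u \<partial>N)"
      using measurable_continuous_sphere[OF mu f] by (simp add: N_int)
    finally show "(\<integral>u. f u \<partial>M) = (\<integral>u. f u \<partial>N)" .
  qed
  have "J_tilde G lam (wulff h) \<omega> = (\<integral>x. w (gauss h x) * indicator \<omega> (gauss h x) \<partial>lam)"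
    unfolding J_tilde_wulff[OF lam h G(1) om] w_def by (simp add: mult.commute)
  also have "\<dots> = (\<integral>u. indicator \<omega> u \<partial>M)" using om by (intro M_int[symmetric]) simp
  also have "\<dots> = (\<integral>u. indicator \<omega> u \<partial>N)" by (simp add: \<open>M = N\<close>)
  also have "\<dots> = c * (\<integral>u. indicator \<omega> u \<partial>\<mu>)" using om smu by (intro N_int) simp
  also have "(\<integral>u. indicator \<omega> u \<partial>\<mu>) = measure \<mu> \<omega>" using om smu by simp
  finally show ?thesis .
qed

section \<open>Existence of a minimiser\<close>

lemma class_C_strict_mono:
  assumes G: "class_C G" "\<forall>u\<in>sphere 0 1. \<forall>t>0. psi_t G u t > 0"
    and "u \<in> sphere 0 1" "0 < s" "s < t"
  shows "G u s < G u t"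
proof (rule DERIV_pos_imp_increasing[OF \<open>s < t\<close>])
  fix x assume "s \<le> x" "x \<le> t"
  then show "\<exists>y. (G u has_real_derivative y) (at x) \<and> 0 < y"
    using class_C_has_derivative[OF G(1) \<open>u \<in> sphere 0 1\<close>, of x] G(2) \<open>u \<in> sphere 0 1\<close> \<open>0 < s\<close> by force
qed

lemma class_C_mono:
  assumes G: "class_C G" "\<forall>u\<in>sphere 0 1. \<forall>t>0. psi_t G u t > 0"
    and "u \<in> sphere 0 1" "0 < s" "s \<le> t"
  shows "G u s \<le> G u t"
  using class_C_strict_mono[OF G, of u s t] assms(3-5) by (cases "s = t") auto

lemma integrable_orlicz:
  assumes "nonzero_finite_borel \<mu>" "class_C G" "pos_even h"
  shows "integrable \<mu> (\<lambda>u. G u (h u))"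
  by (rule integrable_continuous_sphere[OF assms(1) continuous_orlicz[OF assms(2,3)]])

lemma integrable_ln_gauge:
  assumes "nonzero_finite_borel lam" "pos_even h"
  shows "integrable lam (\<lambda>x. ln (wulff_gauge h x))"
  by (rule integrable_continuous_sphere[OF assms(1) continuous_ln_gauge[OF assms(2)]])

lemma support_fun_wulff_improves:
  assumes mu: "nonzero_finite_borel \<mu>"
    and G: "class_C G" "\<forall>u\<in>sphere 0 1. \<forall>t>0. psi_t G u t > 0"
    and k: "pos_even (k :: 'a::euclidean_space \<Rightarrow> real)"
  shows "is_support (support_fun (wulff k))"
    "orlicz G \<mu> (support_fun (wulff k)) \<le> orlicz G \<mu> k"
    "log_gauge lam (support_fun (wulff k)) = log_gauge lam k"
proof -
  have sp: "space \<mu> = sphere 0 1" by (rule space_borel_on_sphere[OF mu])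
  show s: "is_support (support_fun (wulff k))" by (intro is_support_support_fun wulff_Kn_e k)
  then have pe: "pos_even (support_fun (wulff k))" by (rule is_support_pos_even)
  show "orlicz G \<mu> (support_fun (wulff k)) \<le> orlicz G \<mu> k"
    unfolding orlicz_def
    using sp pos_even_pos[OF pe] support_fun_wulff_le[OF k]
    by (intro integral_mono integrable_orlicz[OF mu G(1)] pe k class_C_mono[OF G]) auto
  show "log_gauge lam (support_fun (wulff k)) = log_gauge lam k"
    by (simp add: log_gauge_def wulff_gauge_support_fun[OF k])
qed

lemma is_support_lipschitz:
  assumes h: "is_support h" and R: "\<And>u. u \<in> sphere 0 1 \<Longrightarrow> h u \<le> R"
    and S: "u \<in> sphere 0 1" "v \<in> sphere 0 1"
  shows "\<bar>h u - h v\<bar> \<le> R * norm (u - v)"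
proof -
  have pe: "pos_even h" using h by (rule is_support_pos_even)
  have le: "support_fun (wulff h) u \<le> support_fun (wulff h) v + R * norm (u - v)" for u v
    by (rule support_fun_lipschitz[OF wulff_Kn_e[OF pe] wulff_norm_le[OF pe R]])
  show ?thesis
    using le[of u v] le[of v u] h S by (auto simp: is_support_def norm_minus_commute abs_le_iff)
qed

text \<open>The error is \<open>e\<close> times the gauge of \<open>k\<close>, which is at most
  \<open>1 / r\<close>; writing it as a multiple of \<open>h u \<ge> r\<close> costs the second
  factor \<open>1 / r\<close>.\<close>

lemma wulff_gauge_perturb_le:
  assumes h: "pos_even h" and k: "pos_even k" and r: "r > 0"
    and hr: "\<And>u. u \<in> sphere 0 1 \<Longrightarrow> r \<le> h u" and kr: "\<And>u. u \<in> sphere 0 1 \<Longrightarrow> r \<le> k u"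
    and e: "\<And>u. u \<in> sphere 0 1 \<Longrightarrow> k u \<le> h u + e" "e \<ge> 0" and x: "x \<in> sphere 0 1"
  shows "wulff_gauge h x \<le> wulff_gauge k x + e / r\<^sup>2"
proof (rule wulff_gauge_least[OF h])
  fix u :: 'a assume u: "u \<in> sphere 0 1"
  have g: "0 \<le> wulff_gauge k x" "wulff_gauge k x \<le> 1 / r"
    using wulff_gauge_nonneg(2)[OF k] wulff_gauge_bounds(1)[OF k x r kr] by auto
  have "u \<bullet> x \<le> wulff_gauge k x * k u" by (rule wulff_gauge_upper[OF k u])
  also have "\<dots> \<le> wulff_gauge k x * (h u + e)" using g e(1)[OF u] by (intro mult_left_mono) auto
  also have "\<dots> = wulff_gauge k x * h u + wulff_gauge k x * e" by (simp add: distrib_left)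
  also have "wulff_gauge k x * e \<le> 1 / r * e" using g e(2) by (intro mult_right_mono) auto
  also have "1 / r * e = e / r\<^sup>2 * r" using r by (simp add: power2_eq_square)
  also have "\<dots> \<le> e / r\<^sup>2 * h u" using hr[OF u] e(2) by (intro mult_left_mono) auto
  finally show "u \<bullet> x \<le> (wulff_gauge k x + e / r\<^sup>2) * h u" by (simp add: distrib_right)
qed

lemma pos_even_one: "pos_even (\<lambda>_. 1)"
  by (simp add: pos_even_def)

lemma log_gauge_one:
  assumes "nonzero_finite_borel lam"
  shows "log_gauge lam (\<lambda>_. 1) = 0"
proof -
  have "log_gauge lam (\<lambda>_. 1) = (\<integral>x. 0 \<partial>lam)"
    unfolding log_gauge_def
  proof (intro Bochner_Integration.integral_cong refl)
    fix x assume "x \<in> space lam"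
    then have x: "x \<in> sphere 0 1" using space_borel_on_sphere[OF assms] by simp
    have "wulff_gauge (\<lambda>_. 1) x = 1"
      using wulff_gauge_bounds[OF pos_even_one x, of 1] by simp
    then show "ln (wulff_gauge (\<lambda>_. 1) x) = 0" by simp
  qed
  then show ?thesis by simp
qed

lemma ln_gauge_bounds:
  assumes h: "pos_even h" and x: "x \<in> sphere 0 1"
    and r: "r > 0" "\<And>u. u \<in> sphere 0 1 \<Longrightarrow> r \<le> h u" and R: "\<And>u. u \<in> sphere 0 1 \<Longrightarrow> h u \<le> R"
  shows "- ln R \<le> ln (wulff_gauge h x)" "ln (wulff_gauge h x) \<le> - ln r"
proof -
  have "R > 0" using r R[OF x] r(2)[OF x] by linarith
  have b: "1 / R \<le> wulff_gauge h x" "wulff_gauge h x \<le> 1 / r"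
    using wulff_gauge_bounds[OF h x] r R by auto
  have p: "wulff_gauge h x > 0" using x by (intro wulff_gauge_pos[OF h]) auto
  show "- ln R \<le> ln (wulff_gauge h x)"
    using b(1) \<open>R > 0\<close> p ln_le_cancel_iff[of "1/R" "wulff_gauge h x"] by (simp add: ln_div)
  show "ln (wulff_gauge h x) \<le> - ln r"
    using b(2) r p ln_le_cancel_iff[of "wulff_gauge h x" "1/r"] by (simp add: ln_div)
qed

text \<open>The common bound \<open>R\<close> is also a common Lipschitz constant, which is the
  equicontinuity for Arzela-Ascoli. The limit is recorded only as \<open>pos_even\<close>; its Wulff
  shape later provides a support function.\<close>

lemma support_functions_compact:
  fixes H :: "nat \<Rightarrow> 'a::euclidean_space \<Rightarrow> real"
  assumes H: "\<And>n. is_support (H n)"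
    and r: "r > 0" "\<And>n u. u \<in> sphere 0 1 \<Longrightarrow> r \<le> H n u" and R: "\<And>n u. u \<in> sphere 0 1 \<Longrightarrow> H n u \<le> R"
  obtains g s where "pos_even g" "strict_mono (s :: nat \<Rightarrow> nat)" "\<And>u. u \<in> sphere 0 1 \<Longrightarrow> r \<le> g u"
    "\<And>u. u \<in> sphere 0 1 \<Longrightarrow> g u \<le> R"
    "\<And>u. u \<in> sphere 0 1 \<Longrightarrow> (\<lambda>n. H (s n) u) \<longlonglongrightarrow> g u"
    "\<And>x. x \<in> sphere 0 1 \<Longrightarrow> (\<lambda>n. wulff_gauge (H (s n)) x) \<longlonglongrightarrow> wulff_gauge g x"
proof -
  have pe: "pos_even (H n)" for n using H by (rule is_support_pos_even)
  obtain u0 :: 'a where u0: "u0 \<in> sphere 0 1" using sphere_nonempty by blast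
  have "R > 0" using r(1) r(2)[OF u0, of 0] R[OF u0, of 0] by linarith
  obtain g s where g: "continuous_on (sphere 0 1) g" and s: "strict_mono (s :: nat \<Rightarrow> nat)"
    and unif: "\<And>e. 0 < e \<Longrightarrow> \<exists>N. \<forall>n x. n \<ge> N \<and> x \<in> sphere 0 1 \<longrightarrow> norm (H (s n) x - g x) < e"
  proof (rule Arzela_Ascoli[of "sphere (0::'a) 1" H R])
    show "norm (H n x) \<le> R" if "x \<in> sphere 0 1" for n x
      using pos_even_pos[OF pe that] R[OF that] by (simp add: less_imp_le)
    show "\<exists>d>0. \<forall>n y. y \<in> sphere 0 1 \<and> norm (x - y) < d \<longrightarrow> norm (H n x - H n y) < e"
      if x: "x \<in> sphere 0 1" and "e > 0" for x e
    proof (intro exI conjI allI impI)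
      show "0 < e / R" using \<open>e > 0\<close> \<open>R > 0\<close> by simp
      fix n y assume y: "y \<in> sphere 0 1 \<and> norm (x - y) < e / R"
      then have "R * norm (x - y) < e" using \<open>R > 0\<close> by (simp add: pos_less_divide_eq mult.commute)
      then show "norm (H n x - H n y) < e"
        using is_support_lipschitz[OF H R x, of y n] y by simp
    qed
  qed (rule compact_sphere, rule that)
  have lim: "(\<lambda>n. H (s n) u) \<longlonglongrightarrow> g u" if "u \<in> sphere 0 1" for u
    using unif that by (fastforce intro: LIMSEQ_I)
  have rg: "r \<le> g u" if u: "u \<in> sphere 0 1" for u
    by (rule LIMSEQ_le_const[OF lim[OF u]]) (use r(2)[OF u] in auto)
  have gR: "g u \<le> R" if u: "u \<in> sphere 0 1" for u
    by (rule LIMSEQ_le_const2[OF lim[OF u]]) (use R[OF u] in auto)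
  have ge: "g (- u) = g u" if u: "u \<in> sphere 0 1" for u
  proof (rule LIMSEQ_unique)
    show "(\<lambda>n. H (s n) (- u)) \<longlonglongrightarrow> g (- u)" using u by (intro lim) simp
    show "(\<lambda>n. H (s n) (- u)) \<longlonglongrightarrow> g u" using lim[OF u] by (simp add: pos_even_even[OF pe u])
  qed
  have pg: "pos_even g" unfolding pos_even_def using g rg r(1) ge by force
  have "(\<lambda>n. wulff_gauge (H (s n)) x) \<longlonglongrightarrow> wulff_gauge g x" if x: "x \<in> sphere 0 1" for x
  proof (rule LIMSEQ_I)
    fix e :: real assume e: "0 < e"
    \<comment> \<open>Chosen so that the gauge error \<open>d / r\<^sup>2\<close> is
      \<open>e / 2\<close>.\<close>
    define d where "d = e * r\<^sup>2 / 2"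
    have d: "d > 0" "d / r\<^sup>2 < e" using e r(1) by (auto simp: d_def)
    obtain N where N: "\<And>n x. n \<ge> N \<Longrightarrow> x \<in> sphere 0 1 \<Longrightarrow> norm (H (s n) x - g x) < d"
      using unif[OF d(1)] by blast
    have "norm (wulff_gauge (H (s n)) x - wulff_gauge g x) < e" if n: "n \<ge> N" for n
    proof -
      have c: "g u \<le> H (s n) u + d" "H (s n) u \<le> g u + d" if "u \<in> sphere 0 1" for u
        using N[OF n that] by auto
      have "wulff_gauge (H (s n)) x \<le> wulff_gauge g x + d / r\<^sup>2"
        using d(1) by (intro wulff_gauge_perturb_le[OF pe pg r(1) r(2) rg c(1) _ x]) auto
      moreover have "wulff_gauge g x \<le> wulff_gauge (H (s n)) x + d / r\<^sup>2"
        using d(1) by (intro wulff_gauge_perturb_le[OF pg pe r(1) rg r(2) c(2) _ x]) auto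
      ultimately show ?thesis using d(2) by (auto simp: abs_less_iff)
    qed
    then show "\<exists>no. \<forall>n\<ge>no. norm (wulff_gauge (H (s n)) x - wulff_gauge g x) < e" by blast
  qed
  then show thesis using that[OF pg s rg gR lim] by blast
qed

text \<open>Minimality is stated against all positive even competitors because the perturbations in
  the variation leave the class of support functions. The threshold 0 in the a priori bounds is the
  value of \<open>log_gauge\<close> at the unit ball.\<close>

lemma exists_minimiser:
  fixes lam \<mu> :: "'a::euclidean_space measure"
  assumes lam: "nonzero_finite_borel lam" and mu: "nonzero_finite_borel \<mu>"
    and G: "class_C G" "\<forall>u\<in>sphere 0 1. \<forall>t>0. psi_t G u t > 0"
    and r: "r > 0"
    and bounds: "\<forall>h. is_support h \<and> orlicz G \<mu> h \<le> orlicz G \<mu> (\<lambda>_. 1) \<and> log_gauge lam h \<le> 0 \<longrightarrow>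
      (\<forall>u\<in>sphere 0 1. r \<le> h u \<and> h u \<le> R)"
  obtains h where "is_support h" "orlicz G \<mu> h \<le> orlicz G \<mu> (\<lambda>_. 1)"
    "\<And>k. pos_even k \<Longrightarrow> orlicz G \<mu> k \<le> orlicz G \<mu> (\<lambda>_. 1) \<Longrightarrow> log_gauge lam h \<le> log_gauge lam k"
proof -
  let ?c = "orlicz G \<mu> (\<lambda>_. 1)"
  define F where "F = {h. is_support h \<and> orlicz G \<mu> h \<le> ?c \<and> log_gauge lam h \<le> 0}"
  define A where "A = log_gauge lam ` F"
  interpret lam: finite_measure lam using lam by (simp add: nonzero_finite_borel_def)
  interpret mu: finite_measure \<mu> using mu by (simp add: nonzero_finite_borel_def)
  have spl: "space lam = sphere 0 1" by (rule space_borel_on_sphere[OF lam])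
  have spm: "space \<mu> = sphere 0 1" by (rule space_borel_on_sphere[OF mu])
  have F: "is_support h" "orlicz G \<mu> h \<le> ?c" "log_gauge lam h \<le> 0" "pos_even h" if "h \<in> F" for h
    using that is_support_pos_even by (auto simp: F_def)
  have Fb: "r \<le> h u" "h u \<le> R" if "h \<in> F" "u \<in> sphere 0 1" for h u
    using bounds F(1-3)[OF that(1)] that(2) by auto
  have tight: "support_fun (wulff k) \<in> F"
    if "pos_even k" "orlicz G \<mu> k \<le> ?c" "log_gauge lam k \<le> 0" for k
    using support_fun_wulff_improves[OF mu G that(1)] that(2,3) by (auto simp: F_def)
  have "support_fun (wulff (\<lambda>_. 1)) \<in> F"
    by (intro tight pos_even_one) (simp_all add: log_gauge_one[OF lam])
  then have ne: "A \<noteq> {}" by (auto simp: A_def)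
  have bd: "bdd_below A"
  proof (rule bdd_belowI)
    fix a assume "a \<in> A"
    then obtain h where h: "h \<in> F" "a = log_gauge lam h" by (auto simp: A_def)
    have "(\<integral>x. - ln R \<partial>lam) \<le> log_gauge lam h"
      unfolding log_gauge_def using spl ln_gauge_bounds(1)[OF F(4)[OF h(1)] _ r Fb[OF h(1)]]
      by (intro integral_mono integrable_ln_gauge[OF lam F(4)[OF h(1)]]) auto
    then show "(\<integral>x. - ln R \<partial>lam) \<le> a" using h(2) by simp
  qed
  have "\<exists>h\<in>F. log_gauge lam h < Inf A + inverse (real (Suc n))" for n
    using cInf_lessD[OF ne, of "Inf A + inverse (real (Suc n))"] by (auto simp: A_def)
  then obtain H where H: "\<And>n. H n \<in> F" "\<And>n. log_gauge lam (H n) < Inf A + inverse (real (Suc n))"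
    by metis
  obtain g s where g: "pos_even g" "strict_mono (s :: nat \<Rightarrow> nat)"
    and gb: "\<And>u. u \<in> sphere 0 1 \<Longrightarrow> r \<le> g u" "\<And>u. u \<in> sphere 0 1 \<Longrightarrow> g u \<le> R"
    and lim: "\<And>u. u \<in> sphere 0 1 \<Longrightarrow> (\<lambda>n. H (s n) u) \<longlonglongrightarrow> g u"
    and glim: "\<And>x. x \<in> sphere 0 1 \<Longrightarrow> (\<lambda>n. wulff_gauge (H (s n)) x) \<longlonglongrightarrow> wulff_gauge g x"
    using support_functions_compact[of H r R, OF F(1)[OF H(1)] r Fb[OF H(1)]] by blast
  have "(\<lambda>n. log_gauge lam (H (s n))) \<longlonglongrightarrow> log_gauge lam g"
    unfolding log_gauge_def
  proof (rule integral_dominated_convergence[where w="\<lambda>_. \<bar>ln R\<bar> + \<bar>ln r\<bar>"])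
    show "AE x in lam. (\<lambda>n. ln (wulff_gauge (H (s n)) x)) \<longlonglongrightarrow> ln (wulff_gauge g x)"
    proof (rule AE_I2)
      fix x assume "x \<in> space lam"
      then have x: "x \<in> sphere 0 1" "x \<noteq> 0" using spl by auto
      show "(\<lambda>n. ln (wulff_gauge (H (s n)) x)) \<longlonglongrightarrow> ln (wulff_gauge g x)"
        using wulff_gauge_pos[OF g(1) x(2)] by (intro tendsto_ln glim x(1)) auto
    qed
    show "AE x in lam. norm (ln (wulff_gauge (H (s n)) x)) \<le> \<bar>ln R\<bar> + \<bar>ln r\<bar>" for n
    proof (rule AE_I2)
      fix x assume "x \<in> space lam"
      then have x: "x \<in> sphere 0 1" using spl by auto
      show "norm (ln (wulff_gauge (H (s n)) x)) \<le> \<bar>ln R\<bar> + \<bar>ln r\<bar>"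
        using ln_gauge_bounds[OF F(4)[OF H(1)] x r Fb[OF H(1)], of "s n"] by (auto simp: abs_le_iff)
    qed
  qed (use integrable_ln_gauge[OF lam g(1)] integrable_ln_gauge[OF lam F(4)[OF H(1)]] in auto)
  moreover have "(\<lambda>n. Inf A + inverse (real (Suc (s n)))) \<longlonglongrightarrow> Inf A + 0"
    using LIMSEQ_subseq_LIMSEQ[OF LIMSEQ_inverse_real_of_nat g(2)]
    by (intro tendsto_intros) (simp add: o_def)
  ultimately have le_Inf: "log_gauge lam g \<le> Inf A"
    using H(2) by (intro LIMSEQ_le[of _ _ _ "Inf A"]) (auto intro: less_imp_le)
  obtain B where B: "\<And>u t. u \<in> sphere 0 1 \<Longrightarrow> r \<le> t \<Longrightarrow> t \<le> R \<Longrightarrow> \<bar>G u t\<bar> \<le> B"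
  proof -
    have "continuous_on (sphere 0 1 \<times> {r..R}) (\<lambda>p. G (fst p) (snd p))"
      using r by (intro class_C_continuous[OF G(1)] continuous_intros) auto
    then have "bounded ((\<lambda>p. G (fst p) (snd p)) ` (sphere 0 1 \<times> {r..R}))"
      by (intro compact_imp_bounded compact_continuous_image compact_Times compact_sphere compact_Icc)
    then show thesis using that unfolding bounded_iff by force
  qed
  have "(\<lambda>n. orlicz G \<mu> (H (s n))) \<longlonglongrightarrow> orlicz G \<mu> g"
    unfolding orlicz_def
  proof (rule integral_dominated_convergence[where w="\<lambda>_. B"])
    show "AE u in \<mu>. (\<lambda>n. G u (H (s n) u)) \<longlonglongrightarrow> G u (g u)"
    proof (rule AE_I2)
      fix u assume "u \<in> space \<mu>"
      then have u: "u \<in> sphere 0 1" using spm by auto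
      have "isCont (G u) (g u)"
        by (rule DERIV_isCont[OF class_C_has_derivative[OF G(1) u pos_even_pos[OF g(1) u]]])
      then show "(\<lambda>n. G u (H (s n) u)) \<longlonglongrightarrow> G u (g u)" by (rule isCont_tendsto_compose[OF _ lim[OF u]])
    qed
    show "AE u in \<mu>. norm (G u (H (s n) u)) \<le> B" for n
      using spm Fb[OF H(1)] by (intro AE_I2) (auto intro!: B)
  qed (use integrable_orlicz[OF mu G(1) g(1)] integrable_orlicz[OF mu G(1) F(4)[OF H(1)]] in auto)
  then have og: "orlicz G \<mu> g \<le> ?c"
    using F(2)[OF H(1)] by (intro LIMSEQ_le_const2[of _ "orlicz G \<mu> g"]) auto
  show thesis
  proof (rule that)
    show "is_support (support_fun (wulff g))" by (rule support_fun_wulff_improves(1)[OF mu G g(1)])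
    show "orlicz G \<mu> (support_fun (wulff g)) \<le> ?c" using support_fun_wulff_improves(2)[OF mu G g(1)] og by simp
    fix k :: "'a \<Rightarrow> real" assume k: "pos_even k" "orlicz G \<mu> k \<le> ?c"
    \<comment> \<open>Competitors with a positive value are beaten already by the members of
      \<open>A\<close>, which are all nonpositive; the others are tightened to support
      functions.\<close>
    have "Inf A \<le> log_gauge lam k"
    proof (cases "log_gauge lam k \<le> 0")
      case True
      have "log_gauge lam k \<in> A"
        unfolding A_def support_fun_wulff_improves(3)[OF mu G k(1), symmetric] by (rule imageI[OF tight[OF k True]])
      then show ?thesis using bd by (rule cInf_lower)
    next
      case False
      obtain a where "a \<in> A" using ne by blast
      then have "Inf A \<le> a" "a \<le> 0"
        using cInf_lower[OF \<open>a \<in> A\<close> bd] F(3) by (auto simp: A_def)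
      then show ?thesis using False by linarith
    qed
    then show "log_gauge lam (support_fun (wulff g)) \<le> log_gauge lam k"
      using le_Inf support_fun_wulff_improves(3)[OF mu G g(1)] by simp
  qed
qed

lemma exists_solution:
  fixes lam \<mu> :: "'a::euclidean_space measure"
  assumes lam: "class_M lam" "even_measure lam"
    and mu: "nonzero_finite_borel \<mu>" "even_measure \<mu>"
    and G: "class_C G" "\<forall>u\<in>sphere 0 1. \<forall>t>0. psi_t G u t > 0"
      "\<forall>\<xi>\<in>sphere 0 1. \<forall>t>0. G \<xi> t = G (- \<xi>) t"
    and r: "r > 0"
    and bounds: "\<forall>h. is_support h \<and> orlicz G \<mu> h \<le> orlicz G \<mu> (\<lambda>_. 1) \<and> log_gauge lam h \<le> 0 \<longrightarrow>
      (\<forall>u\<in>sphere 0 1. r \<le> h u \<and> h u \<le> R)"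
  obtains h where "is_support h" "solves_eq G lam \<mu> (wulff h)"
proof -
  have nf: "nonzero_finite_borel lam" using lam(1) by (simp add: class_M_def)
  obtain h where h: "is_support h" "orlicz G \<mu> h \<le> orlicz G \<mu> (\<lambda>_. 1)"
    "\<And>k. pos_even k \<Longrightarrow> orlicz G \<mu> k \<le> orlicz G \<mu> (\<lambda>_. 1) \<Longrightarrow> log_gauge lam h \<le> log_gauge lam k"
    using exists_minimiser[OF nf mu(1) G(1,2) r bounds] by blast
  have pe: "pos_even h" using h(1) by (rule is_support_pos_even)
  \<comment> \<open>The Euler-Lagrange argument takes the constraint level of \<open>h\<close>
    itself; its competitors also satisfy the original constraint.\<close>
  have min: "log_gauge lam h \<le> log_gauge lam k" if "pos_even k" "orlicz G \<mu> k \<le> orlicz G \<mu> h" for k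
    using h(2) h(3)[OF that(1)] that(2) by simp
  obtain c where c: "c > 0" and el: "\<And>f. continuous_on (sphere 0 1) f \<Longrightarrow>
      (\<integral>x. f (gauss h x) \<partial>lam) = c * (\<integral>u. psi_t G u (h u) * h u * f u \<partial>\<mu>)"
    using euler_lagrange[OF lam mu G pe min] by blast
  have J: "J_tilde G lam (wulff h) \<omega> = c * measure \<mu> \<omega>" if "\<omega> \<in> sets sphere_borel" for \<omega>
    by (rule J_tilde_eq_of_euler_lagrange[OF lam(1) mu(1) G(1,2) h(1) c el that])
  have sm: "sets \<mu> = sets sphere_borel" using mu by (simp add: nonzero_finite_borel_def borel_on_sphere_def)
  have "sphere 0 1 \<in> sets (sphere_borel :: 'a measure)"
    using sets.top[of \<mu>] sm space_borel_on_sphere[OF mu(1)] by simp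
  then have "solves_eq G lam \<mu> (wulff h)"
    using c J sm by (auto simp: solves_eq_def)
  then show thesis using that h(1) by blast
qed

section \<open>Coercivity\<close>

text \<open>A relative of Fatou's lemma: the truncations \<open>min (f k x) (T x)\<close> are
  dominated by \<open>\<bar>b\<bar> + \<bar>T x\<bar>\<close> and eventually equal
  \<open>T x\<close>. It turns pointwise growth into a contradiction with bounded integrals.\<close>

lemma integral_le_of_eventually_le:
  fixes f :: "nat \<Rightarrow> 'a \<Rightarrow> real"
  assumes M: "finite_measure M" and f: "\<And>k. integrable M (f k)" and T: "integrable M T"
    and b: "\<And>k x. x \<in> space M \<Longrightarrow> - b \<le> f k x"
    and ev: "AE x in M. \<forall>\<^sub>F k in sequentially. T x \<le> f k x"
    and c: "\<And>k. (\<integral>x. f k x \<partial>M) \<le> c"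
  shows "(\<integral>x. T x \<partial>M) \<le> c"
proof -
  interpret finite_measure M by fact
  have "(\<lambda>k. \<integral>x. min (f k x) (T x) \<partial>M) \<longlonglongrightarrow> (\<integral>x. T x \<partial>M)"
  proof (rule integral_dominated_convergence[where w="\<lambda>x. \<bar>b\<bar> + \<bar>T x\<bar>"])
    show "AE x in M. (\<lambda>k. min (f k x) (T x)) \<longlonglongrightarrow> T x"
      using ev
    proof eventually_elim
      case (elim x)
      then have "\<forall>\<^sub>F k in sequentially. min (f k x) (T x) = T x"
        by eventually_elim simp
      then show ?case by (rule tendsto_eventually)
    qed
    show "AE x in M. norm (min (f k x) (T x)) \<le> \<bar>b\<bar> + \<bar>T x\<bar>" for k
    proof (rule AE_I2)
      fix x assume "x \<in> space M"
      from b[OF this, of k] show "norm (min (f k x) (T x)) \<le> \<bar>b\<bar> + \<bar>T x\<bar>"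
        by (auto simp: min_def)
    qed
  qed (use f T in auto)
  moreover have "(\<integral>x. min (f k x) (T x) \<partial>M) \<le> c" for k
  proof -
    have "(\<integral>x. min (f k x) (T x) \<partial>M) \<le> (\<integral>x. f k x \<partial>M)"
      using f T by (intro integral_mono integrable_min) auto
    then show ?thesis using c[of k] by simp
  qed
  ultimately show ?thesis by (intro LIMSEQ_le_const2) auto
qed

text \<open>Let \<open>y\<close> be a point of the body farthest from the origin,
  \<open>\<rho>\<close> its norm and \<open>v\<close> its direction. The body contains
  \<open>y\<close> and \<open>- y\<close> and lies in the ball of radius \<open>\<rho>\<close>;
  these inclusions give the two bounds.\<close>

lemma support_farthest:
  assumes h: "is_support (h :: 'a::euclidean_space \<Rightarrow> real)"
  obtains v \<rho> where "v \<in> sphere 0 1" "\<rho> > 0"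
    "\<And>u. u \<in> sphere 0 1 \<Longrightarrow> h u \<le> \<rho>" "\<And>u. u \<in> sphere 0 1 \<Longrightarrow> \<rho> * \<bar>u \<bullet> v\<bar> \<le> h u"
proof -
  have pe: "pos_even h" using h by (rule is_support_pos_even)
  have K: "Kn_e (wulff h)" by (rule wulff_Kn_e[OF pe])
  have "compact (wulff h)" "wulff h \<noteq> {}" using K Kn_e_zero[OF K] by (auto simp: Kn_e_def Kn_o_def)
  then obtain y where y: "y \<in> wulff h" "\<And>z. z \<in> wulff h \<Longrightarrow> norm z \<le> norm y"
    using continuous_attains_sup[of "wulff h" norm] continuous_on_norm_id by blast
  have le: "h u \<le> norm y" if u: "u \<in> sphere 0 1" for u
  proof -
    have "support_fun (wulff h) u \<le> norm y"
    proof (rule support_fun_least[OF K])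
      fix z assume "z \<in> wulff h"
      then show "u \<bullet> z \<le> norm y" using norm_cauchy_schwarz[of u z] y(2)[of z] u by simp
    qed
    then show ?thesis using h u by (simp add: is_support_def)
  qed
  obtain u0 :: 'a where u0: "u0 \<in> sphere 0 1" using sphere_nonempty by blast
  have p: "norm y > 0" using le[OF u0] pos_even_pos[OF pe u0] by linarith
  have ge: "\<bar>u \<bullet> y\<bar> \<le> h u" if u: "u \<in> sphere 0 1" for u
  proof -
    have "- y \<in> wulff h" using y(1) K by (auto simp: Kn_e_def)
    then have "u \<bullet> y \<le> h u" "u \<bullet> (- y) \<le> h u" using y(1) u unfolding wulff_def by blast+
    then show ?thesis by (simp add: abs_le_iff)
  qed
  show thesis
  proof (rule that[of "y /\<^sub>R norm y" "norm y"])
    show "y /\<^sub>R norm y \<in> sphere 0 1" using p by simp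
    show "norm y * \<bar>u \<bullet> (y /\<^sub>R norm y)\<bar> \<le> h u" if "u \<in> sphere 0 1" for u
      using ge[OF that] p by (simp add: abs_mult flip: mult.assoc)
  qed (use p le in auto)
qed

lemma sphere_subsequence:
  fixes v :: "nat \<Rightarrow> 'a::euclidean_space"
  assumes "\<And>n. v n \<in> sphere 0 1"
  obtains l s where "l \<in> sphere 0 1" "strict_mono (s :: nat \<Rightarrow> nat)" "(\<lambda>n. v (s n)) \<longlonglongrightarrow> l"
proof -
  have "seq_compact (sphere (0::'a) 1)" by (intro compact_imp_seq_compact compact_sphere)
  then show thesis using assms that unfolding seq_compact_def o_def by blast
qed

text \<open>The bodies contain antipodal points at distances tending to infinity. Along a
  subsequence their directions \<open>w\<close> converge to \<open>v\<close>, and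
  \<open>\<rho> * \<bar>u \<bullet> w\<bar>\<close> diverges unless \<open>u\<close> is orthogonal
  to \<open>v\<close>. The predicate \<open>P\<close> carries along whatever else constrains the
  competitors.\<close>

lemma unbounded_supports:
  fixes P :: "('a::euclidean_space \<Rightarrow> real) \<Rightarrow> bool"
  assumes "\<And>R. \<exists>h. P h \<and> is_support h \<and> (\<exists>u\<in>sphere 0 1. h u > R)"
  obtains H v where "v \<in> sphere 0 1" "\<And>n. P (H n)" "\<And>n. is_support (H n)"
    "\<And>u. u \<in> sphere 0 1 \<Longrightarrow> v \<bullet> u \<noteq> 0 \<Longrightarrow> filterlim (\<lambda>n::nat. H n u) at_top sequentially"
proof -
  have "\<exists>h w \<rho>. P h \<and> is_support h \<and> w \<in> sphere 0 1 \<and> \<rho> > real n \<and> (\<forall>u\<in>sphere 0 1. \<rho> * \<bar>u \<bullet> w\<bar> \<le> h u)" for n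
  proof -
    obtain h u where h: "P h" "is_support h" "u \<in> sphere 0 1" "h u > real n" using assms by blast
    obtain w \<rho> where "w \<in> sphere 0 1" "\<And>u. u \<in> sphere 0 1 \<Longrightarrow> h u \<le> \<rho>"
      "\<And>u. u \<in> sphere 0 1 \<Longrightarrow> \<rho> * \<bar>u \<bullet> w\<bar> \<le> h u"
      using support_farthest[OF h(2)] by metis
    then show ?thesis using h by (meson less_le_trans)
  qed
  then obtain H w \<rho> where H: "\<And>n. P (H n)" "\<And>n. is_support (H n)" "\<And>n. w n \<in> sphere 0 1"
    "\<And>n. \<rho> n > real n" "\<And>n u. u \<in> sphere 0 1 \<Longrightarrow> \<rho> n * \<bar>u \<bullet> w n\<bar> \<le> H n u"
    by metis
  obtain v s where v: "v \<in> sphere 0 1" "strict_mono (s :: nat \<Rightarrow> nat)" "(\<lambda>n. w (s n)) \<longlonglongrightarrow> v"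
    using sphere_subsequence[of w] H(3) by blast
  show thesis
  proof (rule that[of v "\<lambda>n. H (s n)"])
    fix u :: 'a assume u: "u \<in> sphere 0 1" "v \<bullet> u \<noteq> 0"
    have "filterlim (\<lambda>n. \<rho> (s n)) at_top sequentially"
    proof (rule filterlim_at_top_mono[OF filterlim_real_sequentially])
      show "\<forall>\<^sub>F n in sequentially. real n \<le> \<rho> (s n)"
      proof (rule always_eventually, rule allI)
        fix n
        have "real n \<le> real (s n)" using seq_suble[OF v(2), of n] by simp
        then show "real n \<le> \<rho> (s n)" using H(4)[of "s n"] by linarith
      qed
    qed
    moreover have "(\<lambda>n. \<bar>u \<bullet> w (s n)\<bar>) \<longlonglongrightarrow> \<bar>u \<bullet> v\<bar>" by (intro tendsto_intros v(3))
    ultimately have "filterlim (\<lambda>n. \<rho> (s n) * \<bar>u \<bullet> w (s n)\<bar>) at_top sequentially"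
      using u(2) by (intro filterlim_at_top_mult_tendsto_pos[where c="\<bar>u \<bullet> v\<bar>"]) (auto simp: inner_commute)
    then show "filterlim (\<lambda>n. H (s n) u) at_top sequentially"
      by (rule filterlim_at_top_mono) (use H(5)[OF u(1)] in auto)
  qed (use v H in auto)
qed

lemma sets_hyperplane_complement:
  assumes "nonzero_finite_borel M"
  shows "sphere 0 1 - {x. v \<bullet> x = 0} \<in> sets M" "sphere 0 1 \<inter> {x. v \<bullet> x = 0} \<in> sets M"
proof -
  have c: "closed {x. v \<bullet> x = 0}" by (rule closed_hyperplane)
  have "sphere 0 1 - {x. v \<bullet> x = 0} = sphere 0 1 \<inter> (- {x. v \<bullet> x = 0})" by auto
  then show "sphere 0 1 - {x. v \<bullet> x = 0} \<in> sets M" "sphere 0 1 \<inter> {x. v \<bullet> x = 0} \<in> sets M"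
    using borel_closed[OF c] unfolding sets_nonzero_finite_borel[OF assms] sets_restrict_space
    by (auto intro!: imageI)
qed

lemma not_concentrated_measure:
  assumes "nonzero_finite_borel M" "not_concentrated M" "v \<in> sphere 0 1"
  shows "measure M (sphere 0 1 - {x. v \<bullet> x = 0}) > 0"
proof -
  interpret finite_measure M using assms(1) by (simp add: nonzero_finite_borel_def)
  show ?thesis using assms(2,3)
    by (simp add: not_concentrated_def emeasure_eq_measure zero_less_measure_iff)
qed

text \<open>Unbounded support functions would make the integrands diverge off one great subsphere,
  whose complement has positive \<open>\<mu>\<close>-measure, while positivity of \<open>G\<close>
  controls the remaining directions.\<close>

lemma upper_bound_growing:
  fixes \<mu> :: "'a::euclidean_space measure"
  assumes mu: "nonzero_finite_borel \<mu>" "not_concentrated \<mu>" and G: "class_GI G"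
  obtains R where "\<And>h u. is_support h \<Longrightarrow> orlicz G \<mu> h \<le> c \<Longrightarrow> u \<in> sphere 0 1 \<Longrightarrow> h u \<le> R"
proof (rule ccontr)
  assume "\<not> thesis"
  then have "\<exists>h. orlicz G \<mu> h \<le> c \<and> is_support h \<and> (\<exists>u\<in>sphere 0 1. h u > R)" for R
    using that by (meson not_le)
  then obtain H v where v: "v \<in> sphere 0 1" and H: "\<And>n. orlicz G \<mu> (H n) \<le> c" "\<And>n. is_support (H n)"
    and lim: "\<And>u. u \<in> sphere 0 1 \<Longrightarrow> v \<bullet> u \<noteq> 0 \<Longrightarrow> filterlim (\<lambda>n::nat. H n u) at_top sequentially"
    using unbounded_supports[of "\<lambda>h. orlicz G \<mu> h \<le> c"] by metis
  interpret finite_measure \<mu> using mu by (simp add: nonzero_finite_borel_def)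
  have sp: "space \<mu> = sphere 0 1" by (rule space_borel_on_sphere[OF mu(1)])
  have C: "class_C G" using G by (simp add: class_GI_def)
  define A where "A = sphere 0 1 - {x. v \<bullet> x = 0}"
  have A: "A \<in> sets \<mu>" "measure \<mu> A > 0"
    unfolding A_def by (rule sets_hyperplane_complement[OF mu(1)], rule not_concentrated_measure[OF mu v])
  \<comment> \<open>With this height \<open>T * indicator A u\<close> integrates to
    \<open>\<bar>c\<bar> + 1\<close>, which exceeds \<open>c\<close>.\<close>
  define T where "T = (\<bar>c\<bar> + 1) / measure \<mu> A"
  have Gpos: "G u (H n u) > 0" if "u \<in> sphere 0 1" for n u
    using G pos_even_pos[OF is_support_pos_even[OF H(2)] that] that by (simp add: class_GI_def)
  have "(\<integral>u. T * indicator A u \<partial>\<mu>) \<le> c"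
  proof (rule integral_le_of_eventually_le[where b=0])
    show "finite_measure \<mu>" by unfold_locales
    show "integrable \<mu> (\<lambda>u. G u (H k u))" for k
      by (rule integrable_orlicz[OF mu(1) C is_support_pos_even[OF H(2)]])
    show "integrable \<mu> (\<lambda>u. T * indicator A u)" 
      using A by (intro integrable_mult_right integrable_real_indicator) (auto simp: emeasure_eq_measure)
    show "- 0 \<le> G u (H k u)" if "u \<in> space \<mu>" for k u
      using Gpos[of u k] that sp by simp
    show "(\<integral>u. G u (H k u) \<partial>\<mu>) \<le> c" for k using H(1)[of k] by (simp add: orlicz_def)
    show "AE u in \<mu>. \<forall>\<^sub>F k in sequentially. T * indicator A u \<le> G u (H k u)"
    proof (rule AE_I2)
      fix u assume "u \<in> space \<mu>"
      then have u: "u \<in> sphere 0 1" using sp by simp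
      show "\<forall>\<^sub>F k in sequentially. T * indicator A u \<le> G u (H k u)"
      proof (cases "v \<bullet> u = 0")
        case True
        then show ?thesis using Gpos[OF u] by (intro always_eventually) (simp add: A_def less_imp_le)
      next
        case False
        have "filterlim (G u) at_top at_top" using G u by (simp add: class_GI_def)
        then have "filterlim (\<lambda>k. G u (H k u)) at_top sequentially"
          by (rule filterlim_compose) (rule lim[OF u False])
        then have "\<forall>\<^sub>F k in sequentially. T \<le> G u (H k u)" by (simp add: filterlim_at_top)
        then show ?thesis using u False by (simp add: A_def)
      qed
    qed
  qed
  moreover have "(\<integral>u. T * indicator A u \<partial>\<mu>) = \<bar>c\<bar> + 1" using A by (simp add: T_def)
  ultimately show False by linarith
qed

lemma wulff_gauge_lower_abs:
  assumes "pos_even h" "v \<in> sphere 0 1"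
  shows "\<bar>v \<bullet> x\<bar> \<le> wulff_gauge h x * h v"
proof -
  have "- v \<in> sphere 0 1" using assms(2) by simp
  then show ?thesis
    using wulff_gauge_upper[OF assms, of x] wulff_gauge_upper[OF assms(1), of "- v" x] pos_even_even[OF assms]
    by (simp add: abs_le_iff)
qed

text \<open>Widths tending to 0 in directions converging to \<open>v\<close> make the gauge blow up
  off the hyperplane orthogonal to \<open>v\<close>, where \<open>lam\<close> has mass, while the
  outer radius \<open>R\<close> bounds its logarithm below; \<open>log_gauge\<close> would have to
  become positive.\<close>

lemma lower_bound_not_concentrated:
  fixes lam :: "'a::euclidean_space measure"
  assumes lam: "nonzero_finite_borel lam" "not_concentrated lam"
  obtains r where "r > 0" "\<And>h u. is_support h \<Longrightarrow> log_gauge lam h \<le> 0 \<Longrightarrow> \<forall>u\<in>sphere 0 1. h u \<le> R \<Longrightarrow>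
    u \<in> sphere 0 1 \<Longrightarrow> r \<le> h u"
proof (rule ccontr)
  assume "\<not> thesis"
  then have "\<exists>h. is_support h \<and> log_gauge lam h \<le> 0 \<and> (\<forall>u\<in>sphere 0 1. h u \<le> R) \<and> (\<exists>u\<in>sphere 0 1. h u < inverse (real (Suc n)))" for n
    using that[of "inverse (real (Suc n))"] by (metis inverse_positive_iff_positive not_le of_nat_0_less_iff zero_less_Suc)
  then obtain H w where H: "\<And>n. is_support (H n)" "\<And>n. log_gauge lam (H n) \<le> 0" "\<And>n u. u \<in> sphere 0 1 \<Longrightarrow> H n u \<le> R"
    "\<And>n. w n \<in> sphere 0 1" "\<And>n. H n (w n) < inverse (real (Suc n))"
    by metis
  have pe: "pos_even (H n)" for n using H(1) by (rule is_support_pos_even)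
  obtain v s where v: "v \<in> sphere 0 1" "strict_mono (s :: nat \<Rightarrow> nat)" "(\<lambda>n. w (s n)) \<longlonglongrightarrow> v"
    using sphere_subsequence[of w] H(4) by blast
  interpret finite_measure lam using lam by (simp add: nonzero_finite_borel_def)
  have sp: "space lam = sphere 0 1" by (rule space_borel_on_sphere[OF lam(1)])
  define A where "A = sphere 0 1 - {x. v \<bullet> x = 0}"
  have A: "A \<in> sets lam" "measure lam A > 0"
    unfolding A_def by (rule sets_hyperplane_complement[OF lam(1)], rule not_concentrated_measure[OF lam v(1)])
  \<comment> \<open>Compensates the lower bound \<open>- \<bar>ln R\<bar>\<close> over the whole
    sphere, so that the comparison function integrates to 1.\<close>
  define T where "T = (\<bar>ln R\<bar> * measure lam (space lam) + 1) / measure lam A"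
  have lb: "- \<bar>ln R\<bar> \<le> ln (wulff_gauge (H n) x)" if x: "x \<in> sphere 0 1" for n x
  proof -
    obtain m M where m: "0 < m" "\<And>u. u \<in> sphere 0 1 \<Longrightarrow> m \<le> H n u"
      using pos_even_bounds[OF pe] by metis
    show ?thesis using ln_gauge_bounds(1)[OF pe x m H(3)] by simp
  qed
  have "(\<integral>x. - \<bar>ln R\<bar> + T * indicator A x \<partial>lam) \<le> 0"
  proof (rule integral_le_of_eventually_le[where b="\<bar>ln R\<bar>"])
    show "finite_measure lam" by unfold_locales
    show "integrable lam (\<lambda>x. ln (wulff_gauge (H (s k)) x))" for k
      by (rule integrable_ln_gauge[OF lam(1) pe])
    show "integrable lam (\<lambda>x. - \<bar>ln R\<bar> + T * indicator A x)"
      using A by (intro Bochner_Integration.integrable_add integrable_mult_right integrable_real_indicator) (auto simp: emeasure_eq_measure)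
    show "- \<bar>ln R\<bar> \<le> ln (wulff_gauge (H (s k)) x)" if "x \<in> space lam" for k x
      using lb that sp by simp
    show "(\<integral>x. ln (wulff_gauge (H (s k)) x) \<partial>lam) \<le> 0" for k using H(2)[of "s k"] by (simp add: log_gauge_def)
    show "AE x in lam. \<forall>\<^sub>F k in sequentially. - \<bar>ln R\<bar> + T * indicator A x \<le> ln (wulff_gauge (H (s k)) x)"
    proof (rule AE_I2)
      fix x assume "x \<in> space lam"
      then have x: "x \<in> sphere 0 1" using sp by simp
      show "\<forall>\<^sub>F k in sequentially. - \<bar>ln R\<bar> + T * indicator A x \<le> ln (wulff_gauge (H (s k)) x)"
      proof (cases "v \<bullet> x = 0")
        case True
        then show ?thesis using lb[OF x] by (intro always_eventually) (simp add: A_def)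
      next
        case False
        have "filterlim (\<lambda>k. real k * \<bar>w (s k) \<bullet> x\<bar>) at_top sequentially"
          using False
          by (intro filterlim_at_top_mult_tendsto_pos[where c="\<bar>v \<bullet> x\<bar>"] filterlim_real_sequentially tendsto_intros v(3)) auto
        then have "filterlim (\<lambda>k. wulff_gauge (H (s k)) x) at_top sequentially"
        proof (rule filterlim_at_top_mono, intro always_eventually allI)
          fix k
          have "\<bar>w (s k) \<bullet> x\<bar> \<le> wulff_gauge (H (s k)) x * H (s k) (w (s k))"
            by (rule wulff_gauge_lower_abs[OF pe H(4)])
          also have "\<dots> \<le> wulff_gauge (H (s k)) x * inverse (real (Suc k))"
          proof (intro mult_left_mono wulff_gauge_nonneg(2)[OF pe])
            \<comment> \<open>A subsequence only advances the index, so the bound in terms of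
              \<open>k\<close> survives.\<close>
            have "inverse (real (Suc (s k))) \<le> inverse (real (Suc k))"
              using seq_suble[OF v(2), of k] by (intro le_imp_inverse_le) auto
            then show "H (s k) (w (s k)) \<le> inverse (real (Suc k))" using H(5)[of "s k"] by linarith
          qed
          finally have "real (Suc k) * \<bar>w (s k) \<bullet> x\<bar> \<le> wulff_gauge (H (s k)) x"
            by (simp add: field_simps)
          moreover have "real k * \<bar>w (s k) \<bullet> x\<bar> \<le> real (Suc k) * \<bar>w (s k) \<bullet> x\<bar>"
            by (intro mult_right_mono) auto
          ultimately show "real k * \<bar>w (s k) \<bullet> x\<bar> \<le> wulff_gauge (H (s k)) x" by linarith
        qed
        then have "filterlim (\<lambda>k. ln (wulff_gauge (H (s k)) x)) at_top sequentially"
          by (rule filterlim_compose[OF ln_at_top])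
        then have "\<forall>\<^sub>F k in sequentially. - \<bar>ln R\<bar> + T * indicator A x \<le> ln (wulff_gauge (H (s k)) x)"
          unfolding filterlim_at_top by blast
        then show ?thesis .
      qed
    qed
  qed
  moreover have "(\<integral>x. - \<bar>ln R\<bar> + T * indicator A x \<partial>lam) = 1"
  proof -
    have "(\<integral>x. - \<bar>ln R\<bar> + T * indicator A x \<partial>lam) = (\<integral>x. - \<bar>ln R\<bar> \<partial>lam) + (\<integral>x. T * indicator A x \<partial>lam)"
      using A by (intro Bochner_Integration.integral_add integrable_mult_right integrable_real_indicator) (auto simp: emeasure_eq_measure)
    also have "\<dots> = 1" using A by (simp add: T_def)
    finally show ?thesis .
  qed
  ultimately show False by simp
qed

text \<open>Integrating \<open>ln \<bar>v \<bullet> \<xi>\<bar> - ln (h v) \<le> ln (wulff_gauge h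
  \<xi>)\<close> and using \<open>log_gauge lam h \<le> 0\<close> bounds \<open>- ln (h v)\<close>
  by the logarithmic integral, uniformly in \<open>v\<close>.\<close>

lemma lower_bound_log_integral:
  fixes lam :: "'a::euclidean_space measure"
  assumes lam: "nonzero_finite_borel lam" and C: "(INF v\<in>sphere 0 1. log_integral lam v) > ereal C"
  obtains r where "r > 0" "\<And>h u. pos_even h \<Longrightarrow> log_gauge lam h \<le> 0 \<Longrightarrow> u \<in> sphere 0 1 \<Longrightarrow> r \<le> h u"
proof -
  interpret finite_measure lam using lam by (simp add: nonzero_finite_borel_def)
  have sp: "space lam = sphere 0 1" by (rule space_borel_on_sphere[OF lam])
  have "emeasure lam (space lam) \<noteq> 0" using lam sp by (simp add: nonzero_finite_borel_def)
  then have m: "0 < measure lam (space lam)" by (simp add: emeasure_eq_measure zero_less_measure_iff)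
  \<comment> \<open>Made nonnegative for the passage to \<open>ennreal\<close>.\<close>
  define D where "D = max 0 (- C)"
  define r where "r = exp (- (D / measure lam (space lam)))"
  have "r \<le> h v" if h: "pos_even h" "log_gauge lam h \<le> 0" and v: "v \<in> sphere 0 1" for h v
  proof -
    let ?\<phi> = "\<lambda>\<xi>. if v \<bullet> \<xi> = 0 then \<infinity> else ennreal (- ln \<bar>v \<bullet> \<xi>\<bar>)"
    have meas: "(\<lambda>\<xi>. - ln \<bar>v \<bullet> \<xi>\<bar>) \<in> borel_measurable lam"
      by (intro measurable_borel_sphere[OF lam]) measurable
    have mphi: "?\<phi> \<in> borel_measurable lam"
      by (intro measurable_borel_sphere[OF lam]) measurable
    have "ereal C < log_integral lam v"
      using C v by (meson INF_lower less_le_trans)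
    then have "enn2ereal (\<integral>\<^sup>+ \<xi>. ?\<phi> \<xi> \<partial>lam) < ereal (- C)"
      unfolding log_integral_def by (subst (asm) ereal_less_uminus_reorder) simp
    also have "\<dots> \<le> ereal D" by (simp add: D_def)
    also have "\<dots> = enn2ereal (ennreal D)" by (simp add: D_def enn2ereal_ennreal)
    finally have le: "(\<integral>\<^sup>+ \<xi>. ?\<phi> \<xi> \<partial>lam) < ennreal D" by (simp add: less_ennreal.rep_eq)
    \<comment> \<open>The integrand of \<open>log_integral\<close> is infinite on the hyperplane
      orthogonal to \<open>v\<close>, so a finite integral makes it null. This also disposes of the
      default value \<open>ln 0 = 0\<close>.\<close>
    have ae: "AE \<xi> in lam. v \<bullet> \<xi> \<noteq> 0"
    proof -
      have "(\<integral>\<^sup>+ \<xi>. ?\<phi> \<xi> \<partial>lam) \<noteq> \<infinity>" using le by auto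
      then have "AE \<xi> in lam. ?\<phi> \<xi> \<noteq> \<infinity>" using mphi by (intro nn_integral_noteq_infinite)
      then show ?thesis by eventually_elim (auto split: if_splits)
    qed
    have nn: "0 \<le> - ln \<bar>v \<bullet> \<xi>\<bar>" if "\<xi> \<in> sphere 0 1" for \<xi>
    proof -
      have "\<bar>v \<bullet> \<xi>\<bar> \<le> 1" using Cauchy_Schwarz_ineq2[of v \<xi>] v that by simp
      then show ?thesis by (cases "v \<bullet> \<xi> = 0") auto
    qed
    have "(\<integral>\<^sup>+ \<xi>. ennreal (- ln \<bar>v \<bullet> \<xi>\<bar>) \<partial>lam) = (\<integral>\<^sup>+ \<xi>. ?\<phi> \<xi> \<partial>lam)"
    proof (rule nn_integral_cong_AE)
      show "AE \<xi> in lam. ennreal (- ln \<bar>v \<bullet> \<xi>\<bar>) = ?\<phi> \<xi>"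
        using ae by eventually_elim simp
    qed
    then have le': "(\<integral>\<^sup>+ \<xi>. ennreal (- ln \<bar>v \<bullet> \<xi>\<bar>) \<partial>lam) < ennreal D" using le by simp
    have ae0: "AE \<xi> in lam. 0 \<le> - ln \<bar>v \<bullet> \<xi>\<bar>" using nn sp by (intro AE_I2) simp
    have int: "integrable lam (\<lambda>\<xi>. - ln \<bar>v \<bullet> \<xi>\<bar>)"
      by (intro integrableI_nonneg meas ae0 less_trans[OF le']) simp
    have "ennreal (\<integral>\<xi>. - ln \<bar>v \<bullet> \<xi>\<bar> \<partial>lam) < ennreal D"
      using le' nn_integral_eq_integral[OF int ae0] by simp
    then have D: "(\<integral>\<xi>. - ln \<bar>v \<bullet> \<xi>\<bar> \<partial>lam) \<le> D"
      using ennreal_leI[of D "\<integral>\<xi>. - ln \<bar>v \<bullet> \<xi>\<bar> \<partial>lam"] by (meson leD linear)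
    have hv: "h v > 0" by (rule pos_even_pos[OF h(1) v])
    have "(\<integral>\<xi>. - ln (h v) - (- ln \<bar>v \<bullet> \<xi>\<bar>) \<partial>lam) \<le> (\<integral>\<xi>. ln (wulff_gauge h \<xi>) \<partial>lam)"
    proof (rule integral_mono_AE)
      show "integrable lam (\<lambda>\<xi>. - ln (h v) - (- ln \<bar>v \<bullet> \<xi>\<bar>))"
        by (intro Bochner_Integration.integrable_diff int) simp
      show "integrable lam (\<lambda>\<xi>. ln (wulff_gauge h \<xi>))" by (rule integrable_ln_gauge[OF lam h(1)])
      show "AE \<xi> in lam. - ln (h v) - (- ln \<bar>v \<bullet> \<xi>\<bar>) \<le> ln (wulff_gauge h \<xi>)"
        using ae
      proof eventually_elim
        case (elim \<xi>)
        then have p: "wulff_gauge h \<xi> > 0" by (intro wulff_gauge_pos[OF h(1)]) auto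
        have "ln \<bar>v \<bullet> \<xi>\<bar> \<le> ln (wulff_gauge h \<xi> * h v)"
          using wulff_gauge_lower_abs[OF h(1) v, of \<xi>] elim p hv by (subst ln_le_cancel_iff) auto
        also have "\<dots> = ln (wulff_gauge h \<xi>) + ln (h v)" using p hv by (simp add: ln_mult)
        finally show ?case by simp
      qed
    qed
    moreover have "(\<integral>\<xi>. - ln (h v) - (- ln \<bar>v \<bullet> \<xi>\<bar>) \<partial>lam) = (\<integral>\<xi>. - ln (h v) \<partial>lam) - (\<integral>\<xi>. - ln \<bar>v \<bullet> \<xi>\<bar> \<partial>lam)"
      by (intro Bochner_Integration.integral_diff int) simp
    ultimately have "- ln (h v) * measure lam (space lam) \<le> D"
      using D h(2) by (simp add: log_gauge_def mult.commute)
    then have "- ln (h v) \<le> D / measure lam (space lam)"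
      using m by (simp add: pos_le_divide_eq)
    then have "- (D / measure lam (space lam)) \<le> ln (h v)" by linarith
    then show ?thesis using hv by (simp add: r_def ln_ge_iff)
  qed
  then show thesis using that[of r] by (simp add: r_def)
qed

lemma upper_bound_vanishing:
  fixes \<mu> :: "'a::euclidean_space measure"
  assumes mu: "nonzero_finite_borel \<mu>" "vanishes_on_great_subspheres \<mu>"
    and G: "class_C G" "\<forall>u\<in>sphere 0 1. \<forall>t>0. psi_t G u t > 0" and r: "r > 0"
  obtains R where "\<And>h u. is_support h \<Longrightarrow> orlicz G \<mu> h \<le> orlicz G \<mu> (\<lambda>_. 1) \<Longrightarrow>
    \<forall>u\<in>sphere 0 1. r \<le> h u \<Longrightarrow> u \<in> sphere 0 1 \<Longrightarrow> h u \<le> R"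
proof (rule ccontr)
  let ?c = "orlicz G \<mu> (\<lambda>_. 1)"
  define P where "P h \<longleftrightarrow> orlicz G \<mu> h \<le> ?c \<and> (\<forall>u\<in>sphere 0 1. r \<le> h u)" for h
  assume nt: "\<not> thesis"
  have ex: "\<exists>h. P h \<and> is_support h \<and> (\<exists>u\<in>sphere 0 1. h u > R)" for R
  proof (rule ccontr)
    assume no: "\<not> ?thesis"
    have le: "h u \<le> R" if "is_support h" "P h" "u \<in> sphere 0 1" for h u
    proof (rule ccontr)
      assume "\<not> h u \<le> R"
      then have "R < h u" by simp
      then show False using no that by blast
    qed
    have thesis by (rule that, rule le) (simp_all add: P_def)
    with nt show False ..
  qed
  obtain H v where v: "v \<in> sphere 0 1" and PH: "\<And>n. P (H n)" and HS: "\<And>n. is_support (H n)"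
    and lim: "\<And>u. u \<in> sphere 0 1 \<Longrightarrow> v \<bullet> u \<noteq> 0 \<Longrightarrow> filterlim (\<lambda>n::nat. H n u) at_top sequentially"
    by (rule unbounded_supports[of P, OF ex]) (rule that)
  have H: "orlicz G \<mu> (H n) \<le> ?c" "\<forall>u\<in>sphere 0 1. r \<le> H n u" for n
    using PH by (auto simp: P_def)
  interpret finite_measure \<mu> using mu by (simp add: nonzero_finite_borel_def)
  have sp: "space \<mu> = sphere 0 1" by (rule space_borel_on_sphere[OF mu(1)])
  have const: "pos_even (\<lambda>_::'a. t)" if "t > 0" for t :: real using that by (simp add: pos_even_def)
  have c2: "continuous_on (sphere 0 1) (\<lambda>u. G u t)" if "t > 0" for t
    by (rule continuous_orlicz[OF G(1) const[OF that]])
  obtain b where b: "\<And>u. u \<in> sphere 0 1 \<Longrightarrow> \<bar>G u r\<bar> \<le> b" using continuous_sphere_bounded[OF c2[OF r]] by blast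
  have "sphere 0 1 \<inter> {x. v \<bullet> x = 0} \<in> null_sets \<mu>"
    using mu(2) v sets_hyperplane_complement(2)[OF mu(1)] by (auto simp: vanishes_on_great_subspheres_def null_sets_def)
  then have ae: "AE u in \<mu>. v \<bullet> u \<noteq> 0" by (rule AE_I') (use sp in auto)
  \<comment> \<open>Any constant above 1 would serve in place of 2.\<close>
  have "(\<integral>u. G u 2 \<partial>\<mu>) \<le> ?c"
  proof (rule integral_le_of_eventually_le[where b=b])
    show "finite_measure \<mu>" by unfold_locales
    show "integrable \<mu> (\<lambda>u. G u (H k u))" for k
      by (rule integrable_orlicz[OF mu(1) G(1) is_support_pos_even[OF HS]])
    show "integrable \<mu> (\<lambda>u. G u 2)" by (intro integrable_continuous_sphere[OF mu(1)] c2) simp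
    show "- b \<le> G u (H k u)" if "u \<in> space \<mu>" for k u
    proof -
      have u: "u \<in> sphere 0 1" using that sp by simp
      have "G u r \<le> G u (H k u)" using H(2) u by (intro class_C_mono[OF G u r]) auto
      then show ?thesis using b[OF u] by linarith
    qed
    show "(\<integral>u. G u (H k u) \<partial>\<mu>) \<le> ?c" for k using H(1)[of k] by (simp add: orlicz_def)
    show "AE u in \<mu>. \<forall>\<^sub>F k in sequentially. G u 2 \<le> G u (H k u)"
      using ae AE_space
    proof eventually_elim
      case (elim u)
      then have u: "u \<in> sphere 0 1" using sp by simp
      have "\<forall>\<^sub>F k in sequentially. 2 \<le> H k u" using lim[OF u elim(1)] by (simp add: filterlim_at_top)
      then show ?case by eventually_elim (intro class_C_mono[OF G u], auto)
    qed
  qed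
  moreover have "0 < (\<integral>u. G u 2 - G u 1 \<partial>\<mu>)"
    using class_C_strict_mono[OF G]
    by (intro integral_pos_sphere[OF mu(1)] continuous_on_diff c2) auto
  moreover have "(\<integral>u. G u 2 - G u 1 \<partial>\<mu>) = (\<integral>u. G u 2 \<partial>\<mu>) - ?c"
    unfolding orlicz_def
    by (intro Bochner_Integration.integral_diff integrable_continuous_sphere[OF mu(1)] c2) auto
  ultimately show False by linarith
qed

section \<open>Solutions\<close>

lemma solution_growing:
  fixes lam \<mu> :: "'a::euclidean_space measure"
  assumes lam: "class_M lam" "even_measure lam" "not_concentrated lam"
    and mu: "nonzero_finite_borel \<mu>" "even_measure \<mu>" "not_concentrated \<mu>"
    and even: "\<forall>\<xi>\<in>sphere 0 1. \<forall>t>0. \<Psi> \<xi> t = \<Psi> (- \<xi>) t"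
    and Psi: "class_GI \<Psi>"
  shows "\<exists>K. Kn_e K \<and> solves_eq \<Psi> lam \<mu> K"
proof -
  have nf: "nonzero_finite_borel lam" using lam(1) by (simp add: class_M_def)
  have P: "class_C \<Psi>" "\<forall>u\<in>sphere 0 1. \<forall>t>0. psi_t \<Psi> u t > 0"
    using Psi by (simp_all add: class_GI_def)
  obtain R where R: "\<And>h u. is_support h \<Longrightarrow> orlicz \<Psi> \<mu> h \<le> orlicz \<Psi> \<mu> (\<lambda>_. 1) \<Longrightarrow> u \<in> sphere 0 1 \<Longrightarrow> h u \<le> R"
    using upper_bound_growing[OF mu(1,3) Psi] by blast
  obtain r where r: "r > 0" "\<And>h u. is_support h \<Longrightarrow> log_gauge lam h \<le> 0 \<Longrightarrow> \<forall>u\<in>sphere 0 1. h u \<le> R \<Longrightarrow>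
    u \<in> sphere 0 1 \<Longrightarrow> r \<le> h u"
    using lower_bound_not_concentrated[OF nf lam(3)] by blast
  have "\<forall>h. is_support h \<and> orlicz \<Psi> \<mu> h \<le> orlicz \<Psi> \<mu> (\<lambda>_. 1) \<and> log_gauge lam h \<le> 0 \<longrightarrow>
      (\<forall>u\<in>sphere 0 1. r \<le> h u \<and> h u \<le> R)"
    using R r(2) by blast
  then obtain h where "is_support h" "solves_eq \<Psi> lam \<mu> (wulff h)"
    using exists_solution[OF lam(1,2) mu(1,2) P even r(1)] by blast
  then show ?thesis using wulff_Kn_e is_support_pos_even by blast
qed

section \<open>Reduction of the decreasing case to the increasing one\<close>

lemma psi_t_uminus:
  assumes "class_C \<Psi>" "u \<in> sphere 0 1" "t > 0"
  shows "psi_t (\<lambda>u t. - \<Psi> u t) u t = - psi_t \<Psi> u t"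
  using DERIV_minus[OF class_C_has_derivative[OF assms]] unfolding psi_t_def[of "\<lambda>u t. - \<Psi> u t"]
  by (rule DERIV_imp_deriv)

lemma class_C_uminus:
  assumes "class_C \<Psi>"
  shows "class_C (\<lambda>u t. - \<Psi> u t)"
proof -
  have 1: "continuous_on (sphere 0 1 \<times> {0<..}) (\<lambda>p. - \<Psi> (fst p) (snd p))"
    "continuous_on (sphere 0 1 \<times> {0<..}) (\<lambda>p. - psi_t \<Psi> (fst p) (snd p))"
    by (intro continuous_intros class_C_continuous[OF assms]; auto)+
  have "continuous_on (sphere 0 1 \<times> {0<..}) (\<lambda>p. psi_t (\<lambda>u t. - \<Psi> u t) (fst p) (snd p))"
    using 1(2) by (rule continuous_on_eq) (auto simp: psi_t_uminus[OF assms])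
  then show ?thesis
    using assms 1(1) by (auto simp: class_C_def case_prod_beta)
qed

lemma J_tilde_uminus:
  assumes lam: "class_M lam" and h: "is_support h" and Psi: "class_C \<Psi>"
    and om: "\<omega> \<in> sets (sphere_borel :: 'a::euclidean_space measure)"
  shows "J_tilde (\<lambda>u t. - \<Psi> u t) lam (wulff h) \<omega> = - J_tilde \<Psi> lam (wulff h) \<omega>"
proof -
  have pe: "pos_even h" using h by (rule is_support_pos_even)
  have "psi_t (\<lambda>u t. - \<Psi> u t) (gauss h x) (h (gauss h x)) = - psi_t \<Psi> (gauss h x) (h (gauss h x))" for x
    by (intro psi_t_uminus[OF Psi] gauss_sphere[OF pe] pos_even_pos[OF pe])
  then show ?thesis
    unfolding J_tilde_wulff[OF lam h class_C_uminus[OF Psi] om] J_tilde_wulff[OF lam h Psi om] by simp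
qed

lemma sphere_in_sets: "nonzero_finite_borel M \<Longrightarrow> sphere 0 1 \<in> sets M"
  using sets.top[of M] space_borel_on_sphere[of M] by simp

lemma solution_decreasing:
  fixes lam \<mu> :: "'a::euclidean_space measure"
  assumes lam: "class_M lam" "even_measure lam"
    and mu: "nonzero_finite_borel \<mu>" "even_measure \<mu>" "vanishes_on_great_subspheres \<mu>"
    and even: "\<forall>\<xi>\<in>sphere 0 1. \<forall>t>0. \<Psi> \<xi> t = \<Psi> (- \<xi>) t"
    and C: "(INF v\<in>sphere 0 1. log_integral lam v) > ereal C"
    and Psi: "class_Cd \<Psi>"
  shows "\<exists>K. Kn_e K \<and> solves_eq \<Psi> lam \<mu> K"
proof -
  let ?G = "\<lambda>u t. - \<Psi> u t"
  have nf: "nonzero_finite_borel lam" using lam(1) by (simp add: class_M_def)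
  have P: "class_C \<Psi>" using Psi by (simp add: class_Cd_def)
  have G: "class_C ?G" "\<forall>u\<in>sphere 0 1. \<forall>t>0. psi_t ?G u t > 0"
    using class_C_uminus[OF P] Psi psi_t_uminus[OF P] by (auto simp: class_Cd_def)
  have even': "\<forall>\<xi>\<in>sphere 0 1. \<forall>t>0. ?G \<xi> t = ?G (- \<xi>) t"
    unfolding neg_equal_iff_equal by (rule even)
  obtain r where r: "r > 0" "\<And>h u. pos_even h \<Longrightarrow> log_gauge lam h \<le> 0 \<Longrightarrow> u \<in> sphere 0 1 \<Longrightarrow> r \<le> h u"
    using lower_bound_log_integral[OF nf C] by blast
  obtain R where R: "\<And>h u. is_support h \<Longrightarrow> orlicz ?G \<mu> h \<le> orlicz ?G \<mu> (\<lambda>_. 1) \<Longrightarrow>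
    \<forall>u\<in>sphere 0 1. r \<le> h u \<Longrightarrow> u \<in> sphere 0 1 \<Longrightarrow> h u \<le> R"
    using upper_bound_vanishing[OF mu(1,3) G r(1)] by blast
  have "\<forall>h. is_support h \<and> orlicz ?G \<mu> h \<le> orlicz ?G \<mu> (\<lambda>_. 1) \<and> log_gauge lam h \<le> 0 \<longrightarrow>
      (\<forall>u\<in>sphere 0 1. r \<le> h u \<and> h u \<le> R)"
    using R r(2) is_support_pos_even by blast
  then obtain h where h: "is_support h" "solves_eq ?G lam \<mu> (wulff h)"
    using exists_solution[OF lam mu(1,2) G even' r(1)] by blast
  have "sets \<mu> = sets sphere_borel" using mu by (simp add: nonzero_finite_borel_def borel_on_sphere_def)
  then have "J_tilde ?G lam (wulff h) \<omega> = - J_tilde \<Psi> lam (wulff h) \<omega>" if "\<omega> \<in> sets \<mu>" for \<omega>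
    using J_tilde_uminus[OF lam(1) h(1) P] that by simp
  \<comment> \<open>The sign change affects numerator and denominator alike and leaves the quotient
    unchanged.\<close>
  then have "solves_eq \<Psi> lam \<mu> (wulff h)"
    using h(2) sphere_in_sets[OF mu(1)] by (simp add: solves_eq_def)
  then show ?thesis using wulff_Kn_e is_support_pos_even h(1) by blast
qed

text \<open>If \<open>\<nu>\<close> were carried by \<open>v\<^sup>\<bottom>\<close>, then almost no radial direction could have its normal off
  \<open>v\<^sup>\<bottom>\<close>; but normals at directions close to \<open>v\<close> have positive inner product with \<open>v\<close>.\<close>

lemma solution_imp_not_concentrated:
  fixes lam \<nu> :: "'a::euclidean_space measure"
  assumes lam: "class_M lam" "strictly_positive_on_open lam" and Psi: "class_GI \<Psi>"
    and nu: "nonzero_finite_borel \<nu>" and K: "Kn_e K" "solves_eq \<Psi> lam \<nu> K"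
  shows "not_concentrated \<nu>"
proof (rule ccontr)
  assume "\<not> not_concentrated \<nu>"
  then obtain v where v: "v \<in> sphere 0 1" and z: "emeasure \<nu> (sphere 0 1 - {x. v \<bullet> x = 0}) = 0"
    by (auto simp: not_concentrated_def)
  define h where "h = support_fun K"
  have h: "is_support h" "wulff h = K"
    unfolding h_def by (rule is_support_support_fun[OF K(1)], rule wulff_support_fun[OF K(1)])
  have pe: "pos_even h" using h(1) by (rule is_support_pos_even)
  have P: "class_C \<Psi>" "\<forall>u\<in>sphere 0 1. \<forall>t>0. psi_t \<Psi> u t > 0"
    using Psi by (simp_all add: class_GI_def)
  have nf: "nonzero_finite_borel lam" using lam(1) by (simp add: class_M_def)
  have spl: "space lam = sphere 0 1" by (rule space_borel_on_sphere[OF nf])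
  have sets: "sets \<nu> = sets sphere_borel" using nu by (simp add: nonzero_finite_borel_def borel_on_sphere_def)
  interpret nu: finite_measure \<nu> using nu by (simp add: nonzero_finite_borel_def)
  let ?w = "sphere 0 1 - {x. v \<bullet> x = 0}"
  have om: "?w \<in> sets \<nu>" by (rule sets_hyperplane_complement[OF nu])
  define q where "q u = 1 / (h u * psi_t \<Psi> u (h u))" for u
  have q: "q u > 0" if "u \<in> sphere 0 1" for u
    using that P(2) pos_even_pos[OF pe that] by (simp add: q_def)
  have "measure \<nu> (sphere 0 1) \<noteq> 0"
    using nu by (simp add: nonzero_finite_borel_def nu.emeasure_eq_measure)
  \<comment> \<open>On the whole sphere the left side of the identity is 1, whereas a vanishing
    denominator would make the right side 0 by the convention for division.\<close>
  then have "J_tilde \<Psi> lam K (sphere 0 1) \<noteq> 0"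
    using K(2) sphere_in_sets[OF nu] by (force simp: solves_eq_def)
  moreover have "J_tilde \<Psi> lam K ?w / J_tilde \<Psi> lam K (sphere 0 1) = 0"
    using K(2) om z by (metis div_0 enn2real_0 measure_def solves_eq_def)
  ultimately have "J_tilde \<Psi> lam K ?w = 0" by simp
  then have J0: "(\<integral>x. indicator ?w (gauss h x) * q (gauss h x) \<partial>lam) = 0"
    using J_tilde_wulff[OF lam(1) h(1) P(1), of ?w] om sets h(2) by (simp add: q_def)
  have cq: "continuous_on (sphere 0 1) q"
  proof -
    have "continuous_on (sphere 0 1) (\<lambda>u. h u * psi_t \<Psi> u (h u))"
      using continuous_psi_t_mult[OF P(1) pe] by (simp add: mult.commute)
    moreover have "\<forall>u\<in>sphere 0 1. h u * psi_t \<Psi> u (h u) \<noteq> 0"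
      using P(2) pos_even_pos[OF pe] by (metis less_irrefl mult_pos_pos)
    ultimately show ?thesis unfolding q_def by (intro continuous_on_divide continuous_on_const)
  qed
  have int: "integrable lam (\<lambda>x. indicator ?w (gauss h x) * q (gauss h x))"
  proof (rule Bochner_Integration.integrable_bound[OF integrable_comp_gauss[OF nf pe cq]])
    have "(\<lambda>x. indicator ?w (gauss h x) :: real) \<in> borel_measurable lam"
      using om sets by (intro measurable_compose[OF measurable_gauss[OF nf pe]] borel_measurable_indicator) simp
    then show "(\<lambda>x. indicator ?w (gauss h x) * q (gauss h x)) \<in> borel_measurable lam"
      using measurable_comp_gauss[OF nf pe cq] by measurable
    show "AE x in lam. norm (indicator ?w (gauss h x) * q (gauss h x)) \<le> norm (q (gauss h x))"
      by (auto simp: indicator_def)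
  qed
  have "AE x in lam. indicator ?w (gauss h x) * q (gauss h x) = 0"
    using J0 integral_nonneg_eq_0_iff_AE[OF int] q[OF gauss_sphere[OF pe]] by (auto simp: less_imp_le)
  then have ae: "AE x in lam. x \<notin> nonregular h \<and> v \<bullet> gauss h x = 0"
    using AE_regular[OF lam(1) pe]
  proof eventually_elim
    case (elim x)
    then show ?case
      using q[OF gauss_sphere[OF pe, of x]] gauss_sphere[OF pe, of x] by (auto simp: indicator_def split: if_splits)
  qed
  obtain m M where m: "0 < m" "\<And>u. u \<in> sphere 0 1 \<Longrightarrow> m \<le> h u" "\<And>u. u \<in> sphere 0 1 \<Longrightarrow> h u \<le> M"
    using pos_even_bounds[OF pe] by metis
  have "M > 0" using m v by force
  \<comment> \<open>If the normal \<open>u\<close> at \<open>x\<close> is orthogonal to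
    \<open>v\<close>, then \<open>u \<bullet> x \<le> norm (x - v)\<close>; but
    \<open>u \<bullet> x\<close> is the product of the gauge, at least \<open>1 / M\<close>, and
    \<open>h u \<ge> m\<close>. This fixes the radius \<open>m / M\<close>.\<close>
  define U where "U = sphere 0 1 \<inter> ball v (m / M)"
  have "openin (top_of_set (sphere 0 1)) U" "v \<in> U"
    using v m(1) \<open>M > 0\<close> by (auto simp: U_def)
  then have Upos: "emeasure lam U > 0"
    using lam(2) by (auto simp: strictly_positive_on_open_def)
  have "U \<in> sets lam" unfolding U_def sets_nonzero_finite_borel[OF nf] sets_restrict_space by (auto intro!: imageI)
  moreover have "AE x in lam. x \<notin> U"
    using ae AE_space
  proof eventually_elim
    case (elim x)
    then have x: "x \<in> sphere 0 1" using spl by simp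
    let ?u = "gauss h x"
    have uS: "?u \<in> sphere 0 1" by (rule gauss_sphere[OF pe])
    have "?u \<bullet> x = wulff_gauge h x * h ?u"
      using gauss_in_normals[OF pe] elim by (simp add: normals_def)
    moreover have "1 / M * m \<le> wulff_gauge h x * h ?u"
      using wulff_gauge_bounds(2)[OF pe x m(3)] m(1) m(2)[OF uS] wulff_gauge_nonneg(2)[OF pe]
      by (intro mult_mono) auto
    moreover have "?u \<bullet> x = ?u \<bullet> (x - v)" using elim inner_commute[of v ?u] by (simp add: inner_diff_right)
    moreover have "?u \<bullet> (x - v) \<le> norm (x - v)" using norm_cauchy_schwarz[of ?u "x - v"] uS by simp
    ultimately have "m / M \<le> norm (x - v)" by simp
    then show ?case by (simp add: U_def dist_norm norm_minus_commute)
  qed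
  ultimately have "emeasure lam U = 0"
    using AE_iff_measurable[of U lam "\<lambda>x. x \<notin> U"] sets.sets_into_space by auto
  then show False using Upos by simp
qed

theorem theorem6p4:
  fixes lam \<mu> :: "'a::euclidean_space measure"
    and \<Psi> :: "'a \<Rightarrow> real \<Rightarrow> real"
  assumes n: "DIM('a) \<ge> 2"
    and hlam: "class_M lam" "even_measure lam" "not_concentrated lam"
    and mu: "nonzero_finite_borel \<mu>" "even_measure \<mu>" "not_concentrated \<mu>"
    and Psi: "class_C \<Psi>"
    and Psi_even: "\<forall>\<xi>\<in>sphere 0 1. \<forall>t>0. \<Psi> \<xi> t = \<Psi> (- \<xi>) t"
  shows "(class_GI \<Psi> \<longrightarrow> (\<exists>K. Kn_e K \<and> solves_eq \<Psi> lam \<mu> K))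
       \<and> (class_GI \<Psi> \<and> strictly_positive_on_open lam \<longrightarrow>
            (\<forall>\<nu> :: 'a measure. nonzero_finite_borel \<nu> \<and> even_measure \<nu>
                \<and> (\<exists>K. Kn_e K \<and> solves_eq \<Psi> lam \<nu> K) \<longrightarrow> not_concentrated \<nu>))
       \<and> (vanishes_on_great_subspheres \<mu>
            \<and> (\<exists>C::real. (INF v\<in>sphere 0 1. log_integral lam v) > ereal C)
            \<and> class_Cd \<Psi>
            \<longrightarrow> (\<exists>K. Kn_e K \<and> solves_eq \<Psi> lam \<mu> K))"
  using solution_growing[OF hlam mu Psi_even] solution_imp_not_concentrated[OF hlam(1)]
    solution_decreasing[OF hlam(1,2) mu(1,2) _ Psi_even] by blast

end
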